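(* Let $X_s=B_s+\sum_{i=1}^{N_s}\eta_i$ be a Brownian motion with random jumps as described in the context. For any $a,c\in\mathbb R$ and $b,d>0$ such that $at+b>-(ct+d)$ for $t>0$, it holds $$\begin{aligned} &P\big(-(cs+d)<X_s<as+b,\ 0\le s<t\big)\\ &=\sum_{k=0}^{\infty}P(N_t=k)\int_{\mathcal S_k^t}dF_k\Big(t_1,\ldots,\sum_{i=1}^kt_i\Big)\int_{\mathbb R^k}dG_k(h_1,\ldots,h_k)\int_{\alpha_1}^{\beta_1}d\Phi_{t_1}(x_1)\cdots\int_{\alpha_k}^{\beta_k}d\Phi_{t_k}(x_k)\\ &\quad\prod_{i=1}^k\Big(1-\vartheta(b_i,a,-d_i,-c;t_i,x_i)-\vartheta(d_i,c,-b_i,-a;t_i,-x_i)\Big)\\ &\quad\cdot\Big(1-\chi\big(b_{k+1},a,-d_{k+1},-c;\,t-\textstyle\sum_{i=1}^kt_i\big)-\chi\big(d_{k+1},c,-b_{k+1},-a;\,t-\sum_{i=1}^kt_i\big)\Big), \end{aligned}$$ where $$\begin{aligned} &b_1=b,\qquad b_{i+1}=at_i+b_i-x_i-h_i,\quad i=1,\ldots,k;\\ &\beta_i=\min\{at_i+b_i,\ at_i+b_i-h_i\},\quad i=1,\ldots,k;\\ &d_1=d,\qquad d_{i+1}=ct_i+d_i+x_i+h_i,\quad i=1,\ldots,k;\\ &\alpha_i=-\min\{ct_i+d_i,\ ct_i+d_i+h_i\},\quad i=1,\ldots,k. \end{aligned}$$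
   Context: $(B_s)_{s\ge0}$ is a standard Brownian motion; $(N_s)_{s\ge0}$ is any integer-valued stochastic process starting with $N_0=0$ (for example a Poisson process); $(\eta_i)_{i\ge1}$ is a family of real random variables representing jump sizes, not necessarily independent or identically distributed. $(B_s)$, $(N_s)$ and $(\eta_i)$ are mutually independent. The jump times are $\tau_1=\inf\{s>0: N_s\ne N_{s^-}\}$ and $\tau_k=\inf\{s>\tau_{k-1}: N_s\ne N_{s^-}\}$ for $k\ge2$, where $N_{s^-}=\lim_{r\to s^-}N_r$. For each $k\ge1$, $F_k(t_1,\ldots,t_k)$ is the joint distribution function of the jump times $(\tau_1,\ldots,\tau_k)$ and $G_k(h_1,\ldots,h_k)$ is the joint distribution function of the corresponding jump heights $(\eta_1,\ldots,\eta_k)$. For each $t>0$ the support of $F_k$ is $\mathcal S_k^t=\{(s_1,\ldots,s_k):0<s_1<\cdots<s_k<t\}$; in $dF_k(t_1,\ldots,\sum_{i=1}^kt_i)$ the arguments are $t_1,\ t_1+t_2,\ \ldots,\ \sum_{i=1}^kt_i$. $\Phi_s(x)=\frac1{\sqrt{2\pi s}}\int_{-\infty}^xe^{-y^2/(2s)}dy$ is the distribution function of $B_s$. For $k=0$ there are no integrals and the empty product is $1$. For $T>0$ and $x<\delta_1T+\gamma_1$, $$\vartheta(\gamma_1,\delta_1,\gamma_2,\delta_2;T,x)=P\big(\exists\,s<T:\ B_s\ge\delta_1s+\gamma_1,\ B_u>\delta_2u+\gamma_2\ \forall u\in[0,s]\ \big|\ B_T=x\big),$$ and $$\chi(\gamma_1,\delta_1,\gamma_2,\delta_2;T)=P\big(\exists\,s<T:\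 B_s\ge\delta_1s+\gamma_1,\ B_u>\delta_2u+\gamma_2\ \forall u\in[0,s]\big).$$
   Formalization: N is a unit-jump counting process with right-continuous paths, F_k is the law of the jump times given N_t=k, and an integral from α_i to β_i is 0 if β_i ≤ α_i; without this the formula fails, e.g. when N jumps up and back down before t. *)

theory Defs
  imports "HOL-Probability.Probability"
begin

definition standard_brownian_motion :: "'a measure \<Rightarrow> (real \<Rightarrow> 'a \<Rightarrow> real) \<Rightarrow> bool" where
  "standard_brownian_motion M B \<longleftrightarrow>
     (\<forall>s\<ge>0. B s \<in> borel_measurable M) \<and>
     (\<forall>\<omega>\<in>space M. B 0 \<omega> = 0) \<and>
     (\<forall>\<omega>\<in>space M. continuous_on {0..} (\<lambda>s. B s \<omega>)) \<and>
     (\<forall>(n::nat) (r::nat \<Rightarrow> real). 0 \<le> r 0 \<and> (\<forall>i<n. r i < r (Suc i)) \<longrightarrow>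
        prob_space.indep_vars M (\<lambda>_. borel) (\<lambda>i \<omega>. B (r (Suc i)) \<omega> - B (r i) \<omega>) {..<n}) \<and>
     (\<forall>s u. 0 \<le> s \<and> s < u \<longrightarrow>
        distributed M lborel (\<lambda>\<omega>. B u \<omega> - B s \<omega>) (normal_density 0 (sqrt (u - s))))"

text \<open>The number of jumps up to time \<open>s\<close>: values in the natural numbers, start in 0, cadlag
  paths. Jumps have size one, since the jump of \<open>X\<close> at the \<open>k\<close>-th jump time of \<open>N\<close> is meant to be
  the single height \<open>\<eta> k\<close>. Nothing is assumed about the law of the process.\<close>

definition counting_process :: "'a measure \<Rightarrow> (real \<Rightarrow> 'a \<Rightarrow> nat) \<Rightarrow> bool" where
  "counting_process M N \<longleftrightarrow>
     (\<forall>s\<ge>0. N s \<in> measurable M (count_space UNIV)) \<and>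
     (\<forall>\<omega>\<in>space M. N 0 \<omega> = 0) \<and>
     (\<forall>\<omega>\<in>space M. \<forall>s\<ge>0. ((\<lambda>r. N r \<omega>) \<longlongrightarrow> N s \<omega>) (at_right s)) \<and>
     (\<forall>\<omega>\<in>space M. \<forall>s>0. \<exists>n. ((\<lambda>r. N r \<omega>) \<longlongrightarrow> n) (at_left s) \<and>
        (N s \<omega> = n \<or> N s \<omega> = Suc n))"

definition left_limit :: "(real \<Rightarrow> nat) \<Rightarrow> real \<Rightarrow> nat" where
  "left_limit f s = Lim (at_left s) f"

text \<open>Jump times, \<open>\<infinity>\<close> if there is no further jump; \<open>jump_time N 0 = 0\<close> only serves to start
  the recursion.\<close>

primrec jump_time :: "(real \<Rightarrow> 'a \<Rightarrow> nat) \<Rightarrow> nat \<Rightarrow> 'a \<Rightarrow> ereal" where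
  "jump_time N 0 \<omega> = 0"
| "jump_time N (Suc k) \<omega> =
     Inf {ereal s |s. jump_time N k \<omega> < ereal s \<and> N s \<omega> \<noteq> left_limit (\<lambda>r. N r \<omega>) s}"

definition jump_simplex :: "nat \<Rightarrow> real \<Rightarrow> (nat \<Rightarrow> real) set" where
  "jump_simplex k t =
     {s \<in> {1..k} \<rightarrow>\<^sub>E UNIV. (\<forall>i\<in>{1..k}. 0 < s i \<and> s i < t) \<and> strict_mono_on {1..k} s}"

text \<open>The measure with joint distribution function \<open>F\<^sub>k\<close>. As \<open>F\<^sub>k\<close> lives on times before \<open>t\<close>
  and is weighted with the probability of \<open>N t = k\<close>, it is the law of the first \<open>k\<close> jump times
  given \<open>N t = k\<close> (the null measure if that event has probability zero). On this event the jump
  times are finite, so nothing is lost by \<open>real_of_ereal\<close>.\<close>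

definition jump_time_law ::
  "'a measure \<Rightarrow> (real \<Rightarrow> 'a \<Rightarrow> nat) \<Rightarrow> nat \<Rightarrow> real \<Rightarrow> (nat \<Rightarrow> real) measure" where
  "jump_time_law M N k t =
     distr (uniform_measure M {\<omega> \<in> space M. N t \<omega> = k}) (Pi\<^sub>M {1..k} (\<lambda>_. borel))
       (\<lambda>\<omega>. \<lambda>i\<in>{1..k}. real_of_ereal (jump_time N i \<omega>))"

definition jump_height_law ::
  "'a measure \<Rightarrow> (nat \<Rightarrow> 'a \<Rightarrow> real) \<Rightarrow> nat \<Rightarrow> (nat \<Rightarrow> real) measure" where
  "jump_height_law M \<eta> k =
     distr M (Pi\<^sub>M {1..k} (\<lambda>_. borel)) (\<lambda>\<omega>. \<lambda>i\<in>{1..k}. \<eta> i \<omega>)"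

definition generated_events ::
  "'a measure \<Rightarrow> 'i set \<Rightarrow> 'b measure \<Rightarrow> ('i \<Rightarrow> 'a \<Rightarrow> 'b) \<Rightarrow> 'a set set" where
  "generated_events M I K X =
     sigma_sets (space M) (\<Union>i\<in>I. {X i -` A \<inter> space M |A. A \<in> sets K})"

definition mutually_independent ::
  "'a measure \<Rightarrow> (real \<Rightarrow> 'a \<Rightarrow> real) \<Rightarrow> (real \<Rightarrow> 'a \<Rightarrow> nat) \<Rightarrow> (nat \<Rightarrow> 'a \<Rightarrow> real) \<Rightarrow> bool" where
  "mutually_independent M B N \<eta> \<longleftrightarrow>
     prob_space.indep_sets M
       (\<lambda>j. [generated_events M {0..} borel B,
             generated_events M {0..} (count_space UNIV) N,
             generated_events M {1..} borel \<eta>] ! j) {..<3}"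

text \<open>Conditional probability of \<open>E\<close> given \<open>X = x\<close>: the Radon-Nikodym derivative at \<open>x\<close> of
  \<open>A \<mapsto> P (E \<inter> {X \<in> A})\<close> with respect to the law of \<open>X\<close>. It is determined up to null sets of
  that law.\<close>

definition cond_prob_at :: "'a measure \<Rightarrow> 'a set \<Rightarrow> ('a \<Rightarrow> real) \<Rightarrow> real \<Rightarrow> real" where
  "cond_prob_at M E X x =
     enn2real (RN_deriv (distr M borel X) (distr (density M (indicator E)) borel X) x)"

definition crossing_event ::
  "'a measure \<Rightarrow> (real \<Rightarrow> 'a \<Rightarrow> real) \<Rightarrow> real \<Rightarrow> real \<Rightarrow> real \<Rightarrow> real \<Rightarrow> real \<Rightarrow> 'a set" where
  "crossing_event M B \<gamma>1 \<delta>1 \<gamma>2 \<delta>2 T =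
     {\<omega> \<in> space M. \<exists>s\<in>{0..<T}. B s \<omega> \<ge> \<delta>1 * s + \<gamma>1 \<and>
        (\<forall>u\<in>{0..s}. B u \<omega> > \<delta>2 * u + \<gamma>2)}"

definition theta ::
  "'a measure \<Rightarrow> (real \<Rightarrow> 'a \<Rightarrow> real) \<Rightarrow> real \<Rightarrow> real \<Rightarrow> real \<Rightarrow> real \<Rightarrow> real \<Rightarrow> real \<Rightarrow> real" where
  "theta M B \<gamma>1 \<delta>1 \<gamma>2 \<delta>2 T x = cond_prob_at M (crossing_event M B \<gamma>1 \<delta>1 \<gamma>2 \<delta>2 T) (B T) x"

definition chi ::
  "'a measure \<Rightarrow> (real \<Rightarrow> 'a \<Rightarrow> real) \<Rightarrow> real \<Rightarrow> real \<Rightarrow> real \<Rightarrow> real \<Rightarrow> real \<Rightarrow> real" where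
  "chi M B \<gamma>1 \<delta>1 \<gamma>2 \<delta>2 T = measure M (crossing_event M B \<gamma>1 \<delta>1 \<gamma>2 \<delta>2 T)"

definition Phi :: "real \<Rightarrow> real \<Rightarrow> real" where
  "Phi s x = 1 / sqrt (2 * pi * s) * (LBINT y:{..x}. exp (- y\<^sup>2 / (2 * s)))"

definition waiting_time :: "(nat \<Rightarrow> real) \<Rightarrow> nat \<Rightarrow> real" where
  "waiting_time s i = s i - (if i = 1 then 0 else s (i - 1))"

text \<open>The sequences \<open>b\<^sub>i\<close> and \<open>d\<^sub>i\<close> start at index 1; index 0 is not used. The last three
  arguments are the waiting times, the jump heights and the increments of the Brownian motion.\<close>

fun b_seq :: "real \<Rightarrow> real \<Rightarrow> (nat \<Rightarrow> real) \<Rightarrow> (nat \<Rightarrow> real) \<Rightarrow> (nat \<Rightarrow> real) \<Rightarrow> nat \<Rightarrow> real" where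
  "b_seq a b t h x 0 = b"
| "b_seq a b t h x (Suc 0) = b"
| "b_seq a b t h x (Suc (Suc i)) =
     a * t (Suc i) + b_seq a b t h x (Suc i) - x (Suc i) - h (Suc i)"

fun d_seq :: "real \<Rightarrow> real \<Rightarrow> (nat \<Rightarrow> real) \<Rightarrow> (nat \<Rightarrow> real) \<Rightarrow> (nat \<Rightarrow> real) \<Rightarrow> nat \<Rightarrow> real" where
  "d_seq c d t h x 0 = d"
| "d_seq c d t h x (Suc 0) = d"
| "d_seq c d t h x (Suc (Suc i)) =
     c * t (Suc i) + d_seq c d t h x (Suc i) + x (Suc i) + h (Suc i)"

definition beta_seq ::
  "real \<Rightarrow> real \<Rightarrow> (nat \<Rightarrow> real) \<Rightarrow> (nat \<Rightarrow> real) \<Rightarrow> (nat \<Rightarrow> real) \<Rightarrow> nat \<Rightarrow> real" where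
  "beta_seq a b t h x i =
     min (a * t i + b_seq a b t h x i) (a * t i + b_seq a b t h x i - h i)"

definition alpha_seq ::
  "real \<Rightarrow> real \<Rightarrow> (nat \<Rightarrow> real) \<Rightarrow> (nat \<Rightarrow> real) \<Rightarrow> (nat \<Rightarrow> real) \<Rightarrow> nat \<Rightarrow> real" where
  "alpha_seq c d t h x i =
     - min (c * t i + d_seq c d t h x i) (c * t i + d_seq c d t h x i + h i)"

text \<open>\<open>iterated_integral \<mu> \<alpha> \<beta> k f x\<close> integrates \<open>f\<close> over the coordinates 1 to \<open>k\<close>, coordinate \<open>k\<close>
  innermost; the limits \<open>\<alpha> x i\<close> and \<open>\<beta> x i\<close> may depend on the coordinates before \<open>i\<close>. The
  integral over coordinate \<open>i\<close> vanishes if \<open>\<beta> x i \<le> \<alpha> x i\<close>: then the \<open>i\<close>-th jump necessarily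
  leaves the strip. A sign-reversed integral would be wrong here.\<close>

primrec iterated_integral ::
  "(nat \<Rightarrow> real measure) \<Rightarrow> ((nat \<Rightarrow> real) \<Rightarrow> nat \<Rightarrow> real) \<Rightarrow> ((nat \<Rightarrow> real) \<Rightarrow> nat \<Rightarrow> real) \<Rightarrow>
   nat \<Rightarrow> ((nat \<Rightarrow> real) \<Rightarrow> real) \<Rightarrow> (nat \<Rightarrow> real) \<Rightarrow> real" where
  "iterated_integral \<mu> \<alpha> \<beta> 0 f x = f x"
| "iterated_integral \<mu> \<alpha> \<beta> (Suc k) f x =
     iterated_integral \<mu> \<alpha> \<beta> k
       (\<lambda>x. LINT y:{\<alpha> x (Suc k)<..<\<beta> x (Suc k)}|\<mu> (Suc k). f (x(Suc k := y))) x"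

end

theory Submission imports Defs begin

text \<open>Fix the jump times and heights. Between consecutive jumps \<open>X\<close> is a shifted Brownian motion, so
  by the Markov property of the Brownian path at the jump times, staying in the strip splits into
  independent pieces that start at \<open>0\<close> with the shifted boundaries \<open>b\<^sub>i\<close>, \<open>d\<^sub>i\<close>. A path leaves a
  strip first through one of its two boundaries, so for one piece the complement consists of two disjoint
  crossing events; the second is a crossing event of the reflected motion, which has the same law.
  No Brownian bridge is needed: the iterated integral evaluates \<open>theta\<close> at \<open>x\<^sub>i\<close> with all other
  parameters held fixed, so the defining property of the Radon-Nikodym derivative, for one set of
  parameters at a time, gives the joint law of the non-crossing event and the end point. Working from
  the innermost integral outwards, joint measurability of \<open>theta\<close> in its parameters never enters.
  Averaging over the jump times and heights, which are independent of the path, and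
  summing over \<open>N t = k\<close> finishes the proof.\<close>

section \<open>Continuous paths and their sigma-algebra\<close>

text \<open>The law of the motion is moved to the space of continuous paths, where it is determined
  by the Brownian axioms. So a restarted or reflected motion may be replaced by the original one,
  and the future after a jump by an independent copy. Strip and crossing events quantify over
  uncountably many times, so continuity must reduce them to rational times; with jump times and
  heights as further arguments, joint measurability of the strip event is what justifies Fubini.
  Formula and event disagree at one place: the limits \<open>alpha_seq\<close> and
  \<open>beta_seq\<close> force the value just before a jump to lie strictly inside the strip, while
  the event sees that value only as a left limit and yields a weak inequality. A discrepancy
  requires hitting one of finitely many levels at fixed times, which has Wiener measure zero. As
  \<open>jump_time_law\<close> is conditional on \<open>N t = k\<close>, independence is needed
  under that conditioning; it survives because the event belongs to the sigma-algebra of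
  \<open>N\<close>.\<close>

definition paths :: "(real \<Rightarrow> real) set" where
  "paths = {w. continuous_on {0..} w \<and> w 0 = 0}"

definition cylinder :: "real set \<Rightarrow> (real \<Rightarrow> real set) \<Rightarrow> (real \<Rightarrow> real) set" where
  "cylinder J A = {w \<in> paths. \<forall>j\<in>J. w j \<in> A j}"

text \<open>Only times in \<open>{0..}\<close> are constrained: paths are total functions on the
  reals, and neither the continuity in \<open>paths\<close> nor this sigma-algebra says anything
  about negative arguments.\<close>

definition cylinders :: "(real \<Rightarrow> real) set set" where
  "cylinders = {cylinder J A |J A. finite J \<and> J \<subseteq> {0..} \<and> (\<forall>j\<in>J. A j \<in> sets borel)}"

definition path_measure :: "(real \<Rightarrow> real) measure" where
  "path_measure = sigma paths cylinders"

lemma cylinders_Pow: "cylinders \<subseteq> Pow paths"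
  by (auto simp: cylinders_def cylinder_def)

lemma space_path_measure[simp]: "space path_measure = paths"
  by (simp add: path_measure_def cylinders_Pow)

lemma sets_path_measure: "sets path_measure = sigma_sets paths cylinders"
  by (simp add: path_measure_def cylinders_Pow)

lemma cylinderI:
  "finite J \<Longrightarrow> J \<subseteq> {0..} \<Longrightarrow> (\<And>j. j \<in> J \<Longrightarrow> A j \<in> sets borel) \<Longrightarrow> cylinder J A \<in> cylinders"
  by (auto simp: cylinders_def)

lemma Int_stable_cylinders: "Int_stable cylinders"
proof (rule Int_stableI)
  fix a b assume "a \<in> cylinders" "b \<in> cylinders"
  then obtain J A K C where a: "a = cylinder J A" "finite J" "J \<subseteq> {0..}" "\<forall>j\<in>J. A j \<in> sets borel"
    and b: "b = cylinder K C" "finite K" "K \<subseteq> {0..}" "\<forall>j\<in>K. C j \<in> sets borel"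
    by (auto simp: cylinders_def)
  have "a \<inter> b = cylinder (J \<union> K) (\<lambda>j. (if j \<in> J then A j else UNIV) \<inter> (if j \<in> K then C j else UNIV))"
    by (auto simp: a b cylinder_def)
  moreover have "\<dots> \<in> cylinders"
    using a b by (intro cylinderI) auto
  ultimately show "a \<inter> b \<in> cylinders" by simp
qed

lemma measurable_path_measure:
  assumes "\<And>z. z \<in> space K \<Longrightarrow> f z \<in> paths"
    and "\<And>u. 0 \<le> u \<Longrightarrow> (\<lambda>z. f z u) \<in> borel_measurable K"
  shows "f \<in> measurable K path_measure"
  unfolding path_measure_def
proof (rule measurable_measure_of)
  show "f \<in> space K \<rightarrow> paths" using assms by auto
  fix y assume "y \<in> cylinders"
  then obtain J A where y: "y = cylinder J A" "finite J" "J \<subseteq> {0..}" "\<forall>j\<in>J. A j \<in> sets borel"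
    by (auto simp: cylinders_def)
  have "f -` y \<inter> space K = {z \<in> space K. \<forall>j\<in>J. f z j \<in> A j}"
    using assms by (auto simp: y cylinder_def)
  also have "\<dots> \<in> sets K"
    using y assms(2) by (intro sets.sets_Collect_finite_All) (auto simp: subset_iff intro!: measurable_sets_borel[of _ K])
  finally show "f -` y \<inter> space K \<in> sets K" .
qed (rule cylinders_Pow)

lemma path_eval_measurable:
  assumes "0 \<le> u"
  shows "(\<lambda>w. w u) \<in> borel_measurable path_measure"
proof (rule borel_measurableI)
  fix S :: "real set" assume "open S"
  have "(\<lambda>w. w u) -` S \<inter> space path_measure = cylinder {u} (\<lambda>_. S)"
    by (auto simp: cylinder_def)
  also have "\<dots> \<in> sets path_measure"
    unfolding sets_path_measure using \<open>open S\<close> assms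
    by (intro sigma_sets.Basic cylinderI) auto
  finally show "(\<lambda>w. w u) -` S \<inter> space path_measure \<in> sets path_measure" .
qed

lemma pathsD: "w \<in> paths \<Longrightarrow> continuous_on {0..} w" "w \<in> paths \<Longrightarrow> w 0 = 0"
  by (auto simp: paths_def)

text \<open>The random time is approximated by multiples of \<open>1 / (n + 1)\<close>, each of
  which is a fixed time; continuity recovers the evaluation in the limit. The \<open>max 0\<close>
  keeps the argument where paths are continuous and measurable.\<close>

lemma path_eval_measurable2:
  assumes [measurable]: "f \<in> borel_measurable K" "g \<in> measurable K path_measure"
  shows "(\<lambda>z. g z (max 0 (f z))) \<in> borel_measurable K"
proof (rule borel_measurable_LIMSEQ_real)
  have ceil0: "0 \<le> \<lceil>(real n + 1) * max 0 x\<rceil>" for n :: nat and x :: real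
  proof -
    have "0 \<le> (real n + 1) * max 0 x" by (intro mult_nonneg_nonneg) auto
    then show ?thesis by linarith
  qed
  define T where "T n x = real_of_int \<lceil>(real n + 1) * max 0 x\<rceil> / (real n + 1)" for n :: nat and x :: real
  fix z assume z: "z \<in> space K"
  then have w: "g z \<in> paths" using measurable_space[OF assms(2)] by simp
  have lim: "(\<lambda>n. T n (f z)) \<longlonglongrightarrow> max 0 (f z)"
  proof (rule tendsto_sandwich)
    show "\<forall>\<^sub>F n in sequentially. max 0 (f z) \<le> T n (f z)"
    proof (intro always_eventually allI)
      fix n
      have "(real n + 1) * max 0 (f z) \<le> real_of_int \<lceil>(real n + 1) * max 0 (f z)\<rceil>" by (rule le_of_int_ceiling)
      then show "max 0 (f z) \<le> T n (f z)"
        unfolding T_def by (subst pos_le_divide_eq) (auto simp: mult.commute)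
    qed
    show "\<forall>\<^sub>F n in sequentially. T n (f z) \<le> max 0 (f z) + 1 / (real n + 1)"
    proof (intro always_eventually allI)
      fix n
      have "real_of_int \<lceil>(real n + 1) * max 0 (f z)\<rceil> \<le> (real n + 1) * max 0 (f z) + 1" by linarith
      moreover have "k * m + 1 = (m + 1 / k) * k" if "k > 0" for k m :: real
        using that by (simp add: field_simps)
      from this[of "real n + 1" "max 0 (f z)"]
      have "(real n + 1) * max 0 (f z) + 1 = (max 0 (f z) + 1 / (real n + 1)) * (real n + 1)" by linarith
      ultimately show "T n (f z) \<le> max 0 (f z) + 1 / (real n + 1)"
        unfolding T_def by (subst pos_divide_le_eq) linarith+
    qed
    have "(\<lambda>n. max 0 (f z) + 1 / (real n + 1)) \<longlonglongrightarrow> max 0 (f z) + 0"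
      by (intro tendsto_add tendsto_const) (use LIMSEQ_inverse_real_of_nat in \<open>simp add: inverse_eq_divide add.commute\<close>)
    then show "(\<lambda>n. max 0 (f z) + 1 / (real n + 1)) \<longlonglongrightarrow> max 0 (f z)" by simp
  qed auto
  have T0: "T n x \<ge> 0" for n x unfolding T_def using ceil0[of n x] by (intro divide_nonneg_nonneg) auto
  have "continuous (at (max 0 (f z)) within {0..}) (g z)"
    using pathsD(1)[OF w] by (simp add: continuous_on_eq_continuous_within)
  then show "(\<lambda>n. g z (T n (f z))) \<longlonglongrightarrow> g z (max 0 (f z))"
    using lim T0 unfolding continuous_within_sequentially o_def by auto
next
  have ceil0: "0 \<le> \<lceil>(real n + 1) * max 0 x\<rceil>" for n :: nat and x :: real
  proof -
    have "0 \<le> (real n + 1) * max 0 x" by (intro mult_nonneg_nonneg) auto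
    then show ?thesis by linarith
  qed
  fix n :: nat
  \<comment> \<open>The ceiling takes countably many values, so the random time can be frozen at one
    of them.\<close>
  have "(\<lambda>z. (\<lambda>i z. g z (max 0 (real_of_int i / (real n + 1)))) \<lceil>(real n + 1) * max 0 (f z)\<rceil> z) \<in> borel_measurable K"
  proof (rule measurable_compose_countable[where g="\<lambda>z. \<lceil>(real n + 1) * max 0 (f z)\<rceil>"])
    show "(\<lambda>z. \<lceil>(real n + 1) * max 0 (f z)\<rceil>) \<in> K \<rightarrow>\<^sub>M count_space UNIV" by measurable
    fix i :: int
    have "(\<lambda>w. w (max 0 (real_of_int i / (real n + 1)))) \<in> borel_measurable path_measure"
      by (rule path_eval_measurable) simp
    from measurable_compose[OF assms(2) this]
    show "(\<lambda>z. g z (max 0 (real_of_int i / (real n + 1)))) \<in> borel_measurable K" .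
  qed
  moreover have "max 0 (real_of_int \<lceil>(real n + 1) * max 0 (f z)\<rceil> / (real n + 1)) = real_of_int \<lceil>(real n + 1) * max 0 (f z)\<rceil> / (real n + 1)" for z
    using ceil0[of n "f z"] by (intro max_absorb2 divide_nonneg_nonneg) auto
  ultimately show "(\<lambda>z. g z (real_of_int \<lceil>(real n + 1) * max 0 (f z)\<rceil> / (real n + 1))) \<in> borel_measurable K"
    by simp
qed

lemma path_eval_measurable_nonneg:
  assumes "f \<in> borel_measurable K" "g \<in> measurable K path_measure" "\<And>z. z \<in> space K \<Longrightarrow> 0 \<le> f z"
  shows "(\<lambda>z. g z (f z)) \<in> borel_measurable K"
proof -
  have "(\<lambda>z. g z (f z)) \<in> borel_measurable K \<longleftrightarrow> (\<lambda>z. g z (max 0 (f z))) \<in> borel_measurable K"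
    by (intro measurable_cong) (simp add: assms(3) max_absorb2)
  with path_eval_measurable2[OF assms(1,2)] show ?thesis by blast
qed

text \<open>Independence of increments is available along increasing grids. This places finitely
  many times on one such grid from 0 and makes the splitting time \<open>s\<close> a grid
  point.\<close>

lemma finite_nonneg_grid:
  fixes J :: "real set"
  assumes "finite J" "J \<subseteq> {0..}" "s \<ge> 0"
  obtains n m and r :: "nat \<Rightarrow> real"
  where "r 0 = 0" "0 < n" "m \<le> n" "r m = s" "\<forall>i<n. r i < r (Suc i)" "\<forall>j\<in>J. \<exists>i\<le>n. r i = j"
proof -
  \<comment> \<open>0 starts the grid and \<open>s\<close> is the split point; 1 guarantees a second
    point, so that there is at least one increment even for \<open>J = {}\<close> and
    \<open>s = 0\<close>.\<close>
  define L where "L = sorted_list_of_set (insert 0 (insert s (insert 1 J)))"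
  have set: "set L = insert 0 (insert s (insert 1 J))" and srt: "sorted_wrt (<) L"
    unfolding L_def using assms(1) by (simp_all only: finite_insert set_sorted_list_of_set strict_sorted_list_of_set)
  have len: "length L \<ge> 2"
  proof (rule ccontr)
    assume "\<not> length L \<ge> 2"
    moreover have "{0, 1::real} \<subseteq> set L" using set by auto
    then have "card {0, 1::real} \<le> card (set L)" by (intro card_mono) auto
    ultimately show False using card_length[of L] by auto
  qed
  define n where "n = length L - 1"
  have ex: "\<exists>i\<le>n. L ! i = j" if j: "j \<in> set L" for j
  proof -
    obtain i where i: "i < length L" "L ! i = j" using j by (auto simp: in_set_conv_nth)
    then have "i \<le> n" using len by (auto simp: n_def)
    with i show ?thesis by blast
  qed
  obtain i0 where i0: "i0 \<le> n" "L ! i0 = 0" using ex[of 0] set by auto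
  have mono: "i < j \<Longrightarrow> j \<le> n \<Longrightarrow> L ! i < L ! j" for i j
    using srt len by (auto simp: sorted_wrt_iff_nth_less n_def)
  have "L ! 0 \<in> set L" using len by (intro nth_mem) auto
  then have "L ! 0 \<ge> 0" using set assms by auto
  then have "L ! 0 = 0" using mono[of 0 i0] i0 by (cases "i0 = 0") auto
  moreover obtain m where "m \<le> n" "L ! m = s" using ex[of s] set by auto
  moreover have "\<forall>i<n. L ! i < L ! Suc i" using mono by auto
  moreover have "0 < n" using len by (auto simp: n_def)
  ultimately show ?thesis
    using ex set by (intro that[of "(!) L" n m]) auto
qed

section \<open>The law of Brownian motion on path space\<close>

definition shift_path :: "real \<Rightarrow> (real \<Rightarrow> real) \<Rightarrow> real \<Rightarrow> real" where
  "shift_path s w u = w (s + u) - w s"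

text \<open>Freezing the path at \<open>s\<close> keeps exactly its past while staying in the same
  path space, so that past and future share one type and one sigma-algebra.\<close>

definition stop_path :: "real \<Rightarrow> (real \<Rightarrow> real) \<Rightarrow> real \<Rightarrow> real" where
  "stop_path s w u = w (min u s)"

lemma shift_path_paths:
  assumes "0 \<le> s" "w \<in> paths"
  shows "shift_path s w \<in> paths"
proof -
  have "continuous_on {0..} (\<lambda>u. w (s + u))"
    using assms by (intro continuous_on_compose2[OF pathsD(1)[OF assms(2)]] continuous_intros) auto
  then have "continuous_on {0..} (\<lambda>u. w (s + u) - w s)" by (intro continuous_intros)
  then show ?thesis by (simp add: paths_def shift_path_def[abs_def])
qed

lemma stop_path_paths:
  assumes "0 \<le> s" "w \<in> paths"
  shows "stop_path s w \<in> paths"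
proof -
  have "continuous_on {0..} (\<lambda>u. w (min u s))"
    using assms by (intro continuous_on_compose2[OF pathsD(1)[OF assms(2)]] continuous_intros) auto
  then show ?thesis using assms by (simp add: paths_def stop_path_def[abs_def])
qed

lemma shift_path_measurable[measurable]:
  assumes "0 \<le> s"
  shows "shift_path s \<in> measurable path_measure path_measure"
proof (rule measurable_path_measure)
  fix u :: real assume "0 \<le> u"
  then show "(\<lambda>z. shift_path s z u) \<in> borel_measurable path_measure"
    unfolding shift_path_def using assms
    by (intro borel_measurable_diff path_eval_measurable) simp_all
qed (simp add: shift_path_paths assms)

lemma stop_path_measurable[measurable]:
  assumes "0 \<le> s"
  shows "stop_path s \<in> measurable path_measure path_measure"
proof (rule measurable_path_measure)
  fix u :: real assume "0 \<le> u"
  then show "(\<lambda>z. stop_path s z u) \<in> borel_measurable path_measure"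
    unfolding stop_path_def using assms by (intro path_eval_measurable) simp
qed (simp add: stop_path_paths assms)

lemma brownian_motionD:
  assumes "standard_brownian_motion M B"
  shows "0 \<le> s \<Longrightarrow> B s \<in> borel_measurable M"
    and "\<omega> \<in> space M \<Longrightarrow> (\<lambda>u. B u \<omega>) \<in> paths"
    and "0 \<le> r 0 \<Longrightarrow> \<forall>i<n. r i < r (Suc i) \<Longrightarrow>
        prob_space.indep_vars M (\<lambda>_. borel) (\<lambda>i \<omega>. B (r (Suc i)) \<omega> - B (r i) \<omega>) {..<n}"
    and "0 \<le> s \<Longrightarrow> s < u \<Longrightarrow>
        distributed M lborel (\<lambda>\<omega>. B u \<omega> - B s \<omega>) (normal_density 0 (sqrt (u - s)))"
proof -
  note * = assms[unfolded standard_brownian_motion_def]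
  show "0 \<le> s \<Longrightarrow> B s \<in> borel_measurable M" using * by blast
  show "\<omega> \<in> space M \<Longrightarrow> (\<lambda>u. B u \<omega>) \<in> paths" using * unfolding paths_def by blast
  show "0 \<le> r 0 \<Longrightarrow> \<forall>i<n. r i < r (Suc i) \<Longrightarrow>
        prob_space.indep_vars M (\<lambda>_. borel) (\<lambda>i \<omega>. B (r (Suc i)) \<omega> - B (r i) \<omega>) {..<n}"
    using * by blast
  show "0 \<le> s \<Longrightarrow> s < u \<Longrightarrow>
        distributed M lborel (\<lambda>\<omega>. B u \<omega> - B s \<omega>) (normal_density 0 (sqrt (u - s)))"
    using * by blast
qed

lemma brownian_path_measurable:
  assumes "standard_brownian_motion M B"
  shows "(\<lambda>\<omega> u. B u \<omega>) \<in> measurable M path_measure"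
  by (intro measurable_path_measure brownian_motionD(1,2)[OF assms])

section \<open>Laws of Brownian motion at finitely many times\<close>

lemma grid_nonneg:
  fixes r :: "nat \<Rightarrow> real"
  assumes "r 0 = 0" "\<forall>i<n. r i < r (Suc i)" "i \<le> n"
  shows "0 \<le> r i"
  using assms(3)
proof (induction i)
  case (Suc i)
  then show ?case using assms(2) by (auto dest!: spec[of _ i])
qed (simp add: assms)

lemma grid_mono:
  fixes r :: "nat \<Rightarrow> real"
  assumes "\<forall>i<n. r i < r (Suc i)" "i < j" "j \<le> n"
  shows "r i < r j"
  using assms(2,3)
proof (induction j)
  case (Suc j)
  then have "r j < r (Suc j)" using assms(1) by auto
  with Suc show ?case by (cases "i = j") auto
qed simp

lemma brownian_increment_measurable:
  assumes B: "standard_brownian_motion M B"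
    and r: "r 0 = 0" "\<forall>i<n. r i < r (Suc i)" "i < n"
  shows "(\<lambda>\<omega>. B (r (Suc i)) \<omega> - B (r i) \<omega>) \<in> borel_measurable M"
  using grid_nonneg[OF r(1,2), of i] grid_nonneg[OF r(1,2), of "Suc i"] r(3)
  by (intro borel_measurable_diff brownian_motionD(1)[OF B]) simp_all

lemma brownian_increments_law:
  assumes "prob_space M" and B: "standard_brownian_motion M B"
    and r: "r 0 = 0" "0 < n" "\<forall>i<n. r i < r (Suc i)"
  shows "distr M (PiM {..<n} (\<lambda>_. borel)) (\<lambda>\<omega>. \<lambda>i\<in>{..<n}. B (r (Suc i)) \<omega> - B (r i) \<omega>)
    = (\<Pi>\<^sub>M i\<in>{..<n}. density lborel (normal_density 0 (sqrt (r (Suc i) - r i))))"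
proof -
  interpret prob_space M by fact
  have rv: "random_variable borel (\<lambda>\<omega>. B (r (Suc i)) \<omega> - B (r i) \<omega>)" if "i \<in> {..<n}" for i
    using that by (intro brownian_increment_measurable[OF B r(1,3)]) simp
  \<comment> \<open>The characterisation of independence by a product law is applied to a nonempty
    index set; hence \<open>0 < n\<close> in every grid.\<close>
  have ne: "{..<n} \<noteq> {}" using r(2) by auto
  have ind: "indep_vars (\<lambda>_. borel) (\<lambda>i \<omega>. B (r (Suc i)) \<omega> - B (r i) \<omega>) {..<n}"
    using r by (intro brownian_motionD(3)[OF B]) simp_all
  have "distr M (PiM {..<n} (\<lambda>_. borel)) (\<lambda>\<omega>. \<lambda>i\<in>{..<n}. B (r (Suc i)) \<omega> - B (r i) \<omega>)
    = (\<Pi>\<^sub>M i\<in>{..<n}. distr M borel (\<lambda>\<omega>. B (r (Suc i)) \<omega> - B (r i) \<omega>))"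
    using indep_vars_iff_distr_eq_PiM'[OF ne rv] ind by simp
  also have "\<dots> = (\<Pi>\<^sub>M i\<in>{..<n}. density lborel (normal_density 0 (sqrt (r (Suc i) - r i))))"
  proof (rule PiM_cong)
    fix i assume i: "i \<in> {..<n}"
    then have "distributed M lborel (\<lambda>\<omega>. B (r (Suc i)) \<omega> - B (r i) \<omega>) (normal_density 0 (sqrt (r (Suc i) - r i)))"
      using r grid_nonneg[OF r(1,3), of i] by (intro brownian_motionD(4)[OF B]) auto
    then have "distr M lborel (\<lambda>\<omega>. B (r (Suc i)) \<omega> - B (r i) \<omega>) = density lborel (normal_density 0 (sqrt (r (Suc i) - r i)))"
      by (rule distributed_distr_eq_density)
    moreover have "distr M lborel (\<lambda>\<omega>. B (r (Suc i)) \<omega> - B (r i) \<omega>) = distr M borel (\<lambda>\<omega>. B (r (Suc i)) \<omega> - B (r i) \<omega>)"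
      by (rule distr_cong) auto
    ultimately show "distr M borel (\<lambda>\<omega>. B (r (Suc i)) \<omega> - B (r i) \<omega>) = density lborel (normal_density 0 (sqrt (r (Suc i) - r i)))"
      by simp
  qed simp
  finally show ?thesis .
qed

lemma path_eq_sum_increments:
  assumes "w \<in> paths" "r 0 = 0"
  shows "w (r i) = (\<Sum>l<i. w (r (Suc l)) - w (r l))"
  using assms by (subst sum_lessThan_telescope) (auto simp: paths_def)

lemma sum_components_set:
  fixes J :: "real set" and r :: "nat \<Rightarrow> real" and I K :: "nat set" and S :: "nat \<Rightarrow> nat set"
  assumes "\<And>j. j \<in> J \<Longrightarrow> A j \<in> sets borel" "finite K" "\<And>i. i \<in> K \<Longrightarrow> S i \<subseteq> I"
  shows "{x \<in> space (PiM I (\<lambda>_. borel)). \<forall>i\<in>K. r i \<in> J \<longrightarrow> (\<Sum>l\<in>S i. x l) \<in> A (r i)} \<in> sets (PiM I (\<lambda>_. borel :: real measure))"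
proof (rule sets.sets_Collect_finite_All)
  fix i assume i: "i \<in> K"
  have m: "(\<lambda>x. \<Sum>l\<in>S i. x l) \<in> borel_measurable (PiM I (\<lambda>_. borel :: real measure))"
    using assms(3)[OF i] by (intro borel_measurable_sum measurable_component_singleton) auto
  show "{x \<in> space (PiM I (\<lambda>_. borel)). r i \<in> J \<longrightarrow> (\<Sum>l\<in>S i. x l) \<in> A (r i)} \<in> sets (PiM I (\<lambda>_. borel :: real measure))"
  proof (cases "r i \<in> J")
    case True
    have "{x \<in> space (PiM I (\<lambda>_. borel)). r i \<in> J \<longrightarrow> (\<Sum>l\<in>S i. x l) \<in> A (r i)}
      = (\<lambda>x. \<Sum>l\<in>S i. x l) -` A (r i) \<inter> space (PiM I (\<lambda>_. borel :: real measure))"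
      by (rule set_eqI) (simp add: True conj_commute)
    with measurable_sets[OF m assms(1)[OF True]] show ?thesis by simp
  next
    case False
    have "{x \<in> space (PiM I (\<lambda>_. borel)). r i \<in> J \<longrightarrow> (\<Sum>l\<in>S i. x l) \<in> A (r i)}
      = space (PiM I (\<lambda>_. borel :: real measure))"
      by (rule set_eqI) (simp add: False)
    then show ?thesis by (simp only: sets.top)
  qed
qed (rule assms)

text \<open>The right-hand side mentions neither \<open>K\<close> nor \<open>X\<close>: on a grid
  from 0 the values of the path are partial sums of its increments, and their joint law is a fixed
  product of normal laws.\<close>

lemma brownian_cylinder_emeasure:
  assumes K: "prob_space K" and X: "standard_brownian_motion K X"
    and C: "finite J" "J \<subseteq> {0..}" "\<forall>j\<in>J. A j \<in> sets borel"
    and r: "r 0 = 0" "0 < n" "\<forall>i<n. r i < r (Suc i)" "\<forall>j\<in>J. \<exists>i\<le>n. r i = j"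
  defines "D \<equiv> {x \<in> space (PiM {..<n} (\<lambda>_. borel)). \<forall>i\<in>{..n}. r i \<in> J \<longrightarrow> (\<Sum>l<i. x l) \<in> A (r i)}"
  shows "emeasure (distr K path_measure (\<lambda>\<omega> u. X u \<omega>)) (cylinder J A)
      = emeasure (\<Pi>\<^sub>M i\<in>{..<n}. density lborel (normal_density 0 (sqrt (r (Suc i) - r i)))) D"
proof -
  define C where "C = cylinder J A"
  have C': "C \<in> sets path_measure" using cylinderI[of J A] C by (auto simp: sets_path_measure C_def)
  have D: "D \<in> sets (PiM {..<n} (\<lambda>_. borel :: real measure))"
    unfolding D_def using C by (intro sum_components_set) auto
  note m[measurable] = brownian_path_measurable[OF X]
  have rv: "(\<lambda>\<omega>. \<lambda>i\<in>{..<n}. X (r (Suc i)) \<omega> - X (r i) \<omega>) \<in> measurable K (PiM {..<n} (\<lambda>_. borel))"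
    by (intro measurable_restrict brownian_increment_measurable[OF X r(1,3)]) simp
  have "emeasure (distr K path_measure (\<lambda>\<omega> u. X u \<omega>)) C
    = emeasure K ((\<lambda>\<omega> u. X u \<omega>) -` C \<inter> space K)"
    using C' by (intro emeasure_distr) auto
  also have "(\<lambda>\<omega> u. X u \<omega>) -` C \<inter> space K
    = (\<lambda>\<omega>. \<lambda>i\<in>{..<n}. X (r (Suc i)) \<omega> - X (r i) \<omega>) -` D \<inter> space K"
  proof -
    have "(\<lambda>u. X u \<omega>) \<in> C \<longleftrightarrow> (\<lambda>i\<in>{..<n}. X (r (Suc i)) \<omega> - X (r i) \<omega>) \<in> D" if \<omega>: "\<omega> \<in> space K" for \<omega>
    proof -
      have p: "(\<lambda>u. X u \<omega>) \<in> paths" by (rule brownian_motionD(2)[OF X \<omega>])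
      define x where "x = (\<lambda>i\<in>{..<n}. X (r (Suc i)) \<omega> - X (r i) \<omega>)"
      have "X (r i) \<omega> = (\<Sum>l<i. x l)" if "i \<le> n" for i
        unfolding path_eq_sum_increments[where w="\<lambda>u. X u \<omega>" and r=r, OF p r(1), of i] using that by (intro sum.cong) (auto simp: x_def)
      moreover have "(\<lambda>u. X u \<omega>) \<in> C \<longleftrightarrow> (\<forall>i\<in>{..n}. r i \<in> J \<longrightarrow> X (r i) \<omega> \<in> A (r i))"
      proof -
        have "(\<lambda>u. X u \<omega>) \<in> C \<longleftrightarrow> (\<forall>j\<in>J. X j \<omega> \<in> A j)"
          using p by (simp add: C_def cylinder_def)
        also have "\<dots> \<longleftrightarrow> (\<forall>i\<in>{..n}. r i \<in> J \<longrightarrow> X (r i) \<omega> \<in> A (r i))"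
          using r(4) by (metis atMost_iff)
        finally show ?thesis .
      qed
      moreover have "x \<in> space (PiM {..<n} (\<lambda>_. borel))" by (simp add: space_PiM x_def)
      ultimately have "(\<lambda>u. X u \<omega>) \<in> C \<longleftrightarrow> x \<in> D"
        by (simp add: D_def)
      then show ?thesis by (simp only: x_def)
    qed
    then show ?thesis by auto
  qed
  also have "emeasure K \<dots> = emeasure (distr K (PiM {..<n} (\<lambda>_. borel)) (\<lambda>\<omega>. \<lambda>i\<in>{..<n}. X (r (Suc i)) \<omega> - X (r i) \<omega>)) D"
    using rv D by (intro emeasure_distr[symmetric])
  also have "\<dots> = emeasure (\<Pi>\<^sub>M i\<in>{..<n}. density lborel (normal_density 0 (sqrt (r (Suc i) - r i)))) D"
    by (subst brownian_increments_law[OF K X r(1-3)]) simp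
  finally show ?thesis unfolding C_def .
qed

text \<open>Cylinders are closed under intersection and generate the sigma-algebra, so agreement on
  them suffices. This lets shifted and reflected motions be replaced by the original one in
  integrals over paths.\<close>

lemma brownian_law_unique:
  assumes M: "prob_space M" and B: "standard_brownian_motion M B"
    and M': "prob_space M'" and B': "standard_brownian_motion M' B'"
  shows "distr M path_measure (\<lambda>\<omega> u. B u \<omega>) = distr M' path_measure (\<lambda>\<omega> u. B' u \<omega>)"
proof (rule measure_eqI_generator_eq[OF Int_stable_cylinders cylinders_Pow])
  interpret M: prob_space M by fact
  interpret M': prob_space M' by fact
  note [measurable] = brownian_path_measurable[OF B] brownian_path_measurable[OF B']
  fix C assume "C \<in> cylinders"
  then obtain J A where C: "C = cylinder J A" "finite J" "J \<subseteq> {0..}" "\<forall>j\<in>J. A j \<in> sets borel"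
    by (auto simp: cylinders_def)
  obtain n m r where r: "r 0 = 0" "0 < n" "\<forall>i<n. r i < r (Suc i)" "\<forall>j\<in>J. \<exists>i\<le>n. r i = j"
    by (rule finite_nonneg_grid[OF C(2,3) order_refl]) (rule that, assumption+)
  note * = brownian_cylinder_emeasure[OF _ _ C(2-4) r]
  show "emeasure (distr M path_measure (\<lambda>\<omega> u. B u \<omega>)) C = emeasure (distr M' path_measure (\<lambda>\<omega> u. B' u \<omega>)) C"
    unfolding C(1) using *[OF M B] *[OF M' B'] by simp
next
  interpret M: prob_space M by fact
  have "paths = cylinder {} (\<lambda>_. UNIV)" by (auto simp: cylinder_def)
  moreover have "cylinder {} (\<lambda>_. UNIV) \<in> cylinders" by (rule cylinderI) auto
  ultimately have p: "paths \<in> cylinders" by simp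
  show "range (\<lambda>_::nat. paths) \<subseteq> cylinders" using p by auto
  show "emeasure (distr M path_measure (\<lambda>\<omega> u. B u \<omega>)) paths \<noteq> \<infinity>" for i :: nat
  proof -
    interpret prob_space "distr M path_measure (\<lambda>\<omega> u. B u \<omega>)"
      by (rule M.prob_space_distr[OF brownian_path_measurable[OF B]])
    show ?thesis by simp
  qed
qed (auto simp: sets_path_measure)

section \<open>Shifts, reflections and independence of past and future\<close>

lemma brownian_shift:
  assumes M: "prob_space M" and B: "standard_brownian_motion M B" and s: "0 \<le> s"
  shows "standard_brownian_motion M (\<lambda>u \<omega>. B (s + u) \<omega> - B s \<omega>)"
  unfolding standard_brownian_motion_def
proof (intro conjI ballI allI impI)
  interpret prob_space M by fact
  show "(\<lambda>\<omega>. B (s + u) \<omega> - B s \<omega>) \<in> borel_measurable M" if "u \<ge> 0" for u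
    using s that by (intro borel_measurable_diff brownian_motionD(1)[OF B]) auto
  show "continuous_on {0..} (\<lambda>u. B (s + u) \<omega> - B s \<omega>)" if "\<omega> \<in> space M" for \<omega>
    using shift_path_paths[OF s brownian_motionD(2)[OF B that]]
    by (simp add: paths_def shift_path_def[abs_def])
  show "indep_vars (\<lambda>_. borel) (\<lambda>i \<omega>. B (s + r (Suc i)) \<omega> - B s \<omega> - (B (s + r i) \<omega> - B s \<omega>)) {..<n}"
    if r: "0 \<le> r 0 \<and> (\<forall>i<n. r i < r (Suc i))" for n r
    using brownian_motionD(3)[OF B, of "\<lambda>i. s + r i" n] r s by simp
  show "distributed M lborel (\<lambda>\<omega>. B (s + v) \<omega> - B s \<omega> - (B (s + u) \<omega> - B s \<omega>)) (normal_density 0 (sqrt (v - u)))"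
    if "0 \<le> u \<and> u < v" for u v
    using brownian_motionD(4)[OF B, of "s + u" "s + v"] that s by simp
qed simp

lemma brownian_uminus:
  assumes M: "prob_space M" and B: "standard_brownian_motion M B"
  shows "standard_brownian_motion M (\<lambda>u \<omega>. - B u \<omega>)"
  unfolding standard_brownian_motion_def
proof (intro conjI ballI allI impI)
  interpret prob_space M by fact
  show "(\<lambda>\<omega>. - B u \<omega>) \<in> borel_measurable M" if "u \<ge> 0" for u
    using that brownian_motionD(1)[OF B] by auto
  show "- B 0 \<omega> = 0" if "\<omega> \<in> space M" for \<omega>
    using brownian_motionD(2)[OF B that] by (simp add: paths_def)
  show "continuous_on {0..} (\<lambda>u. - B u \<omega>)" if "\<omega> \<in> space M" for \<omega>
    using brownian_motionD(2)[OF B that] by (auto simp: paths_def intro!: continuous_intros)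
  show "indep_vars (\<lambda>_. borel) (\<lambda>i \<omega>. - B (r (Suc i)) \<omega> - - B (r i) \<omega>) {..<n}"
    if r: "0 \<le> r 0 \<and> (\<forall>i<n. r i < r (Suc i))" for n r
    using indep_vars_compose2[OF brownian_motionD(3)[OF B, of r n], of "\<lambda>_ x. - x" "\<lambda>_. borel"] r
    by simp
  show "distributed M lborel (\<lambda>\<omega>. - B v \<omega> - - B u \<omega>) (normal_density 0 (sqrt (v - u)))"
    if uv: "0 \<le> u \<and> u < v" for u v
  proof -
    have "distributed M lborel (\<lambda>\<omega>. 0 + (-1) * (B v \<omega> - B u \<omega>)) (normal_density (0 + (-1) * 0) (\<bar>-1\<bar> * sqrt (v - u)))"
      using uv by (intro normal_density_affine brownian_motionD(4)[OF B]) auto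
    then show ?thesis by simp
  qed
qed


text \<open>It suffices to treat cylinder events of the stopped and of the shifted path. All their
  times fit on one grid containing \<open>s = r m\<close>; the former depend on the increments
  before index \<open>m\<close> only, the latter on those from \<open>m\<close> on, and disjoint
  blocks of independent increments are independent.\<close>

lemma brownian_indep_stop_shift:
  assumes M: "prob_space M" and B: "standard_brownian_motion M B" and s: "0 \<le> s"
  shows "prob_space.indep_var M path_measure (\<lambda>\<omega>. stop_path s (\<lambda>u. B u \<omega>))
    path_measure (\<lambda>\<omega>. shift_path s (\<lambda>u. B u \<omega>))"
proof -
  interpret prob_space M by fact
  let ?b = "\<lambda>\<omega> u. B u \<omega>"
  let ?S = "\<lambda>\<omega>. stop_path s (?b \<omega>)" and ?T = "\<lambda>\<omega>. shift_path s (?b \<omega>)"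
  note pm = brownian_path_measurable[OF B]
  have Sm: "?S \<in> measurable M path_measure"
    using measurable_compose[OF pm stop_path_measurable[OF s]] .
  have Tm: "?T \<in> measurable M path_measure"
    using measurable_compose[OF pm shift_path_measurable[OF s]] .
  have gen: "{X -` A \<inter> space M |A. A \<in> sets path_measure} = sigma_sets (space M) {X -` A \<inter> space M |A. A \<in> cylinders}"
    if X: "X \<in> measurable M path_measure" for X
    unfolding sets_path_measure
    by (rule sigma_sets_vimage_commute) (use measurable_space[OF X] in auto)
  have stable: "Int_stable {X -` A \<inter> space M |A. A \<in> cylinders}" for X :: "'a \<Rightarrow> real \<Rightarrow> real"
  proof (rule Int_stableI)
    fix a b assume "a \<in> {X -` A \<inter> space M |A. A \<in> cylinders}" "b \<in> {X -` A \<inter> space M |A. A \<in> cylinders}"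
    then obtain A C where *: "a = X -` A \<inter> space M" "A \<in> cylinders" "b = X -` C \<inter> space M" "C \<in> cylinders" by blast
    have "a \<inter> b = X -` (A \<inter> C) \<inter> space M" using * by blast
    moreover have "A \<inter> C \<in> cylinders" using * Int_stable_cylinders by (auto simp: Int_stable_def)
    ultimately show "a \<inter> b \<in> {X -` A \<inter> space M |A. A \<in> cylinders}" by blast
  qed
  have sub: "{X -` A \<inter> space M |A. A \<in> cylinders} \<subseteq> events" if X: "X \<in> measurable M path_measure" for X
    using measurable_sets[OF X] by (auto simp: sets_path_measure)
  have "indep_set {?S -` A \<inter> space M |A. A \<in> cylinders} {?T -` A \<inter> space M |A. A \<in> cylinders}"
  proof (rule indep_setI[OF sub[OF Sm] sub[OF Tm]])
    fix a b assume "a \<in> {?S -` A \<inter> space M |A. A \<in> cylinders}" "b \<in> {?T -` A \<inter> space M |A. A \<in> cylinders}"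
    then obtain J A K C where a: "a = ?S -` cylinder J A \<inter> space M" "finite J" "J \<subseteq> {0..}" "\<forall>j\<in>J. A j \<in> sets borel"
      and b: "b = ?T -` cylinder K C \<inter> space M" "finite K" "K \<subseteq> {0..}" "\<forall>j\<in>K. C j \<in> sets borel"
      unfolding cylinders_def by blast
    \<comment> \<open>Times at which the two cylinders read the original path: a stopped path at
      \<open>j\<close> reads time \<open>min j s\<close>, a shifted one reads
      \<open>s + j\<close>.\<close>
    let ?G = "(\<lambda>j. min j s) ` J \<union> (\<lambda>j. s + j) ` K"
    have G0: "finite ?G" using a(2) b(2) by simp
    have "(\<lambda>j. min j s) ` J \<subseteq> {0..}"
    proof (rule image_subsetI)
      fix j assume "j \<in> J"
      with a(3) have "0 \<le> j" by (auto simp: subset_iff)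
      with s show "min j s \<in> {0..}" by simp
    qed
    moreover have "(\<lambda>j. s + j) ` K \<subseteq> {0..}"
    proof (rule image_subsetI)
      fix j assume "j \<in> K"
      with b(3) have "0 \<le> j" by (auto simp: subset_iff)
      with s show "s + j \<in> {0..}" by simp
    qed
    ultimately have G1: "?G \<subseteq> {0..}" by (rule Un_least)
    obtain n m and r :: "nat \<Rightarrow> real"
      where r: "r 0 = 0" "0 < n" "m \<le> n" "r m = s" "\<forall>i<n. r i < r (Suc i)"
        and G': "\<forall>j\<in>?G. \<exists>i\<le>n. r i = j"
      by (rule finite_nonneg_grid[OF G0 G1 s]) (rule that, assumption+)
    note G = bspec[OF G']
    have mono: "i < j \<Longrightarrow> j \<le> n \<Longrightarrow> r i < r j" for i j by (rule grid_mono[OF r(5)])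
    have GJ: "\<exists>i\<le>m. r i = min j s" if j: "j \<in> J" for j
    proof -
      obtain i where i: "i \<le> n" "r i = min j s" using G[of "min j s"] j by blast
      moreover have "i \<le> m" using i mono[of m i] r(4) by (cases "m < i") auto
      ultimately show ?thesis by blast
    qed
    have GK: "\<exists>i. m \<le> i \<and> i \<le> n \<and> r i = s + j" if j: "j \<in> K" for j
    proof -
      obtain i where i: "i \<le> n" "r i = s + j" using G[of "s + j"] j by blast
      moreover have "0 \<le> j" using b(3) j by auto
      then have "m \<le> i" using i mono[of i m] r(3,4) by (cases "i < m") auto
      ultimately show ?thesis by blast
    qed
    define inc where "inc i \<omega> = B (r (Suc i)) \<omega> - B (r i) \<omega>" for i \<omega>
    define p where "p j = (SOME i. i \<le> m \<and> r i = min j s)" for j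
    define q where "q j = (SOME i. m \<le> i \<and> i \<le> n \<and> r i = s + j)" for j
    have p: "p j \<le> m" "r (p j) = min j s" if "j \<in> J" for j
      using someI_ex[OF GJ[OF that]] by (auto simp: p_def)
    have q: "m \<le> q j" "q j \<le> n" "r (q j) = s + j" if "j \<in> K" for j
      using someI_ex[OF GK[OF that]] by (auto simp: q_def)
    have ind: "indep_vars (\<lambda>_. borel) inc {..<n}"
      unfolding inc_def using r by (intro brownian_motionD(3)[OF B]) simp_all
    define DJ where "DJ = {x \<in> space (PiM {..<m} (\<lambda>_. borel :: real measure)). \<forall>j\<in>J. (\<Sum>l<p j. x l) \<in> A j}"
    define DK where "DK = {x \<in> space (PiM {m..<n} (\<lambda>_. borel :: real measure)). \<forall>j\<in>K. (\<Sum>l\<in>{m..<q j}. x l) \<in> C j}"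
    have DJ: "DJ \<in> sets (PiM {..<m} (\<lambda>_. borel :: real measure))"
      unfolding DJ_def
    proof (rule sets.sets_Collect_finite_All)
      fix j assume j: "j \<in> J"
      have "(\<lambda>x. \<Sum>l<p j. x l) \<in> borel_measurable (PiM {..<m} (\<lambda>_. borel :: real measure))"
        using p[OF j] by (intro borel_measurable_sum measurable_component_singleton) auto
      from measurable_sets[OF this, of "A j"] a(4) j
      show "{x \<in> space (PiM {..<m} (\<lambda>_. borel :: real measure)). (\<Sum>l<p j. x l) \<in> A j} \<in> sets (PiM {..<m} (\<lambda>_. borel))"
        by (simp add: vimage_def Int_def conj_commute)
    qed fact
    have DK: "DK \<in> sets (PiM {m..<n} (\<lambda>_. borel :: real measure))"
      unfolding DK_def
    proof (rule sets.sets_Collect_finite_All)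
      fix j assume j: "j \<in> K"
      have "(\<lambda>x. \<Sum>l\<in>{m..<q j}. x l) \<in> borel_measurable (PiM {m..<n} (\<lambda>_. borel :: real measure))"
        using q[OF j] by (intro borel_measurable_sum measurable_component_singleton) auto
      from measurable_sets[OF this, of "C j"] b(4) j
      show "{x \<in> space (PiM {m..<n} (\<lambda>_. borel :: real measure)). (\<Sum>l\<in>{m..<q j}. x l) \<in> C j} \<in> sets (PiM {m..<n} (\<lambda>_. borel))"
        by (simp add: vimage_def Int_def conj_commute)
    qed fact
    have B_sum: "B (r i) \<omega> = (\<Sum>l<i. inc l \<omega>)" if "\<omega> \<in> space M" for i \<omega>
      unfolding inc_def by (rule path_eq_sum_increments[where w="\<lambda>u. B u \<omega>" and r=r, OF brownian_motionD(2)[OF B that] r(1)])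
    have a': "a = (\<lambda>\<omega>. restrict (\<lambda>i. inc i \<omega>) {..<m}) -` DJ \<inter> space M"
    proof -
      have "?S \<omega> \<in> cylinder J A \<longleftrightarrow> restrict (\<lambda>i. inc i \<omega>) {..<m} \<in> DJ" if \<omega>: "\<omega> \<in> space M" for \<omega>
      proof -
        have "B (min j s) \<omega> = (\<Sum>l<p j. restrict (\<lambda>i. inc i \<omega>) {..<m} l)" if "j \<in> J" for j
        proof -
          have "B (r (p j)) \<omega> = (\<Sum>l<p j. restrict (\<lambda>i. inc i \<omega>) {..<m} l)"
            unfolding B_sum[OF \<omega>] using p[OF that] by (intro sum.cong) auto
          then show ?thesis by (simp add: p(2)[OF that])
        qed
        then show ?thesis
          using stop_path_paths[OF s brownian_motionD(2)[OF B \<omega>]]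
          by (simp add: cylinder_def DJ_def space_PiM stop_path_def)
      qed
      then show ?thesis unfolding a(1) by auto
    qed
    have b': "b = (\<lambda>\<omega>. restrict (\<lambda>i. inc i \<omega>) {m..<n}) -` DK \<inter> space M"
    proof -
      have "?T \<omega> \<in> cylinder K C \<longleftrightarrow> restrict (\<lambda>i. inc i \<omega>) {m..<n} \<in> DK" if \<omega>: "\<omega> \<in> space M" for \<omega>
      proof -
        have "B (s + j) \<omega> - B s \<omega> = (\<Sum>l\<in>{m..<q j}. restrict (\<lambda>i. inc i \<omega>) {m..<n} l)" if j: "j \<in> K" for j
        proof -
          have "B (r (q j)) \<omega> - B (r m) \<omega> = (\<Sum>l\<in>{m..<q j}. inc l \<omega>)"
            unfolding B_sum[OF \<omega>] using sum_diff_nat_ivl[of 0 m "q j" "\<lambda>l. inc l \<omega>"] q(1)[OF j]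
            by (simp add: lessThan_atLeast0)
          also have "\<dots> = (\<Sum>l\<in>{m..<q j}. restrict (\<lambda>i. inc i \<omega>) {m..<n} l)"
            using q[OF j] by (intro sum.cong) auto
          finally show ?thesis by (simp add: q(3)[OF j] r(4))
        qed
        then show ?thesis
          using shift_path_paths[OF s brownian_motionD(2)[OF B \<omega>]]
          by (simp add: cylinder_def DK_def space_PiM shift_path_def)
      qed
      then show ?thesis unfolding b(1) by auto
    qed
    have "indep_var (PiM {..<m} (\<lambda>_. borel)) (\<lambda>\<omega>. restrict (\<lambda>i. inc i \<omega>) {..<m})
        (PiM {m..<n} (\<lambda>_. borel)) (\<lambda>\<omega>. restrict (\<lambda>i. inc i \<omega>) {m..<n})"
      using r(3) by (intro indep_var_restrict[OF ind]) auto
    from indep_varD[OF this DJ DK]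
    have "prob ((\<lambda>x. (\<lambda>i\<in>{..<m}. inc i x, \<lambda>i\<in>{m..<n}. inc i x)) -` (DJ \<times> DK) \<inter> space M) = prob a * prob b"
      unfolding a' b' .
    moreover have "(\<lambda>x. (\<lambda>i\<in>{..<m}. inc i x, \<lambda>i\<in>{m..<n}. inc i x)) -` (DJ \<times> DK) \<inter> space M = a \<inter> b"
      unfolding a' b' by (rule set_eqI) (simp add: conj_ac)
    ultimately show "prob (a \<inter> b) = prob a * prob b" by simp
  qed
  from indep_set_sigma_sets[OF this stable stable]
  have ind: "indep_set {?S -` A \<inter> space M |A. A \<in> sets path_measure} {?T -` A \<inter> space M |A. A \<in> sets path_measure}"
    unfolding gen[OF Sm] gen[OF Tm] .
  \<comment> \<open>\<open>indep_var_eq\<close> speaks of generated sigma-algebras, while these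
    preimages already form one.\<close>
  have ss: "sigma_sets (space M) {X -` A \<inter> space M |A. A \<in> sets path_measure} = {X -` A \<inter> space M |A. A \<in> sets path_measure}"
    if X: "X \<in> measurable M path_measure" for X
    unfolding gen[OF X] by (rule sigma_sets_sigma_sets_eq) auto
  show ?thesis
    unfolding indep_var_eq ss[OF Sm] ss[OF Tm] using Sm Tm ind by blast
qed

section \<open>Strips and boundary crossings of continuous paths\<close>

text \<open>Approximation from the right also covers \<open>r = 0\<close>, the left end of the
  domain of continuity. Only a weak inequality survives the limit, which dictates the explicit
  margins \<open>1 / (m + 1)\<close> in the characterisations below.\<close>

lemma ge_of_rational_right:
  fixes F :: "real \<Rightarrow> real"
  assumes F: "continuous_on {0..<1} F" and r: "0 \<le> r" "r < c" "c \<le> 1"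
    and ge: "\<And>q :: rat. r < of_rat q \<Longrightarrow> of_rat q < c \<Longrightarrow> e \<le> F (of_rat q)"
  shows "e \<le> F r"
proof (rule ccontr)
  assume "\<not> e \<le> F r"
  then have "0 < e - F r" by simp
  moreover have "r \<in> {0..<1}" using r by auto
  ultimately obtain \<delta> where \<delta>: "\<delta> > 0" "\<And>x. x \<in> {0..<1} \<Longrightarrow> dist x r < \<delta> \<Longrightarrow> dist (F x) (F r) < e - F r"
    using F unfolding continuous_on_iff by metis
  have "r < min (r + \<delta>) c" using \<delta>(1) r by auto
  then obtain q :: rat where q: "r < of_rat q" "of_rat q < min (r + \<delta>) c" using of_rat_dense by blast
  have "dist (F (of_rat q)) (F r) < e - F r" using q r by (intro \<delta>(2)) (auto simp: dist_real_def simp del: zero_le_of_rat_iff of_rat_less_1_iff)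
  moreover have "e \<le> F (of_rat q)" using q by (intro ge) auto
  ultimately show False by (auto simp: dist_real_def)
qed

lemma pos_lower_bound_nat:
  fixes F :: "real \<Rightarrow> real"
  assumes F: "continuous_on {0..<1} F" and c: "0 \<le> c" "c < 1" and pos: "\<And>r. r \<in> {0..c} \<Longrightarrow> 0 < F r"
  obtains m :: nat where "\<And>r. r \<in> {0..c} \<Longrightarrow> 1 / (real m + 1) < F r"
proof -
  have "compact {0..c}" "{0..c} \<noteq> {}" using c by auto
  moreover have "continuous_on {0..c} F" using c by (intro continuous_on_subset[OF F]) auto
  ultimately obtain x where x: "x \<in> {0..c}" "\<And>y. y \<in> {0..c} \<Longrightarrow> F x \<le> F y"
    using continuous_attains_inf[of "{0..c}" F] by blast
  obtain m :: nat where m: "inverse (real (Suc m)) < F x" using reals_Archimedean[OF pos[OF x(1)]] by blast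
  have "1 / (real m + 1) < F r" if "r \<in> {0..c}" for r
  proof -
    have "1 / (real m + 1) < F x" using m by (simp add: inverse_eq_divide add.commute)
    with x(2)[OF that] show ?thesis by linarith
  qed
  with that show ?thesis by blast
qed

lemma exhaust_Ico:
  fixes r :: real
  assumes "r < 1"
  obtains n :: nat where "r < 1 - 1 / (real n + 1)"
proof -
  have "0 < 1 - r" using assms by simp
  then obtain n :: nat where "inverse (real (Suc n)) < 1 - r" using reals_Archimedean by blast
  then have "r < 1 - 1 / (real n + 1)" by (simp add: inverse_eq_divide add.commute)
  with that show ?thesis by blast
qed

text \<open>Strict positivity at all rationals does not imply it at all reals. On each compact
  interval inside \<open>{0..<1}\<close>, however, it amounts to a uniform margin, because the
  minimum is attained, and a weak inequality with a margin can be tested on rationals.\<close>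

lemma all_pos_Ico_iff:
  fixes F :: "real \<Rightarrow> real"
  assumes F: "continuous_on {0..<1} F"
  shows "(\<forall>r\<in>{0..<1}. 0 < F r) \<longleftrightarrow>
    (\<forall>n::nat. \<exists>m::nat. \<forall>q::rat. 0 \<le> q \<and> real_of_rat q < 1 - 1 / (real n + 1) \<longrightarrow> 1 / (real m + 1) \<le> F (of_rat q))"
    (is "?L \<longleftrightarrow> ?R")
proof
  assume L: ?L
  show ?R
  proof
    fix n :: nat
    have c: "0 \<le> 1 - 1 / (real n + 1)" "1 - 1 / (real n + 1) < 1" by (auto simp: field_simps)
    obtain m where m: "\<And>r. r \<in> {0..1 - 1 / (real n + 1)} \<Longrightarrow> 1 / (real m + 1) < F r"
      using pos_lower_bound_nat[OF F c] L c(2) by (metis atLeastAtMost_iff atLeastLessThan_iff le_less_trans)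
    show "\<exists>m::nat. \<forall>q::rat. 0 \<le> q \<and> real_of_rat q < 1 - 1 / (real n + 1) \<longrightarrow> 1 / (real m + 1) \<le> F (of_rat q)"
      by (intro exI[of _ m] allI impI less_imp_le m) auto
  qed
next
  assume R: ?R
  show ?L
  proof
    fix r :: real assume r: "r \<in> {0..<1}"
    then obtain n where n: "r < 1 - 1 / (real n + 1)" using exhaust_Ico by auto
    obtain m where m: "\<And>q::rat. 0 \<le> q \<and> real_of_rat q < 1 - 1 / (real n + 1) \<longrightarrow> 1 / (real m + 1) \<le> F (of_rat q)"
      using R by blast
    have "1 / (real m + 1) \<le> F r"
    proof (rule ge_of_rational_right[OF F _ n])
      fix q :: rat assume "r < of_rat q" "of_rat q < 1 - 1 / (real n + 1)"
      moreover have "0 \<le> q" using r calculation(1) by (metis atLeastLessThan_iff le_less_trans less_imp_le zero_le_of_rat_iff)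
      ultimately show "1 / (real m + 1) \<le> F (of_rat q)" using m by blast
    qed (use r in \<open>auto simp: field_simps\<close>)
    moreover have "0 < 1 / (real m + 1)" by simp
    ultimately show "0 < F r" by linarith
  qed
qed

lemma pred_all_pos_Ico:
  fixes F :: "real \<Rightarrow> 'b \<Rightarrow> real"
  assumes "\<And>r. 0 \<le> r \<Longrightarrow> F r \<in> borel_measurable K"
    and "\<And>z. z \<in> space K \<Longrightarrow> continuous_on {0..<1} (\<lambda>r. F r z)"
  shows "Measurable.pred K (\<lambda>z. \<forall>r\<in>{0..<1}. (0::real) < F r z)"
proof -
  have 1: "Measurable.pred K (\<lambda>z. 0 \<le> q \<and> real_of_rat q < 1 - 1 / (real n + 1) \<longrightarrow> 1 / (real m + 1) \<le> F (of_rat q) z)" for q n m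
  proof (cases "0 \<le> q")
    case True
    then have [measurable]: "F (of_rat q) \<in> borel_measurable K" by (intro assms(1)) simp
    show ?thesis by measurable
  qed simp
  have "Measurable.pred K (\<lambda>z. \<forall>n::nat. \<exists>m::nat. \<forall>q::rat. 0 \<le> q \<and> real_of_rat q < 1 - 1 / (real n + 1) \<longrightarrow> 1 / (real m + 1) \<le> F (of_rat q) z)"
    by (intro pred_intros_countable 1)
  also have "?this \<longleftrightarrow> ?thesis"
    by (intro measurable_cong all_pos_Ico_iff[symmetric] assms(2))
  finally show ?thesis .
qed

text \<open>The crossing condition mixes a closed requirement on \<open>F\<close> with an open one
  on \<open>G\<close>. A rational time may miss \<open>0 \<le> F\<close> but comes within
  \<open>1 / (l + 1)\<close> of it, and a limit point of such times is a true crossing. For the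
  limit to stay in \<open>{0..<1}\<close> and to keep \<open>0 < G\<close>, the cut-off
  \<open>n\<close> and the margin \<open>m\<close> must not depend on \<open>l\<close>.\<close>

lemma ex_cross_Ico_iff:
  fixes F G :: "real \<Rightarrow> real"
  assumes F: "continuous_on {0..<1} F" and G: "continuous_on {0..<1} G"
  shows "(\<exists>r\<in>{0..<1}. 0 \<le> F r \<and> (\<forall>v\<in>{0..r}. 0 < G v)) \<longleftrightarrow>
    (\<exists>(n::nat) m::nat. \<forall>l::nat. \<exists>q::rat. 0 \<le> q \<and> real_of_rat q \<le> 1 - 1 / (real n + 1) \<and>
        - (1 / (real l + 1)) \<le> F (of_rat q) \<and> (\<forall>p::rat. 0 \<le> p \<and> p \<le> q \<longrightarrow> 1 / (real m + 1) \<le> G (of_rat p)))"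
    (is "?L \<longleftrightarrow> ?R")
proof
  assume ?L
  then obtain r where r: "0 \<le> r" "r < 1" "0 \<le> F r" "\<And>v. v \<in> {0..r} \<Longrightarrow> 0 < G v" by auto
  obtain n where n: "r < 1 - 1 / (real n + 1)" using exhaust_Ico[OF r(2)] .
  obtain m where m: "\<And>v. v \<in> {0..r} \<Longrightarrow> 1 / (real m + 1) < G v"
    using pos_lower_bound_nat[OF G r(1,2,4)] by metis
  have r01: "r \<in> {0..<1}" using r by auto
  \<comment> \<open>The witness \<open>q\<close> below lies to the right of \<open>r\<close>, where
    the margin of \<open>G\<close> on \<open>{0..r}\<close> says nothing; continuity extends it to a
    neighbourhood of \<open>r\<close>.\<close>
  have "0 < G r - 1 / (real m + 1)" using m[of r] r(1) by auto
  then obtain \<epsilon> where \<epsilon>: "\<epsilon> > 0" "\<And>x. x \<in> {0..<1} \<Longrightarrow> dist x r < \<epsilon> \<Longrightarrow> dist (G x) (G r) < G r - 1 / (real m + 1)"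
    using G r01 unfolding continuous_on_iff by metis
  show ?R
  proof (rule exI[of _ n], rule exI[of _ m], rule allI)
    fix l :: nat
    have "0 < 1 / (real l + 1)" by simp
    then obtain \<delta> where \<delta>: "\<delta> > 0" "\<And>x. x \<in> {0..<1} \<Longrightarrow> dist x r < \<delta> \<Longrightarrow> dist (F x) (F r) < 1 / (real l + 1)"
      using F r01 unfolding continuous_on_iff by metis
    have "r < min (min (r + \<delta>) (r + \<epsilon>)) (1 - 1 / (real n + 1))" using \<delta>(1) \<epsilon>(1) n by auto
    then obtain q :: rat where q: "r < of_rat q" "of_rat q < min (min (r + \<delta>) (r + \<epsilon>)) (1 - 1 / (real n + 1))"
      using of_rat_dense by blast
    have n1: "1 - 1 / (real n + 1) < 1" by (auto simp: field_simps)
    have q1: "real_of_rat q < 1" using q(2) n1 by linarith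
    have "0 \<le> q" using r(1) q(1) by (metis le_less_trans less_imp_le zero_le_of_rat_iff)
    moreover have "real_of_rat q \<le> 1 - 1 / (real n + 1)" using q by auto
    moreover have "dist (F (of_rat q)) (F r) < 1 / (real l + 1)"
      using q r(1) q1 by (intro \<delta>(2)) (auto simp: dist_real_def simp del: zero_le_of_rat_iff of_rat_less_1_iff)
    then have "- (1 / (real l + 1)) \<le> F (of_rat q)" using r(3) by (auto simp: dist_real_def abs_if split: if_splits)
    moreover have "1 / (real m + 1) \<le> G (of_rat p)" if "0 \<le> p \<and> p \<le> q" for p :: rat
    proof (cases "of_rat p \<le> r")
      case True
      then show ?thesis using that m[of "of_rat p"] by (auto intro: less_imp_le)
    next
      case False
      have "real_of_rat p \<le> of_rat q" using that by (simp add: of_rat_less_eq)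
      then have "dist (G (of_rat p)) (G r) < G r - 1 / (real m + 1)"
        using q r(1) q1 False by (intro \<epsilon>(2)) (auto simp: dist_real_def simp del: zero_le_of_rat_iff of_rat_less_1_iff)
      then show ?thesis by (auto simp: dist_real_def abs_if split: if_splits)
    qed
    ultimately show "\<exists>q::rat. 0 \<le> q \<and> real_of_rat q \<le> 1 - 1 / (real n + 1) \<and>
        - (1 / (real l + 1)) \<le> F (of_rat q) \<and> (\<forall>p::rat. 0 \<le> p \<and> p \<le> q \<longrightarrow> 1 / (real m + 1) \<le> G (of_rat p))"
      by blast
  qed
next
  assume ?R
  then obtain n m :: nat where "\<forall>l::nat. \<exists>q::rat. 0 \<le> q \<and> real_of_rat q \<le> 1 - 1 / (real n + 1) \<and>
        - (1 / (real l + 1)) \<le> F (of_rat q) \<and> (\<forall>p::rat. 0 \<le> p \<and> p \<le> q \<longrightarrow> 1 / (real m + 1) \<le> G (of_rat p))"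
    by blast
  from choice[OF this] obtain q :: "nat \<Rightarrow> rat" where q0: "\<And>l. 0 \<le> q l" "\<And>l. real_of_rat (q l) \<le> 1 - 1 / (real n + 1)"
    "\<And>l. - (1 / (real l + 1)) \<le> F (of_rat (q l))" and qG: "\<And>l p. 0 \<le> p \<Longrightarrow> p \<le> q l \<Longrightarrow> 1 / (real m + 1) \<le> G (of_rat p)"
    by blast
  define c where "c = 1 - 1 / (real n + 1)"
  have c1: "c < 1" by (auto simp: c_def field_simps)
  have "\<forall>l. real_of_rat (q l) \<in> {0..c}" using q0 by (simp add: c_def)
  moreover have "compact {0..c}" by simp
  ultimately obtain r \<sigma> where r: "r \<in> {0..c}" and \<sigma>: "strict_mono (\<sigma> :: nat \<Rightarrow> nat)" "((\<lambda>l. real_of_rat (q l)) \<circ> \<sigma>) \<longlonglongrightarrow> r"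
    unfolding compact_def by metis
  have lim: "(\<lambda>l. real_of_rat (q (\<sigma> l))) \<longlonglongrightarrow> r" using \<sigma>(2) by (simp add: o_def)
  have "real_of_rat (q (\<sigma> l)) \<in> {0..<1}" for l
    using q0(1)[of "\<sigma> l"] le_less_trans[OF q0(2)[of "\<sigma> l", folded c_def] c1] by simp
  then have limF: "(\<lambda>l. F (real_of_rat (q (\<sigma> l)))) \<longlonglongrightarrow> F r"
    using r c1 by (intro continuous_on_tendsto_compose[OF F lim]) auto
  have "(\<lambda>l. - (1 / (real l + 1))) \<longlonglongrightarrow> - 0"
    by (intro tendsto_minus) (use LIMSEQ_inverse_real_of_nat in \<open>simp add: inverse_eq_divide add.commute\<close>)
  from LIMSEQ_subseq_LIMSEQ[OF this \<sigma>(1)]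
  have "(\<lambda>l. - (1 / (real (\<sigma> l) + 1))) \<longlonglongrightarrow> 0" by (simp add: o_def)
  from LIMSEQ_le[OF this limF] have Fr: "0 \<le> F r" using q0(3) by blast
  have less: "1 / (real m + 1) \<le> G v" if v: "0 \<le> v" "v < r" for v
  proof -
    from order_tendstoD(1)[OF lim v(2)] obtain l where l: "v < real_of_rat (q (\<sigma> l))"
      by (auto simp: eventually_sequentially)
    show ?thesis
    proof (rule ge_of_rational_right[OF G v(1) l])
      show "real_of_rat (q (\<sigma> l)) \<le> 1" using less_imp_le[OF le_less_trans[OF q0(2)[of "\<sigma> l", folded c_def] c1]] .
      fix p :: rat assume "v < of_rat p" "real_of_rat p < of_rat (q (\<sigma> l))"
      then show "1 / (real m + 1) \<le> G (of_rat p)"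
        using v(1) by (intro qG[of p "\<sigma> l"]) (metis le_less_trans less_imp_le zero_le_of_rat_iff, simp add: of_rat_less)
    qed
  qed
  \<comment> \<open>For \<open>r = 0\<close> there is nothing to the left to approach from, but then
    the rational 0 itself is covered by the hypothesis.\<close>
  have "1 / (real m + 1) \<le> G r"
  proof (cases "r = 0")
    case True
    then show ?thesis using qG[of 0 0] q0(1)[of 0] by simp
  next
    case False
    then have "0 < r" using r by auto
    define v where "v k = r - r / (real k + 1)" for k :: nat
    have v: "0 \<le> v k" "v k < r" for k using \<open>0 < r\<close> by (auto simp: v_def field_simps)
    have "(\<lambda>k. r / (real k + 1)) \<longlonglongrightarrow> 0"
      using tendsto_mult_right_zero[OF LIMSEQ_inverse_real_of_nat, of r] by (simp add: field_simps)
    then have "v \<longlonglongrightarrow> r - 0" unfolding v_def by (intro tendsto_diff tendsto_const)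
    then have "v \<longlonglongrightarrow> r" by simp
    moreover have "v k \<in> {0..<1}" for k using v[of k] r c1 by auto
    ultimately have "(\<lambda>k. G (v k)) \<longlonglongrightarrow> G r"
      using r c1 by (intro continuous_on_tendsto_compose[OF G]) auto
    then show ?thesis using less[OF v] by (intro LIMSEQ_le_const[of _ "G r"]) auto
  qed
  moreover have "0 < 1 / (real m + 1)" by simp
  ultimately have "\<forall>v\<in>{0..r}. 0 < G v" using less by (metis atLeastAtMost_iff less_eq_real_def less_le_trans)
  then show ?L using Fr r c1 by (intro bexI[of _ r]) auto
qed

lemma pred_ex_cross_Ico:
  fixes F G :: "real \<Rightarrow> 'b \<Rightarrow> real"
  assumes "\<And>r. 0 \<le> r \<Longrightarrow> F r \<in> borel_measurable K" "\<And>r. 0 \<le> r \<Longrightarrow> G r \<in> borel_measurable K"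
    and "\<And>z. z \<in> space K \<Longrightarrow> continuous_on {0..<1} (\<lambda>r. F r z)" "\<And>z. z \<in> space K \<Longrightarrow> continuous_on {0..<1} (\<lambda>r. G r z)"
  shows "Measurable.pred K (\<lambda>z. \<exists>r\<in>{0..<1}. (0::real) \<le> F r z \<and> (\<forall>v\<in>{0..r}. (0::real) < G v z))"
proof -
  have 1: "Measurable.pred K (\<lambda>z. 0 \<le> p \<and> p \<le> q \<longrightarrow> 1 / (real m + 1) \<le> G (of_rat p) z)" for p q :: rat and m
  proof (cases "0 \<le> p")
    case True
    then have [measurable]: "G (of_rat p) \<in> borel_measurable K" by (intro assms(2)) simp
    show ?thesis by measurable
  qed simp
  have 2: "Measurable.pred K (\<lambda>z. 0 \<le> q \<and> real_of_rat q \<le> 1 - 1 / (real n + 1) \<and>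
        - (1 / (real l + 1)) \<le> F (of_rat q) z \<and> (\<forall>p::rat. 0 \<le> p \<and> p \<le> q \<longrightarrow> 1 / (real m + 1) \<le> G (of_rat p) z))" for q :: rat and n l m
  proof (cases "0 \<le> q")
    case True
    then have [measurable]: "F (of_rat q) \<in> borel_measurable K" by (intro assms(1)) simp
    have 3: "Measurable.pred K (\<lambda>z. - (1 / (real l + 1)) \<le> F (of_rat q) z)" by measurable
    show ?thesis
      by (rule pred_intros_logic(3) pred_intros_countable(1) 1 3 measurable_const UNIV_I | simp)+
  qed simp
  have "Measurable.pred K (\<lambda>z. \<exists>(n::nat) m::nat. \<forall>l::nat. \<exists>q::rat. 0 \<le> q \<and> real_of_rat q \<le> 1 - 1 / (real n + 1) \<and>
        - (1 / (real l + 1)) \<le> F (of_rat q) z \<and> (\<forall>p::rat. 0 \<le> p \<and> p \<le> q \<longrightarrow> 1 / (real m + 1) \<le> G (of_rat p) z))"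
    by (intro pred_intros_countable 2)
  also have "?this \<longleftrightarrow> ?thesis"
    by (intro measurable_cong ex_cross_Ico_iff[symmetric] assms(3,4))
  finally show ?thesis .
qed


text \<open>The right end is excluded: with right-continuous jumps, the value at a jump time belongs
  to the next piece.\<close>

definition in_strip :: "real \<Rightarrow> real \<Rightarrow> real \<Rightarrow> real \<Rightarrow> real \<Rightarrow> real \<Rightarrow> (real \<Rightarrow> real) \<Rightarrow> bool" where
  "in_strip a b c d p q w \<longleftrightarrow> (\<forall>u\<in>{p..<q}. - (c * u + d) < w u \<and> w u < a * u + b)"

text \<open>This is \<open>crossing_event\<close> as a predicate of a single path. The arguments are
  intercept and slope of the line to be reached, followed by those of the line to be
  avoided.\<close>

definition crosses :: "real \<Rightarrow> real \<Rightarrow> real \<Rightarrow> real \<Rightarrow> real \<Rightarrow> (real \<Rightarrow> real) \<Rightarrow> bool" where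
  "crosses \<gamma>1 \<delta>1 \<gamma>2 \<delta>2 T w \<longleftrightarrow>
    (\<exists>s\<in>{0..<T}. w s \<ge> \<delta>1 * s + \<gamma>1 \<and> (\<forall>u\<in>{0..s}. w u > \<delta>2 * u + \<gamma>2))"

text \<open>Transfers an interval with random end points to the fixed parameter range
  \<open>{0..<1}\<close>, for which measurability has been settled.\<close>

lemma Ico_reparam:
  fixes p q :: real
  assumes "p < q"
  shows "(\<forall>u\<in>{p..<q}. P u) \<longleftrightarrow> (\<forall>r\<in>{0..<1}. P (p + r * (q - p)))"
proof
  assume L: "\<forall>u\<in>{p..<q}. P u"
  show "\<forall>r\<in>{0..<1}. P (p + r * (q - p))"
  proof
    fix r :: real assume r: "r \<in> {0..<1}"
    have "r * (q - p) < 1 * (q - p)" using assms r by (intro mult_strict_right_mono) auto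
    moreover have "0 \<le> r * (q - p)" using assms r by auto
    ultimately have "p + r * (q - p) \<in> {p..<q}" by auto
    with L show "P (p + r * (q - p))" by blast
  qed
next
  assume R: "\<forall>r\<in>{0..<1}. P (p + r * (q - p))"
  show "\<forall>u\<in>{p..<q}. P u"
  proof
    fix u assume u: "u \<in> {p..<q}"
    have "(u - p) / (q - p) \<in> {0..<1}" using assms u by auto
    from bspec[OF R this] show "P u" using assms by simp
  qed
qed

lemma pred_in_strip:
  assumes b: "b \<in> borel_measurable K" and d: "d \<in> borel_measurable K"
    and p: "p \<in> borel_measurable K" and q: "q \<in> borel_measurable K"
    and g: "g \<in> measurable K path_measure" and p0: "\<And>z. z \<in> space K \<Longrightarrow> 0 \<le> p z"
  shows "Measurable.pred K (\<lambda>z. in_strip a (b z) c (d z) (p z) (q z) (g z))"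
proof -
  \<comment> \<open>For \<open>q z \<le> p z\<close> the strip condition is vacuous and
    \<open>U\<close> degenerates to the constant \<open>p z\<close>, so the path is never evaluated
    at a negative time.\<close>
  define U where "U r z = p z + r * max 0 (q z - p z)" for r z
  define F where "F r z = min (g z (U r z) + c * U r z + d z) (a * U r z + b z - g z (U r z))" for r z
  have U0: "0 \<le> U r z" if "0 \<le> r" "z \<in> space K" for r z
    unfolding U_def using that p0 by (intro add_nonneg_nonneg mult_nonneg_nonneg) auto
  have Um: "U r \<in> borel_measurable K" for r
    unfolding U_def using p q by measurable
  have 1: "Measurable.pred K (\<lambda>z. \<forall>r\<in>{0..<1}. 0 < F r z)"
  proof (rule pred_all_pos_Ico)
    fix r :: real assume "0 \<le> r"
    then have [measurable]: "(\<lambda>z. g z (U r z)) \<in> borel_measurable K"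
      using path_eval_measurable_nonneg[OF Um[of r] g U0] by blast
    show "F r \<in> borel_measurable K"
      unfolding F_def using b d Um[of r] by measurable
  next
    fix z assume z: "z \<in> space K"
    have "g z \<in> paths" using measurable_space[OF g z] by simp
    have U: "continuous_on {0..<1} (\<lambda>r. U r z)" unfolding U_def by (intro continuous_intros)
    have "continuous_on {0..<1} (\<lambda>r. g z (U r z))"
      by (rule continuous_on_compose2[OF pathsD(1)[OF \<open>g z \<in> paths\<close>] U]) (use U0 z in auto)
    then show "continuous_on {0..<1} (\<lambda>r. F r z)"
      unfolding F_def using U by (intro continuous_intros)
  qed
  have "in_strip a (b z) c (d z) (p z) (q z) (g z) \<longleftrightarrow> (p z < q z \<longrightarrow> (\<forall>r\<in>{0..<1}. 0 < F r z))" for z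
  proof (cases "p z < q z")
    case True
    have "0 < F r z \<longleftrightarrow> - (c * (p z + r * (q z - p z)) + d z) < g z (p z + r * (q z - p z)) \<and>
        g z (p z + r * (q z - p z)) < a * (p z + r * (q z - p z)) + b z" for r
    proof -
      have "U r z = p z + r * (q z - p z)" using True by (simp add: U_def)
      then show ?thesis unfolding F_def by auto
    qed
    then show ?thesis
      unfolding in_strip_def Ico_reparam[OF True] using True by simp
  qed (auto simp: in_strip_def)
  moreover have "Measurable.pred K (\<lambda>z. p z < q z \<longrightarrow> (\<forall>r\<in>{0..<1}. 0 < F r z))"
    using p q by (intro pred_intros_logic(4) 1 borel_measurable_pred_less)
  ultimately show ?thesis by simp
qed

lemma pred_crosses:
  assumes "0 < T"
  shows "Measurable.pred path_measure (crosses \<gamma>1 \<delta>1 \<gamma>2 \<delta>2 T)"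
proof -
  define F where "F r w = w (T * r) - (\<delta>1 * (T * r) + \<gamma>1)" for r w
  define G where "G r w = w (T * r) - (\<delta>2 * (T * r) + \<gamma>2)" for r w
  have ev: "(\<lambda>w. w (T * r)) \<in> borel_measurable path_measure" if "0 \<le> r" for r
    using that assms by (intro path_eval_measurable) simp
  have ct: "continuous_on {0..<1} (\<lambda>r. w (T * r))" if "w \<in> paths" for w
    by (rule continuous_on_compose2[OF pathsD(1)[OF that]]) (use assms in \<open>auto intro!: continuous_intros\<close>)
  have "Measurable.pred path_measure (\<lambda>w. \<exists>r\<in>{0..<1}. 0 \<le> F r w \<and> (\<forall>v\<in>{0..r}. 0 < G v w))"
    unfolding F_def G_def
  proof (rule pred_ex_cross_Ico)
    fix w assume "w \<in> space path_measure"
    then have w: "w \<in> paths" by simp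
    show "continuous_on {0..<1} (\<lambda>r. w (T * r) - (\<delta>1 * (T * r) + \<gamma>1))"
      by (intro continuous_on_diff[OF ct[OF w]] continuous_intros)
    show "continuous_on {0..<1} (\<lambda>r. w (T * r) - (\<delta>2 * (T * r) + \<gamma>2))"
      by (intro continuous_on_diff[OF ct[OF w]] continuous_intros)
  qed (rule borel_measurable_diff[OF ev]; simp)+
  moreover have "crosses \<gamma>1 \<delta>1 \<gamma>2 \<delta>2 T w \<longleftrightarrow> (\<exists>r\<in>{0..<1}. 0 \<le> F r w \<and> (\<forall>v\<in>{0..r}. 0 < G v w))" for w
  proof
    assume "crosses \<gamma>1 \<delta>1 \<gamma>2 \<delta>2 T w"
    then obtain s where s: "0 \<le> s" "s < T" "w s \<ge> \<delta>1 * s + \<gamma>1" "\<And>u. 0 \<le> u \<Longrightarrow> u \<le> s \<Longrightarrow> w u > \<delta>2 * u + \<gamma>2"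
      unfolding crosses_def by auto
    have "0 < G v w" if "v \<in> {0..s / T}" for v
      using that assms s(4)[of "T * v"] by (auto simp: G_def field_simps)
    then show "\<exists>r\<in>{0..<1}. 0 \<le> F r w \<and> (\<forall>v\<in>{0..r}. 0 < G v w)"
      using s assms by (intro bexI[of _ "s / T"]) (auto simp: F_def)
  next
    assume "\<exists>r\<in>{0..<1}. 0 \<le> F r w \<and> (\<forall>v\<in>{0..r}. 0 < G v w)"
    then obtain r where r: "0 \<le> r" "r < 1" "0 \<le> F r w" "\<And>v. 0 \<le> v \<Longrightarrow> v \<le> r \<Longrightarrow> 0 < G v w" by auto
    have "w u > \<delta>2 * u + \<gamma>2" if "u \<in> {0..T * r}" for u
      using that assms r(4)[of "u / T"] by (auto simp: G_def field_simps)
    then show "crosses \<gamma>1 \<delta>1 \<gamma>2 \<delta>2 T w"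
      unfolding crosses_def using r assms by (intro bexI[of _ "T * r"]) (auto simp: F_def)
  qed
  ultimately show ?thesis by presburger
qed

text \<open>Look at the earlier of the two crossing times: there one event has reached a line that
  the other event still strictly avoids.\<close>

lemma crosses_disjoint:
  "crosses b a (- d) (- c) T w \<Longrightarrow> \<not> crosses d c (- b) (- a) T (\<lambda>u. - w u)"
proof
  assume "crosses b a (- d) (- c) T w" "crosses d c (- b) (- a) T (\<lambda>u. - w u)"
  then obtain s v where s: "0 \<le> s" "w s \<ge> a * s + b" "\<And>u. 0 \<le> u \<Longrightarrow> u \<le> s \<Longrightarrow> w u > - c * u - d"
    and v: "0 \<le> v" "- w v \<ge> c * v + d" "\<And>u. 0 \<le> u \<Longrightarrow> u \<le> v \<Longrightarrow> - w u > - a * u - b"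
    unfolding crosses_def by auto
  show False
    using s(1,2) v(1,2) s(3)[of v] v(3)[of s] by (cases "s \<le> v") auto
qed

text \<open>A path leaves the strip through exactly one of the two lines: consider the first exit time.\<close>

lemma in_strip_iff_not_crosses:
  assumes w: "continuous_on {0..} w" and pos: "\<And>u. 0 \<le> u \<Longrightarrow> - (c * u + d) < a * u + b"
  shows "in_strip a b c d 0 T w \<longleftrightarrow>
    \<not> crosses b a (- d) (- c) T w \<and> \<not> crosses d c (- b) (- a) T (\<lambda>u. - w u)"
proof (intro iffI conjI)
  assume L: "in_strip a b c d 0 T w"
  show "\<not> crosses b a (- d) (- c) T w" "\<not> crosses d c (- b) (- a) T (\<lambda>u. - w u)"
    using L unfolding in_strip_def crosses_def by fastforce+
next
  assume R: "\<not> crosses b a (- d) (- c) T w \<and> \<not> crosses d c (- b) (- a) T (\<lambda>u. - w u)"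
  show "in_strip a b c d 0 T w"
  proof (rule ccontr)
    assume "\<not> in_strip a b c d 0 T w"
    then obtain e where e: "0 \<le> e" "e < T" "\<not> (- (c * e + d) < w e \<and> w e < a * e + b)"
      unfolding in_strip_def by auto
    define f where "f u = max (w u - (a * u + b)) (- w u - (c * u + d))" for u
    have "continuous_on {0..e} w" using w by (rule continuous_on_subset) auto
    then have "continuous_on {0..e} f" unfolding f_def by (intro continuous_intros)
    then have "closed ({0..e} \<inter> f -` {0..})" by (intro continuous_closed_preimage) auto
    then have "compact ({0..e} \<inter> f -` {0..})"
      using compact_Int_closed[of "{0..e}" "{0..e} \<inter> f -` {0..}"] by (simp add: Int_absorb1)
    moreover have "e \<in> {0..e} \<inter> f -` {0..}" using e by (auto simp: f_def)
    ultimately obtain s where s: "s \<in> {0..e} \<inter> f -` {0..}" "\<And>u. u \<in> {0..e} \<inter> f -` {0..} \<Longrightarrow> s \<le> u"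
      using compact_attains_inf by (metis empty_iff)
    have before: "- (c * u + d) < w u \<and> w u < a * u + b" if "0 \<le> u" "u < s" for u
      using s(2)[of u] s(1) that by (fastforce simp: f_def)
    have "0 \<le> f s" "0 \<le> s" "s < T" using s e by auto
    then consider "w s \<ge> a * s + b" | "- w s \<ge> c * s + d" by (fastforce simp: f_def max_def split: if_splits)
    then show False
    proof cases
      case 1
      \<comment> \<open>At \<open>u = s\<close> the path is on or above the upper line, and
        \<open>pos\<close> puts it strictly above the lower one.\<close>
      have "w u > (- c) * u + (- d)" if "u \<in> {0..s}" for u
        using before[of u] that pos[of s] 1 \<open>0 \<le> s\<close> by (cases "u = s") auto
      then have "crosses b a (- d) (- c) T w"
        unfolding crosses_def using 1 \<open>0 \<le> s\<close> \<open>s < T\<close> by (intro bexI[of _ s]) auto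
      with R show False by blast
    next
      case 2
      have "- w u > (- a) * u + (- b)" if "u \<in> {0..s}" for u
        using before[of u] that pos[of s] 2 \<open>0 \<le> s\<close> by (cases "u = s") auto
      then have "crosses d c (- b) (- a) T (\<lambda>u. - w u)"
        unfolding crosses_def using 2 \<open>0 \<le> s\<close> \<open>s < T\<close> by (intro bexI[of _ s]) auto
      with R show False by blast
    qed
  qed
qed

section \<open>Wiener measure, crossing probabilities and the Markov property\<close>

text \<open>\<open>Phi s\<close> is the distribution function of a normal law, and a probability
  measure on the reals is determined by its distribution function.\<close>

lemma interval_measure_Phi:
  assumes "0 < s"
  shows "interval_measure (Phi s) = density lborel (normal_density 0 (sqrt s))"
proof -
  let ?D = "density lborel (normal_density 0 (sqrt s))"
  interpret D: prob_space ?D using assms by (intro prob_space_normal_density) simp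
  interpret D: real_distribution ?D by unfold_locales simp
  have "Phi s = cdf ?D"
  proof
    fix x
    have "cdf ?D x = (LINT y|?D. indicator {..x} y)"
      unfolding cdf_def by simp
    also have "\<dots> = (LINT y|lborel. normal_density 0 (sqrt s) y *\<^sub>R indicator {..x} y)"
      by (rule integral_density) auto
    also have "\<dots> = (LINT y|lborel. 1 / sqrt (2 * pi * s) * (indicator {..x} y *\<^sub>R exp (- y\<^sup>2 / (2 * s))))"
      using assms by (intro Bochner_Integration.integral_cong) (auto simp: normal_density_def)
    also have "\<dots> = Phi s x" unfolding Phi_def set_lebesgue_integral_def by simp
    finally show "Phi s x = cdf ?D x" by simp
  qed
  moreover have "interval_measure (cdf ?D) = ?D"
  proof (rule cdf_unique)
    show "real_distribution (interval_measure (cdf ?D))"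
      by (intro real_distribution_interval_measure D.cdf_nondecreasing D.cdf_is_right_cont D.cdf_lim_at_bot D.cdf_lim_at_top_prob)
    show "real_distribution ?D" ..
    show "cdf (interval_measure (cdf ?D)) = cdf ?D"
      by (intro cdf_interval_measure D.cdf_nondecreasing D.cdf_is_right_cont D.cdf_lim_at_bot)
  qed
  ultimately show ?thesis by simp
qed

text \<open>The derivative exists because an event \<open>X \<in> A\<close> of probability zero
  stays null after intersection with \<open>E\<close>. As it is fixed only up to null sets, it is
  used in tested form, against a bounded function of \<open>X\<close>.\<close>

lemma (in prob_space) cond_prob_at_integral:
  assumes E: "E \<in> events" and X: "X \<in> borel_measurable M" and G: "G \<in> borel_measurable borel"
    and bound: "\<And>x. \<bar>G x\<bar> \<le> C"
  shows "(LINT \<omega>|M. indicator E \<omega> * G (X \<omega>)) = (LINT x|(distr M borel X). cond_prob_at M E X x * G x)"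
    and "integrable (distr M borel X) (\<lambda>x. cond_prob_at M E X x * G x)"
proof -
  let ?N = "distr M borel X" and ?D = "density M (\<lambda>\<omega>. ennreal (indicator E \<omega>))"
  let ?V = "distr ?D borel X"
  interpret N: prob_space ?N by (rule prob_space_distr[OF X])
  note [measurable] = E X G
  have X': "X \<in> borel_measurable ?D" by simp
  have "emeasure ?D (space ?D) = emeasure M E"
    using sets.sets_into_space[OF E]
    by (simp add: emeasure_density ennreal_indicator nn_integral_indicator' Int_absorb2 flip: indicator_inter_arith)
  then have "emeasure ?D (space ?D) \<le> 1" by (simp add: emeasure_le_1)
  then have fin: "finite_measure ?D"
    by (intro finite_measureI) (auto simp: top_unique)
  interpret V: finite_measure ?V by (rule finite_measure.finite_measure_distr[OF fin X'])
  have ac: "absolutely_continuous ?N ?V"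
    unfolding absolutely_continuous_def
  proof
    fix A assume A: "A \<in> null_sets ?N"
    then have [measurable]: "A \<in> sets borel" by auto
    have "emeasure M (X -` A \<inter> space M) = 0" using A by (auto simp: null_sets_def emeasure_distr)
    then have "X -` A \<inter> space M \<in> null_sets M" by (intro null_setsI) auto
    then have "AE \<omega> in M. \<omega> \<notin> X -` A \<inter> space M" by (rule AE_not_in)
    then have "emeasure ?D (X -` A \<inter> space M) = 0"
      by (subst emeasure_density) (auto simp: nn_integral_0_iff_AE elim!: eventually_mono split: split_indicator)
    then show "A \<in> null_sets ?V" by (auto simp: null_sets_def emeasure_distr)
  qed
  have sets: "sets ?V = sets ?N" by simp
  have eqD: "density M (indicator E) = ?D" by (simp add: ennreal_indicator)
  have R: "RN_deriv ?N ?V \<in> borel_measurable ?N" by (rule borel_measurable_RN_deriv)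
  have cm: "cond_prob_at M E X \<in> borel_measurable ?N"
    unfolding cond_prob_at_def[abs_def] eqD by (rule measurable_compose[OF R]) simp
  have "?V = density ?N (RN_deriv ?N ?V)" using N.density_RN_deriv[OF ac sets] by simp
  also have "\<dots> = density ?N (\<lambda>x. ennreal (cond_prob_at M E X x))"
  proof (rule density_cong)
    \<comment> \<open>Finiteness of the derivative makes \<open>enn2real\<close> in
      \<open>cond_prob_at\<close> lossless almost everywhere.\<close>
    have "AE x in ?N. RN_deriv ?N ?V x \<noteq> \<infinity>"
      by (rule N.RN_deriv_finite[OF _ ac sets]) unfold_locales
    then show "AE x in ?N. RN_deriv ?N ?V x = ennreal (cond_prob_at M E X x)"
      by eventually_elim (simp add: cond_prob_at_def eqD less_top)
  qed (use R cm in simp_all)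
  finally have V: "?V = density ?N (\<lambda>x. ennreal (cond_prob_at M E X x))" .
  have nn: "AE x in ?N. 0 \<le> cond_prob_at M E X x" by (simp add: cond_prob_at_def)
  have "integrable ?V G"
    by (rule V.integrable_const_bound[where B=C]) (use bound in auto)
  then show "integrable ?N (\<lambda>x. cond_prob_at M E X x * G x)"
    unfolding V using cm nn by (subst (asm) integrable_density) auto
  have "(LINT x|?N. cond_prob_at M E X x * G x) = (LINT x|?V. G x)"
    unfolding V using cm nn by (subst integral_density) auto
  also have "\<dots> = (LINT \<omega>|?D. G (X \<omega>))" by (rule integral_distr[OF X']) simp
  also have "\<dots> = (LINT \<omega>|M. indicator E \<omega> *\<^sub>R G (X \<omega>))"
    by (rule integral_density) auto
  finally show "(LINT \<omega>|M. indicator E \<omega> * G (X \<omega>)) = (LINT x|?N. cond_prob_at M E X x * G x)" by simp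
qed

lemma measurable_If_zero:
  fixes g :: "_ \<Rightarrow> real"
  assumes "Measurable.pred K P" "g \<in> borel_measurable K"
  shows "(\<lambda>w. if P w then g w else 0) \<in> borel_measurable K"
  by (intro measurable_If assms(2) measurable_const predE assms(1)) simp

locale brownian_space = prob_space M for M :: "'a measure" +
  fixes B :: "real \<Rightarrow> 'a \<Rightarrow> real"
  assumes B: "standard_brownian_motion M B"
begin

definition path :: "'a \<Rightarrow> real \<Rightarrow> real" where
  "path \<omega> u = B u \<omega>"

text \<open>Wiener measure. Since shifted and reflected motions share it, statements about pieces of
  the path are made here rather than on \<open>M\<close>.\<close>

definition W :: "(real \<Rightarrow> real) measure" where
  "W = distr M path_measure path"

lemma path_measurable[measurable]: "path \<in> measurable M path_measure"
  unfolding path_def[abs_def] by (rule brownian_path_measurable[OF B])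

lemma path_paths: "\<omega> \<in> space M \<Longrightarrow> path \<omega> \<in> paths"
  using measurable_space[OF path_measurable] by simp

lemma sets_W[simp, measurable_cong]: "sets W = sets path_measure" by (simp add: W_def)

lemma space_W[simp]: "space W = paths" by (simp add: W_def)

lemma prob_space_W: "prob_space W"
  unfolding W_def by (rule prob_space_distr) simp

lemma W_integral: "f \<in> borel_measurable path_measure \<Longrightarrow> (LINT w|W. f w) = (LINT \<omega>|M. f (path \<omega>))"
  for f :: "_ \<Rightarrow> real"
  unfolding W_def by (rule integral_distr) simp_all

lemma W_unique: "standard_brownian_motion M B' \<Longrightarrow> distr M path_measure (\<lambda>\<omega> u. B' u \<omega>) = W"
  unfolding W_def path_def[abs_def]
  by (rule brownian_law_unique[OF prob_space_axioms _ prob_space_axioms B])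

lemma W_shift: "0 \<le> s \<Longrightarrow> distr M path_measure (\<lambda>\<omega>. shift_path s (path \<omega>)) = W"
  using W_unique[OF brownian_shift[OF prob_space_axioms B]]
  by (simp add: shift_path_def[abs_def] path_def)

lemma uminus_path_measurable: "(\<lambda>w u. - w u) \<in> measurable path_measure path_measure"
  by (rule measurable_path_measure)
    (auto simp: paths_def intro!: continuous_intros borel_measurable_uminus path_eval_measurable)

lemma W_integral_uminus:
  fixes f :: "_ \<Rightarrow> real"
  assumes f: "f \<in> borel_measurable path_measure"
  shows "(LINT w|W. f (\<lambda>u. - w u)) = (LINT w|W. f w)"
proof -
  have "(LINT w|W. f w) = (LINT w|(distr M path_measure (\<lambda>\<omega> u. - B u \<omega>)). f w)"
    by (subst W_unique[OF brownian_uminus[OF prob_space_axioms B]]) simp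
  also have "\<dots> = (LINT \<omega>|M. f (\<lambda>u. - B u \<omega>))"
    by (intro integral_distr brownian_path_measurable[OF brownian_uminus[OF prob_space_axioms B]] f)
  also have "\<dots> = (LINT w|W. f (\<lambda>u. - w u))"
    by (subst W_integral[OF measurable_compose[OF uminus_path_measurable f]]) (simp add: path_def)
  finally show ?thesis by simp
qed

text \<open>The Markov property at a fixed time: past and future are independent and the future has
  law \<open>W\<close>, so the shifted path may be replaced by an independent copy
  \<open>w'\<close>. Boundedness of \<open>f\<close> serves Fubini.\<close>

lemma W_markov:
  fixes f :: "(real \<Rightarrow> real) \<times> (real \<Rightarrow> real) \<Rightarrow> real"
  assumes f: "f \<in> borel_measurable (path_measure \<Otimes>\<^sub>M path_measure)" and bound: "\<And>x. \<bar>f x\<bar> \<le> C"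
    and s: "0 \<le> s"
  shows "(LINT w|W. f (stop_path s w, shift_path s w)) = (LINT w|W. LINT w'|W. f (stop_path s w, w'))"
proof -
  let ?S = "\<lambda>\<omega>. stop_path s (path \<omega>)" and ?T = "\<lambda>\<omega>. shift_path s (path \<omega>)"
  have Sm: "?S \<in> measurable M path_measure"
    by (rule measurable_compose[OF path_measurable stop_path_measurable[OF s]])
  have Tm: "?T \<in> measurable M path_measure"
    by (rule measurable_compose[OF path_measurable shift_path_measurable[OF s]])
  have "indep_var path_measure ?S path_measure ?T"
    using brownian_indep_stop_shift[OF prob_space_axioms B s] by (simp add: path_def[abs_def])
  then have joint: "distr M path_measure ?S \<Otimes>\<^sub>M W = distr M (path_measure \<Otimes>\<^sub>M path_measure) (\<lambda>\<omega>. (?S \<omega>, ?T \<omega>))"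
    unfolding indep_var_distribution_eq W_shift[OF s] by simp
  interpret DS: prob_space "distr M path_measure ?S" by (rule prob_space_distr[OF Sm])
  interpret W: prob_space W by (rule prob_space_W)
  interpret P: pair_prob_space "distr M path_measure ?S" W ..
  have f': "f \<in> borel_measurable (distr M path_measure ?S \<Otimes>\<^sub>M W)"
    using f by (simp cong: measurable_cong_sets)
  have int: "integrable (distr M path_measure ?S \<Otimes>\<^sub>M W) f"
    by (rule P.integrable_const_bound[where B=C]) (use bound f' in auto)
  have inner: "(\<lambda>w. LINT w'|W. f (w, w')) \<in> borel_measurable path_measure"
    using W.borel_measurable_lebesgue_integral[of "\<lambda>w w'. f (w, w')" path_measure] f
    by (simp cong: measurable_cong_sets)
  have "(LINT w|W. f (stop_path s w, shift_path s w)) = (LINT \<omega>|M. f (?S \<omega>, ?T \<omega>))"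
    by (rule W_integral)
      (intro measurable_compose[OF _ f] measurable_Pair stop_path_measurable shift_path_measurable s)
  also have "\<dots> = (LINT x|(distr M path_measure ?S \<Otimes>\<^sub>M W). f x)"
    unfolding joint by (rule integral_distr[symmetric]) (intro measurable_Pair Sm Tm, rule f)
  also have "\<dots> = (LINT w|distr M path_measure ?S. LINT w'|W. f (w, w'))"
    by (rule P.integral_fst'[OF int, symmetric])
  also have "\<dots> = (LINT \<omega>|M. LINT w'|W. f (?S \<omega>, w'))"
    by (rule integral_distr[OF Sm inner])
  also have "\<dots> = (LINT w|W. LINT w'|W. f (stop_path s w, w'))"
    by (rule W_integral[symmetric]) (rule measurable_compose[OF stop_path_measurable[OF s] inner])
  finally show ?thesis .
qed

lemma B_law:
  assumes "0 < T"
  shows "distr M borel (B T) = interval_measure (Phi T)"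
proof -
  have "distributed M lborel (\<lambda>\<omega>. B T \<omega> - B 0 \<omega>) (normal_density 0 (sqrt (T - 0)))"
    using assms by (intro brownian_motionD(4)[OF B]) auto
  then have "distr M lborel (\<lambda>\<omega>. B T \<omega> - B 0 \<omega>) = density lborel (normal_density 0 (sqrt T))"
    by (simp add: distributed_distr_eq_density)
  moreover have "distr M lborel (\<lambda>\<omega>. B T \<omega> - B 0 \<omega>) = distr M borel (B T)"
    using pathsD(2)[OF path_paths] by (intro distr_cong) (auto simp: path_def)
  ultimately show ?thesis by (simp add: interval_measure_Phi[OF assms])
qed

section \<open>Crossing and strip probabilities as Wiener integrals\<close>

lemma crossing_event_eq: "crossing_event M B \<gamma>1 \<delta>1 \<gamma>2 \<delta>2 T = {\<omega> \<in> space M. crosses \<gamma>1 \<delta>1 \<gamma>2 \<delta>2 T (path \<omega>)}"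
  by (simp add: crossing_event_def crosses_def path_def)

lemma crossing_event_events: "0 < T \<Longrightarrow> crossing_event M B \<gamma>1 \<delta>1 \<gamma>2 \<delta>2 T \<in> events"
  unfolding crossing_event_eq using measurable_compose[OF path_measurable pred_crosses]
  by (simp add: pred_def)

text \<open>These two facts are all that later proofs know about \<open>theta\<close>: fixed
  parameters, a bounded test function of the end point, and no pointwise statement.\<close>

lemma
  assumes T: "0 < T" and G: "G \<in> borel_measurable borel" "\<And>x. \<bar>G x\<bar> \<le> C"
  shows theta_integral: "(LINT w|W. (if crosses \<gamma>1 \<delta>1 \<gamma>2 \<delta>2 T w then G (w T) else 0))
      = (LINT x|interval_measure (Phi T). theta M B \<gamma>1 \<delta>1 \<gamma>2 \<delta>2 T x * G x)"
    and theta_integrable: "integrable (interval_measure (Phi T)) (\<lambda>x. theta M B \<gamma>1 \<delta>1 \<gamma>2 \<delta>2 T x * G x)"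
proof -
  note E = crossing_event_events[OF T, of \<gamma>1 \<delta>1 \<gamma>2 \<delta>2]
  have BT: "B T \<in> borel_measurable M" using T by (intro brownian_motionD(1)[OF B]) simp
  note * = cond_prob_at_integral[OF E BT G, folded theta_def B_law[OF T]]
  show "integrable (interval_measure (Phi T)) (\<lambda>x. theta M B \<gamma>1 \<delta>1 \<gamma>2 \<delta>2 T x * G x)"
    using *(2) by (simp add: B_law[OF T])
  have GT: "(\<lambda>w. G (w T)) \<in> borel_measurable path_measure"
    using T by (intro measurable_compose[OF path_eval_measurable G(1)]) simp
  have "(LINT w|W. (if crosses \<gamma>1 \<delta>1 \<gamma>2 \<delta>2 T w then G (w T) else 0))
    = (LINT \<omega>|M. (if crosses \<gamma>1 \<delta>1 \<gamma>2 \<delta>2 T (path \<omega>) then G (path \<omega> T) else 0))"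
    by (rule W_integral) (rule measurable_If_zero[OF pred_crosses[OF T] GT])
  also have "\<dots> = (LINT \<omega>|M. indicator (crossing_event M B \<gamma>1 \<delta>1 \<gamma>2 \<delta>2 T) \<omega> * G (B T \<omega>))"
    by (intro Bochner_Integration.integral_cong) (auto simp: crossing_event_eq path_def)
  also have "\<dots> = (LINT x|interval_measure (Phi T). theta M B \<gamma>1 \<delta>1 \<gamma>2 \<delta>2 T x * G x)"
    using *(1) by (simp add: B_law[OF T])
  finally show "(LINT w|W. (if crosses \<gamma>1 \<delta>1 \<gamma>2 \<delta>2 T w then G (w T) else 0))
      = (LINT x|interval_measure (Phi T). theta M B \<gamma>1 \<delta>1 \<gamma>2 \<delta>2 T x * G x)" .
qed

lemma chi_eq:
  assumes T: "0 < T"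
  shows "chi M B \<gamma>1 \<delta>1 \<gamma>2 \<delta>2 T = (LINT w|W. (if crosses \<gamma>1 \<delta>1 \<gamma>2 \<delta>2 T w then 1 else 0))"
proof -
  have "(LINT w|W. (if crosses \<gamma>1 \<delta>1 \<gamma>2 \<delta>2 T w then 1 else 0 :: real)) = (LINT \<omega>|M. (if crosses \<gamma>1 \<delta>1 \<gamma>2 \<delta>2 T (path \<omega>) then 1 else 0))"
    by (rule W_integral) (rule measurable_If_zero[OF pred_crosses[OF T]], simp)
  also have "\<dots> = (LINT \<omega>|M. indicator (crossing_event M B \<gamma>1 \<delta>1 \<gamma>2 \<delta>2 T) \<omega>)"
    by (intro Bochner_Integration.integral_cong) (auto simp: crossing_event_eq)
  also have "\<dots> = measure M (crossing_event M B \<gamma>1 \<delta>1 \<gamma>2 \<delta>2 T)"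
    using crossing_event_events[OF T, of \<gamma>1 \<delta>1 \<gamma>2 \<delta>2] sets.sets_into_space by (simp add: Int_absorb2)
  finally show ?thesis by (simp add: chi_def)
qed

lemma integrable_W_If:
  fixes g :: "_ \<Rightarrow> real"
  assumes "Measurable.pred path_measure P" "g \<in> borel_measurable path_measure" "\<And>w. \<bar>g w\<bar> \<le> C"
  shows "integrable W (\<lambda>w. if P w then g w else 0)"
proof -
  interpret W: prob_space W by (rule prob_space_W)
  have m: "(\<lambda>w. if P w then g w else 0) \<in> borel_measurable path_measure"
    by (rule measurable_If_zero[OF assms(1,2)])
  \<comment> \<open>The bound at an arbitrary path gives \<open>0 \<le> C\<close>, which covers the
    zero branch.\<close>
  have "0 \<le> C" using assms(3)[of undefined] by linarith
  then have "\<bar>if P w then g w else 0\<bar> \<le> C" for w using assms(3)[of w] by auto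
  then show ?thesis
    using m by (intro W.integrable_const_bound[where B=C]) auto
qed

text \<open>The complement of the strip event is the disjoint union of the two crossing events.
  Reflection invariance moves the sign in the second one from the crossing condition into
  \<open>g\<close>; this is the origin of the argument \<open>- x\<close> of the second
  \<open>theta\<close>.\<close>

lemma strip_split:
  assumes T: "0 < T" and pos: "\<And>u. 0 \<le> u \<Longrightarrow> - (c * u + d) < a * u + b"
    and g: "g \<in> borel_measurable path_measure" "\<And>w. \<bar>g w\<bar> \<le> (C::real)"
  shows "(LINT w|W. (if in_strip a b c d 0 T w then g w else 0)) = (LINT w|W. g w)
    - (LINT w|W. (if crosses b a (- d) (- c) T w then g w else 0))
    - (LINT w|W. (if crosses d c (- b) (- a) T w then g (\<lambda>u. - w u) else 0))"
proof -
  let ?U = "\<lambda>w. if crosses b a (- d) (- c) T w then g w else 0"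
  let ?L = "\<lambda>w. if crosses d c (- b) (- a) T (\<lambda>u. - w u) then g w else 0"
  let ?L' = "\<lambda>w. if crosses d c (- b) (- a) T w then g (\<lambda>u. - w u) else 0"
  have gu: "(\<lambda>w. g (\<lambda>u. - w u)) \<in> borel_measurable path_measure"
    by (rule measurable_compose[OF uminus_path_measurable g(1)])
  have pu: "Measurable.pred path_measure (\<lambda>w. crosses d c (- b) (- a) T (\<lambda>u. - w u))"
    by (rule measurable_compose[OF uminus_path_measurable pred_crosses[OF T]])
  have intU: "integrable W ?U" by (rule integrable_W_If[OF pred_crosses[OF T] g])
  have intL: "integrable W ?L" by (rule integrable_W_If[OF pu g])
  have intg: "integrable W g" using integrable_W_If[of "\<lambda>_. True" g C] g by simp
  have "?L' \<in> borel_measurable path_measure"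
    by (rule measurable_If_zero[OF pred_crosses[OF T] gu])
  from W_integral_uminus[OF this] have L: "(LINT w|W. ?L w) = (LINT w|W. ?L' w)" by (simp cong: if_cong)
  have "(LINT w|W. (if in_strip a b c d 0 T w then g w else 0)) = (LINT w|W. g w - ?U w - ?L w)"
  proof (rule Bochner_Integration.integral_cong)
    fix w assume "w \<in> space W"
    then have "continuous_on {0..} w" by (simp add: paths_def)
    from in_strip_iff_not_crosses[OF this pos, of T] crosses_disjoint[of b a d c T w]
    show "(if in_strip a b c d 0 T w then g w else 0) = g w - ?U w - ?L w" by auto
  qed simp
  also have "\<dots> = (LINT w|W. g w) - (LINT w|W. ?U w) - (LINT w|W. ?L w)"
    using intU intL intg by simp
  finally show ?thesis unfolding L .
qed

lemma chi_strip:
  assumes T: "0 < T" and pos: "\<And>u. 0 \<le> u \<Longrightarrow> - (c * u + d) < a * u + b"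
  shows "1 - chi M B b a (- d) (- c) T - chi M B d c (- b) (- a) T
    = (LINT w|W. (if in_strip a b c d 0 T w then 1 else 0))"
proof -
  interpret W: prob_space W by (rule prob_space_W)
  show ?thesis
    using strip_split[OF T pos, of "\<lambda>_. 1" 1] W.prob_space by (simp add: chi_eq[OF T])
qed

lemma theta_strip:
  assumes T: "0 < T" and pos: "\<And>u. 0 \<le> u \<Longrightarrow> - (c * u + d) < a * u + b"
    and G: "G \<in> borel_measurable borel" "\<And>x. \<bar>G x\<bar> \<le> C"
  shows "(LINT x|interval_measure (Phi T).
      (1 - theta M B b a (- d) (- c) T x - theta M B d c (- b) (- a) T (- x)) * G x)
    = (LINT w|W. (if in_strip a b c d 0 T w then G (w T) else 0))"
proof -
  let ?\<mu> = "interval_measure (Phi T)"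
  let ?t1 = "theta M B b a (- d) (- c) T" and ?t2 = "theta M B d c (- b) (- a) T"
  \<comment> \<open>Symmetry of the normal law, obtained by applying \<open>B_law\<close> to the
    reflected motion.\<close>
  have sym: "distr ?\<mu> borel uminus = ?\<mu>"
  proof -
    have BT: "B T \<in> borel_measurable M" using T by (intro brownian_motionD(1)[OF B]) simp
    interpret U: brownian_space M "\<lambda>u \<omega>. - B u \<omega>"
      by unfold_locales (rule brownian_uminus[OF prob_space_axioms B])
    have "distr ?\<mu> borel uminus = distr M borel (\<lambda>\<omega>. - B T \<omega>)"
      unfolding B_law[OF T, symmetric] by (subst distr_distr) (use BT in \<open>auto simp: o_def\<close>)
    also have "\<dots> = ?\<mu>" by (rule U.B_law[OF T])
    finally show ?thesis .
  qed
  have G': "(\<lambda>x. G (- x)) \<in> borel_measurable borel" "\<And>x. \<bar>G (- x)\<bar> \<le> C" using G by auto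
  have GT: "(\<lambda>w. G (w T)) \<in> borel_measurable path_measure"
    using T by (intro measurable_compose[OF path_eval_measurable G(1)]) simp
  \<comment> \<open>Measurability of \<open>theta\<close> in the end point, from integrability with
    the test function 1.\<close>
  have tm: "theta M B \<gamma>1 \<delta>1 \<gamma>2 \<delta>2 T \<in> borel_measurable borel" for \<gamma>1 \<delta>1 \<gamma>2 \<delta>2
    using borel_measurable_integrable[OF theta_integrable[OF T, of "\<lambda>_. 1" 1]] by simp
  have int2: "integrable ?\<mu> (\<lambda>x. ?t2 (- x) * G x)"
  proof -
    have "integrable (distr ?\<mu> borel uminus) (\<lambda>x. ?t2 x * G (- x))"
      unfolding sym by (rule theta_integrable[OF T G'])
    then show ?thesis
      using tm G by (subst (asm) integrable_distr_eq) auto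
  qed
  have eq2: "(LINT x|?\<mu>. ?t2 (- x) * G x) = (LINT x|?\<mu>. ?t2 x * G (- x))"
  proof -
    have "(LINT x|?\<mu>. ?t2 x * G (- x)) = (LINT x|distr ?\<mu> borel uminus. ?t2 x * G (- x))" by (simp only: sym)
    also have "\<dots> = (LINT x|?\<mu>. ?t2 (- x) * G (- (- x)))"
      using tm G' by (intro integral_distr borel_measurable_times) auto
    finally show ?thesis by simp
  qed
  have int1: "integrable ?\<mu> (\<lambda>x. ?t1 x * G x)" by (rule theta_integrable[OF T G])
  have int0: "integrable ?\<mu> G" "(LINT x|?\<mu>. G x) = (LINT w|W. G (w T))"
  proof -
    have BT: "B T \<in> borel_measurable M" using T by (intro brownian_motionD(1)[OF B]) simp
    interpret \<mu>: prob_space ?\<mu> unfolding B_law[OF T, symmetric] by (rule prob_space_distr[OF BT])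
    show "integrable ?\<mu> G"
      using G by (intro \<mu>.integrable_const_bound[where B=C]) auto
    have "(LINT x|?\<mu>. G x) = (LINT \<omega>|M. G (B T \<omega>))"
      unfolding B_law[OF T, symmetric] by (rule integral_distr[OF BT G(1)])
    also have "\<dots> = (LINT w|W. G (w T))" by (subst W_integral[OF GT]) (simp add: path_def)
    finally show "(LINT x|?\<mu>. G x) = (LINT w|W. G (w T))" .
  qed
  have "(LINT x|?\<mu>. (1 - ?t1 x - ?t2 (- x)) * G x) = (LINT x|?\<mu>. G x - ?t1 x * G x - ?t2 (- x) * G x)"
    by (simp add: algebra_simps)
  also have "\<dots> = (LINT x|?\<mu>. G x) - (LINT x|?\<mu>. ?t1 x * G x) - (LINT x|?\<mu>. ?t2 (- x) * G x)"
    using int0(1) int1 int2 by simp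
  also have "\<dots> = (LINT w|W. (if in_strip a b c d 0 T w then G (w T) else 0))"
    using strip_split[where g="\<lambda>w. G (w T)", OF T pos GT G(2)]
    unfolding eq2 int0(2) theta_integral[OF T G, symmetric] theta_integral[OF T G', symmetric] by simp
  finally show ?thesis .
qed

end

section \<open>The iterated integral for deterministic jumps\<close>

text \<open>Jump vectors are indexed from 1; the origin of time is added as knot 0.\<close>

definition knot :: "(nat \<Rightarrow> real) \<Rightarrow> nat \<Rightarrow> real" where
  "knot s i = (if i = 0 then 0 else s i)"

lemma knot_0[simp]: "knot s 0 = 0" by (simp add: knot_def)

lemma waiting_time_Suc: "waiting_time s (Suc k) = knot s (Suc k) - knot s k"
  by (cases k) (auto simp: waiting_time_def knot_def)

lemma sum_waiting_time: "(\<Sum>i=1..k. waiting_time s i) = knot s k"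
  by (induction k) (simp_all add: waiting_time_Suc)

lemma knot_nonneg:
  assumes "\<forall>i<k. knot s i < knot s (Suc i)"
  shows "0 \<le> knot s k"
  using assms
proof (induction k)
  case (Suc k)
  then have "0 \<le> knot s k" "knot s k < knot s (Suc k)" by auto
  then show ?case by linarith
qed simp

text \<open>\<open>b_seq\<close> at index \<open>i\<close> reads only the coordinates of
  \<open>x\<close> below \<open>i\<close>. Hence all earlier factors of the product are constants in
  the innermost integral.\<close>

lemma b_seq_upd: "i \<le> Suc k \<Longrightarrow> b_seq a b v h (x(Suc k := y)) i = b_seq a b v h x i"
proof (induction i rule: less_induct)
  case (less i)
  consider "i = 0" | "i = Suc 0" | j where "i = Suc (Suc j)" by (metis not0_implies_Suc)
  then show ?case
  proof cases
    case 3
    have "b_seq a b v h (x(Suc k := y)) (Suc j) = b_seq a b v h x (Suc j)"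
      by (rule less.IH) (use 3 less.prems in auto)
    moreover have "(x(Suc k := y)) (Suc j) = x (Suc j)" using 3 less.prems by simp
    ultimately show ?thesis unfolding 3 by (simp only: b_seq.simps)
  qed simp_all
qed

lemma d_seq_upd: "i \<le> Suc k \<Longrightarrow> d_seq c d v h (x(Suc k := y)) i = d_seq c d v h x i"
proof (induction i rule: less_induct)
  case (less i)
  consider "i = 0" | "i = Suc 0" | j where "i = Suc (Suc j)" by (metis not0_implies_Suc)
  then show ?case
  proof cases
    case 3
    have "d_seq c d v h (x(Suc k := y)) (Suc j) = d_seq c d v h x (Suc j)"
      by (rule less.IH) (use 3 less.prems in auto)
    moreover have "(x(Suc k := y)) (Suc j) = x (Suc j)" using 3 less.prems by simp
    ultimately show ?thesis unfolding 3 by (simp only: d_seq.simps)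
  qed simp_all
qed

text \<open>Increments and heights enter the two sequences with opposite signs and cancel: a jump
  translates the strip, but its width remains that of the original strip at this time.\<close>

lemma b_seq_plus_d_seq:
  "b_seq a b (waiting_time s) h x (Suc k) + d_seq c d (waiting_time s) h x (Suc k) = (a + c) * knot s k + b + d"
  by (induction k) (simp_all add: waiting_time_Suc algebra_simps)

text \<open>Only the width matters, and it is that of the original strip at time
  \<open>u + knot s k\<close>. The shifted intercepts themselves may well be negative.\<close>

lemma strip_seq_pos:
  assumes "\<And>u. 0 \<le> u \<Longrightarrow> - (c * u + d) < a * u + b" "0 \<le> knot s k" "0 \<le> u"
  shows "- (c * u + d_seq c d (waiting_time s) h x (Suc k)) < a * u + b_seq a b (waiting_time s) h x (Suc k)"
  using assms(1)[of "u + knot s k"] assms(2,3) b_seq_plus_d_seq[of a b s h x k c d]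
  by (simp add: algebra_simps)

section \<open>Measurable dependence on the increments\<close>

abbreviation seq_space :: "(nat \<Rightarrow> real) measure" where
  "seq_space \<equiv> Pi\<^sub>M UNIV (\<lambda>_. borel)"

lemma seq_component_measurable: "(\<lambda>x. x i) \<in> borel_measurable seq_space"
  by (rule measurable_component_singleton) simp

lemma b_seq_measurable: "(\<lambda>x. b_seq a b v h x i) \<in> borel_measurable seq_space"
proof (induction i rule: less_induct)
  case (less i)
  consider "i = 0" | "i = Suc 0" | j where "i = Suc (Suc j)" by (metis not0_implies_Suc)
  then show ?case
  proof cases
    case 3
    then have "(\<lambda>x. b_seq a b v h x (Suc j)) \<in> borel_measurable seq_space" using less by auto
    then show ?thesis using 3 by (simp add: borel_measurable_diff borel_measurable_add seq_component_measurable)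
  qed simp_all
qed

lemma d_seq_measurable: "(\<lambda>x. d_seq c d v h x i) \<in> borel_measurable seq_space"
proof (induction i rule: less_induct)
  case (less i)
  consider "i = 0" | "i = Suc 0" | j where "i = Suc (Suc j)" by (metis not0_implies_Suc)
  then show ?case
  proof cases
    case 3
    then have "(\<lambda>x. d_seq c d v h x (Suc j)) \<in> borel_measurable seq_space" using less by auto
    then show ?thesis using 3 by (simp add: borel_measurable_add seq_component_measurable)
  qed simp_all
qed

lemma alpha_seq_measurable: "(\<lambda>x. alpha_seq c d v h x i) \<in> borel_measurable seq_space"
  unfolding alpha_seq_def
  by (intro borel_measurable_uminus borel_measurable_min borel_measurable_add borel_measurable_const d_seq_measurable)

lemma beta_seq_measurable: "(\<lambda>x. beta_seq a b v h x i) \<in> borel_measurable seq_space"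
  unfolding beta_seq_def
  by (intro borel_measurable_diff borel_measurable_min borel_measurable_add borel_measurable_const b_seq_measurable)

lemma seq_upd_measurable:
  assumes "f \<in> measurable K seq_space" "g \<in> borel_measurable K"
  shows "(\<lambda>z. (f z)(i := g z)) \<in> measurable K seq_space"
proof (rule measurable_PiM_single')
  fix j :: nat
  show "(\<lambda>z. ((f z)(i := g z)) j) \<in> borel_measurable K"
    using assms measurable_compose[OF assms(1) seq_component_measurable[of j]]
    by (cases "j = i") simp_all
qed simp

text \<open>Increments of a path between knots, arranged as \<open>iterated_integral\<close>
  arranges its variables: the zero sequence with coordinates 1 to \<open>k\<close> filled
  in.\<close>

primrec incr :: "(nat \<Rightarrow> real) \<Rightarrow> nat \<Rightarrow> (real \<Rightarrow> real) \<Rightarrow> nat \<Rightarrow> real" where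
  "incr s 0 w = (\<lambda>_. 0)"
| "incr s (Suc k) w = (incr s k w)(Suc k := shift_path (knot s k) w (waiting_time s (Suc k)))"

text \<open>The path \<open>w\<close> is measured from the start of its piece. The end-point bounds
  are the limits of the integral over coordinate \<open>i\<close>; being built from minima, they ask
  that the value be inside the strip both before and after the jump.\<close>

definition piece_ok ::
  "real \<Rightarrow> real \<Rightarrow> real \<Rightarrow> real \<Rightarrow> (nat \<Rightarrow> real) \<Rightarrow> (nat \<Rightarrow> real) \<Rightarrow> nat \<Rightarrow> (nat \<Rightarrow> real) \<Rightarrow> (real \<Rightarrow> real) \<Rightarrow> bool" where
  "piece_ok a b c d v h i x w \<longleftrightarrow>
     in_strip a (b_seq a b v h x i) c (d_seq c d v h x i) 0 (v i) w \<and>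
     alpha_seq c d v h x i < w (v i) \<and> w (v i) < beta_seq a b v h x i"

primrec survive ::
  "real \<Rightarrow> real \<Rightarrow> real \<Rightarrow> real \<Rightarrow> (nat \<Rightarrow> real) \<Rightarrow> (nat \<Rightarrow> real) \<Rightarrow> nat \<Rightarrow> (real \<Rightarrow> real) \<Rightarrow> bool" where
  "survive a b c d s h 0 w \<longleftrightarrow> True"
| "survive a b c d s h (Suc k) w \<longleftrightarrow> survive a b c d s h k w \<and>
     piece_ok a b c d (waiting_time s) h (Suc k) (incr s k w) (shift_path (knot s k) w)"

text \<open>Nothing after the \<open>k\<close>-th knot is read. So both quantities can be computed
  from the stopped path, which is the form that the Markov property asks for.\<close>

lemma incr_survive_cong:
  assumes "\<forall>i<k. knot s i < knot s (Suc i)" "\<And>u. 0 \<le> u \<Longrightarrow> u \<le> knot s k \<Longrightarrow> w u = w' u"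
  shows "incr s k w = incr s k w'" "survive a b c d s h k w \<longleftrightarrow> survive a b c d s h k w'"
proof -
  have "incr s k w = incr s k w' \<and> (survive a b c d s h k w \<longleftrightarrow> survive a b c d s h k w')"
    using assms
  proof (induction k)
    case (Suc k)
    have k: "\<forall>i<k. knot s i < knot s (Suc i)" "knot s k < knot s (Suc k)" using Suc.prems(1) by auto
    note k0 = knot_nonneg[OF k(1)]
    have IH: "incr s k w = incr s k w'" "survive a b c d s h k w \<longleftrightarrow> survive a b c d s h k w'"
      using Suc.IH[OF k(1)] Suc.prems(2) k(2) by auto
    have sh: "shift_path (knot s k) w u = shift_path (knot s k) w' u" if "0 \<le> u" "u \<le> waiting_time s (Suc k)" for u
      unfolding shift_path_def using that k0 k(2) by (simp add: Suc.prems(2) waiting_time_Suc)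
    have v: "0 \<le> waiting_time s (Suc k)" using k(2) by (simp add: waiting_time_Suc)
    have "piece_ok a b c d (waiting_time s) h (Suc k) (incr s k w) (shift_path (knot s k) w)
      \<longleftrightarrow> piece_ok a b c d (waiting_time s) h (Suc k) (incr s k w) (shift_path (knot s k) w')"
      using sh v unfolding piece_ok_def in_strip_def by auto
    then show ?case using IH sh[OF v order_refl] by simp
  qed simp
  then show "incr s k w = incr s k w'" "survive a b c d s h k w \<longleftrightarrow> survive a b c d s h k w'" by auto
qed

lemma incr_survive_stop:
  assumes "\<forall>i<k. knot s i < knot s (Suc i)"
  shows "incr s k (stop_path (knot s k) w) = incr s k w"
    "survive a b c d s h k (stop_path (knot s k) w) \<longleftrightarrow> survive a b c d s h k w"
  by (rule incr_survive_cong[OF assms]; simp add: stop_path_def)+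

lemma pred_in_strip_seq:
  assumes f: "f \<in> measurable K seq_space" and g: "g \<in> measurable K path_measure"
  shows "Measurable.pred K (\<lambda>z. in_strip a (b_seq a b v h (f z) i) c (d_seq c d v h (f z) i) 0 T (g z))"
  by (rule pred_in_strip[OF measurable_compose[OF f b_seq_measurable] measurable_compose[OF f d_seq_measurable] _ _ g]) simp_all

lemma pred_piece_ok:
  assumes f: "f \<in> measurable K seq_space" and g: "g \<in> measurable K path_measure" and v: "0 \<le> v i"
  shows "Measurable.pred K (\<lambda>z. piece_ok a b c d v h i (f z) (g z))"
proof -
  have ev: "(\<lambda>z. g z (v i)) \<in> borel_measurable K" by (rule measurable_compose[OF g path_eval_measurable[OF v]])
  show ?thesis
    unfolding piece_ok_def
    by (intro pred_intros_logic(3) pred_in_strip_seq[OF f g] borel_measurable_pred_less ev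
        measurable_compose[OF f alpha_seq_measurable] measurable_compose[OF f beta_seq_measurable])
qed

lemma incr_survive_measurable:
  assumes "\<forall>i<k. knot s i < knot s (Suc i)"
  shows "incr s k \<in> measurable path_measure seq_space"
    and "Measurable.pred path_measure (survive a b c d s h k)"
proof -
  have "incr s k \<in> measurable path_measure seq_space \<and> Measurable.pred path_measure (survive a b c d s h k)"
    using assms
  proof (induction k)
    case 0
    have "incr s 0 = (\<lambda>w. \<lambda>_. 0)" by (simp add: fun_eq_iff)
    moreover have "survive a b c d s h 0 = (\<lambda>w. True)" by (simp add: fun_eq_iff)
    moreover have "(\<lambda>w::real \<Rightarrow> real. \<lambda>_. 0) \<in> measurable path_measure seq_space" by (rule measurable_PiM_single') auto
    ultimately show ?case by simp
  next
    case (Suc k)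
    have k: "\<forall>i<k. knot s i < knot s (Suc i)" "knot s k < knot s (Suc k)" using Suc.prems(1) by auto
    note k0 = knot_nonneg[OF k(1)]
    have IH: "incr s k \<in> measurable path_measure seq_space" "Measurable.pred path_measure (survive a b c d s h k)"
      using Suc.IH[OF k(1)] by auto
    have v: "0 \<le> waiting_time s (Suc k)" using k(2) by (simp add: waiting_time_Suc)
    note sh = shift_path_measurable[OF k0]
    have "(\<lambda>w. (incr s k w)(Suc k := shift_path (knot s k) w (waiting_time s (Suc k)))) \<in> measurable path_measure seq_space"
      by (rule seq_upd_measurable[OF IH(1) measurable_compose[OF sh path_eval_measurable[OF v]]])
    moreover have "incr s (Suc k) = (\<lambda>w. (incr s k w)(Suc k := shift_path (knot s k) w (waiting_time s (Suc k))))"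
      by (simp add: fun_eq_iff)
    moreover have "Measurable.pred path_measure (\<lambda>w. survive a b c d s h k w \<and>
     piece_ok a b c d (waiting_time s) h (Suc k) (incr s k w) (shift_path (knot s k) w))"
      by (rule pred_intros_logic(3)[OF IH(2) pred_piece_ok[where v="waiting_time s" and i="Suc k", OF IH(1) sh v]])
    moreover have "survive a b c d s h (Suc k) = (\<lambda>w. survive a b c d s h k w \<and>
     piece_ok a b c d (waiting_time s) h (Suc k) (incr s k w) (shift_path (knot s k) w))"
      by (simp add: fun_eq_iff)
    ultimately show ?case by (simp only: simp_thms)
  qed
  then show "incr s k \<in> measurable path_measure seq_space" "Measurable.pred path_measure (survive a b c d s h k)" by auto
qed

context brownian_space begin

text \<open>A nested integral over an independent future becomes one integral along a single path.
  \<open>P\<close> and \<open>G\<close> have to be jointly measurable because their first argument,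
  the past increments, is itself random.\<close>

lemma markov_step:
  assumes k: "\<forall>i<k. knot s i < knot s (Suc i)"
    and P: "Measurable.pred (seq_space \<Otimes>\<^sub>M path_measure) (\<lambda>z. P (fst z) (snd z))"
    and G: "(\<lambda>z. G (fst z) (snd z)) \<in> borel_measurable (seq_space \<Otimes>\<^sub>M path_measure)"
    and bound: "\<And>x w. \<bar>G x w\<bar> \<le> (C::real)"
  shows "(LINT w|W. (if survive a b c d s h k w then (LINT w'|W. (if P (incr s k w) w' then G (incr s k w) w' else 0)) else 0))
    = (LINT w|W. (if survive a b c d s h k w \<and> P (incr s k w) (shift_path (knot s k) w)
         then G (incr s k w) (shift_path (knot s k) w) else 0))"
proof -
  define F where "F z = (if survive a b c d s h k (fst z) \<and> P (incr s k (fst z)) (snd z) then G (incr s k (fst z)) (snd z) else 0)" for z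
  note m = incr_survive_measurable[OF k]
  have pr: "(\<lambda>z. (incr s k (fst z), snd z)) \<in> measurable (path_measure \<Otimes>\<^sub>M path_measure) (seq_space \<Otimes>\<^sub>M path_measure)"
    by (intro measurable_Pair measurable_compose[OF measurable_fst m(1)] measurable_snd)
  have C0: "0 \<le> C" using bound[of undefined undefined] by linarith
  have "F \<in> borel_measurable (path_measure \<Otimes>\<^sub>M path_measure)"
    unfolding F_def
    by (intro measurable_If_zero pred_intros_logic(3) measurable_compose[OF measurable_fst m(2)])
      (use measurable_compose[OF pr P] measurable_compose[OF pr G] in simp_all)
  moreover have "\<bar>F z\<bar> \<le> C" for z unfolding F_def using bound C0 by auto
  ultimately have "(LINT w|W. F (stop_path (knot s k) w, shift_path (knot s k) w)) = (LINT w|W. LINT w'|W. F (stop_path (knot s k) w, w'))"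
    by (rule W_markov[OF _ _ knot_nonneg[OF k]])
  moreover have "(LINT w'|W. F (stop_path (knot s k) w, w'))
    = (if survive a b c d s h k w then (LINT w'|W. (if P (incr s k w) w' then G (incr s k w) w' else 0)) else 0)" for w
    by (simp add: F_def incr_survive_stop[OF k] cong: if_cong)
  ultimately show ?thesis by (simp add: F_def incr_survive_stop[OF k] cong: if_cong)
qed

abbreviation theta_term :: "real \<Rightarrow> real \<Rightarrow> real \<Rightarrow> real \<Rightarrow> (nat \<Rightarrow> real) \<Rightarrow> (nat \<Rightarrow> real) \<Rightarrow> (nat \<Rightarrow> real) \<Rightarrow> nat \<Rightarrow> real" where
  "theta_term a b c d v h x i \<equiv>
    1 - theta M B (b_seq a b v h x i) a (- d_seq c d v h x i) (- c) (v i) (x i)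
      - theta M B (d_seq c d v h x i) c (- b_seq a b v h x i) (- a) (v i) (- x i)"

lemma bounded_integral_W:
  fixes f :: "_ \<Rightarrow> real"
  assumes "integrable W f" "\<And>w. \<bar>f w\<bar> \<le> C"
  shows "\<bar>LINT w|W. f w\<bar> \<le> C"
proof -
  interpret W: prob_space W by (rule prob_space_W)
  have "f w \<le> C" "- C \<le> f w" for w using assms(2)[of w] by auto
  then have "(LINT w|W. f w) \<le> C" "- C \<le> (LINT w|W. f w)"
    using assms(1) by (intro W.integral_le_const W.integral_ge_const; simp)+
  then show ?thesis by linarith
qed

text \<open>The function \<open>g\<close> is arbitrary because the iterated integral removes the last coordinate first: the
  innermost integral of the case \<open>Suc k\<close> becomes the \<open>g\<close> of the case \<open>k\<close>.\<close>

lemma iterated_integral_survive: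
  assumes k: "\<forall>i<k. knot s i < knot s (Suc i)"
    and pos: "\<And>u. 0 \<le> u \<Longrightarrow> - (c * u + d) < a * u + b"
    and g: "g \<in> borel_measurable seq_space" "\<And>x. \<bar>g x\<bar> \<le> (C::real)"
  defines "v \<equiv> waiting_time s"
  shows "iterated_integral (\<lambda>i. interval_measure (Phi (v i))) (alpha_seq c d v h) (beta_seq a b v h) k
      (\<lambda>x. (\<Prod>i=1..k. theta_term a b c d v h x i) * g x) (\<lambda>_. 0)
    = (LINT w|W. (if survive a b c d s h k w then g (incr s k w) else 0))"
  using k g
proof (induction k arbitrary: g)
  case 0
  interpret W: prob_space W by (rule prob_space_W)
  show ?case using W.prob_space by simp
next
  case (Suc k)
  have k: "\<forall>i<k. knot s i < knot s (Suc i)" "knot s k < knot s (Suc k)" using Suc.prems(1) by auto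
  have v: "0 < v (Suc k)" using k(2) by (simp add: v_def waiting_time_Suc)
  define P where "P = piece_ok a b c d v h (Suc k)"
  \<comment> \<open>The end point of the new piece is its increment, that is, coordinate
    \<open>Suc k\<close>.\<close>
  define G where "G x w = g (x(Suc k := w (v (Suc k))))" for x w
  \<comment> \<open>The innermost integral without the outer product, as test function for the
    induction hypothesis. Its measurability comes from the strip event, where \<open>theta\<close>
    no longer appears.\<close>
  define gg where "gg x = (LINT w|W. (if P x w then G x w else 0))" for x
  note gm = Suc.prems(2) and gC = Suc.prems(3)
  have Pm: "Measurable.pred (seq_space \<Otimes>\<^sub>M path_measure) (\<lambda>z. P (fst z) (snd z))"
    unfolding P_def by (rule pred_piece_ok[OF measurable_fst measurable_snd]) (use v in simp)
  have Gm: "(\<lambda>z. G (fst z) (snd z)) \<in> borel_measurable (seq_space \<Otimes>\<^sub>M path_measure)"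
    unfolding G_def
    by (rule measurable_compose[OF seq_upd_measurable[OF measurable_fst measurable_compose[OF measurable_snd path_eval_measurable]] gm])
      (use v in simp)
  have GC: "\<bar>G x w\<bar> \<le> C" for x w using gC by (simp add: G_def)
  have Pm': "Measurable.pred path_measure (P x)" for x
    using measurable_compose[OF measurable_Pair1' Pm, of x] by (simp add: space_PiM)
  have Gm': "G x \<in> borel_measurable path_measure" for x
    using measurable_compose[OF measurable_Pair1' Gm, of x] by (simp add: space_PiM)
  have int: "integrable W (\<lambda>w. if P x w then G x w else 0)" for x
    by (rule integrable_W_If[OF Pm' Gm' GC])
  have C0: "0 \<le> C" using gC[of undefined] by linarith
  have ggC: "\<bar>gg x\<bar> \<le> C" for x
    unfolding gg_def by (rule bounded_integral_W[OF int]) (use GC C0 in auto)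
  have ggm: "gg \<in> borel_measurable seq_space"
  proof -
    interpret W: prob_space W by (rule prob_space_W)
    have "(\<lambda>z. if P (fst z) (snd z) then G (fst z) (snd z) else 0) \<in> borel_measurable (seq_space \<Otimes>\<^sub>M W)"
      using measurable_If_zero[OF Pm Gm] by (simp cong: measurable_cong_sets)
    then show ?thesis
      unfolding gg_def by (intro W.borel_measurable_lebesgue_integral) (simp add: case_prod_beta')
  qed
  have inner: "(LINT y:{alpha_seq c d v h x (Suc k)<..<beta_seq a b v h x (Suc k)}|interval_measure (Phi (v (Suc k))).
        (\<Prod>i=1..Suc k. theta_term a b c d v h (x(Suc k := y)) i) * g (x(Suc k := y)))
      = (\<Prod>i=1..k. theta_term a b c d v h x i) * gg x" for x
  proof -
    let ?I = "{alpha_seq c d v h x (Suc k)<..<beta_seq a b v h x (Suc k)}"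
    let ?b = "b_seq a b v h x (Suc k)" and ?d = "d_seq c d v h x (Suc k)"
    let ?t = "\<lambda>y. 1 - theta M B ?b a (- ?d) (- c) (v (Suc k)) y - theta M B ?d c (- ?b) (- a) (v (Suc k)) (- y)"
    \<comment> \<open>The limits of integration are moved into the test function as an indicator, so
      that \<open>theta_strip\<close> applies with the parameters of this piece frozen.\<close>
    let ?G = "\<lambda>y. indicator ?I y * g (x(Suc k := y))"
    have prod: "(\<Prod>i=1..Suc k. theta_term a b c d v h (x(Suc k := y)) i) = (\<Prod>i=1..k. theta_term a b c d v h x i) * ?t y" for y
    proof -
      have "(\<Prod>i=1..k. theta_term a b c d v h (x(Suc k := y)) i) = (\<Prod>i=1..k. theta_term a b c d v h x i)"
        by (intro prod.cong refl) (simp add: b_seq_upd d_seq_upd)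
      moreover have "theta_term a b c d v h (x(Suc k := y)) (Suc k) = ?t y"
        by (simp add: b_seq_upd d_seq_upd)
      ultimately show ?thesis by simp
    qed
    have "(LINT y:?I|interval_measure (Phi (v (Suc k))).
        (\<Prod>i=1..Suc k. theta_term a b c d v h (x(Suc k := y)) i) * g (x(Suc k := y)))
      = (LINT y|interval_measure (Phi (v (Suc k))). (\<Prod>i=1..k. theta_term a b c d v h x i) * (?t y * ?G y))"
      unfolding set_lebesgue_integral_def prod by (intro Bochner_Integration.integral_cong) simp_all
    also have "\<dots> = (\<Prod>i=1..k. theta_term a b c d v h x i) * (LINT y|interval_measure (Phi (v (Suc k))). ?t y * ?G y)"
      by (rule integral_mult_right_zero)
    also have "(LINT y|interval_measure (Phi (v (Suc k))). ?t y * ?G y)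
      = (LINT w|W. (if in_strip a ?b c ?d 0 (v (Suc k)) w then ?G (w (v (Suc k))) else 0))"
    proof (rule theta_strip[OF v])
      show "- (c * u + ?d) < a * u + ?b" if "0 \<le> u" for u
        unfolding v_def by (rule strip_seq_pos[OF pos knot_nonneg[OF k(1)] that])
      have "(\<lambda>y. x(Suc k := y)) \<in> measurable borel seq_space"
        by (rule seq_upd_measurable) (simp_all add: space_PiM)
      from measurable_compose[OF this gm] have "(\<lambda>y. g (x(Suc k := y))) \<in> borel_measurable borel" .
      then show "?G \<in> borel_measurable borel"
        by (rule borel_measurable_times[rotated]) simp
      show "\<bar>?G y\<bar> \<le> C" for y using C0
        by (cases "y \<in> ?I") (simp_all only: indicator_simps mult_1 mult_zero_left abs_zero gC not_False_eq_True)
    qed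
    also have "\<dots> = gg x"
      unfolding gg_def by (intro Bochner_Integration.integral_cong) (simp_all add: P_def piece_ok_def G_def)
    finally show ?thesis .
  qed
  have "iterated_integral (\<lambda>i. interval_measure (Phi (v i))) (alpha_seq c d v h) (beta_seq a b v h) (Suc k)
      (\<lambda>x. (\<Prod>i=1..Suc k. theta_term a b c d v h x i) * g x) (\<lambda>_. 0)
    = iterated_integral (\<lambda>i. interval_measure (Phi (v i))) (alpha_seq c d v h) (beta_seq a b v h) k
      (\<lambda>x. (\<Prod>i=1..k. theta_term a b c d v h x i) * gg x) (\<lambda>_. 0)"
    by (simp only: iterated_integral.simps inner)
  also have "\<dots> = (LINT w|W. (if survive a b c d s h k w then gg (incr s k w) else 0))"
    by (rule Suc.IH[OF k(1) ggm ggC])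
  also have "\<dots> = (LINT w|W. (if survive a b c d s h (Suc k) w then g (incr s (Suc k) w) else 0))"
    unfolding gg_def markov_step[OF k(1) Pm Gm GC] by (simp add: P_def G_def v_def cong: if_cong)
  finally show ?case .
qed

text \<open>The last stretch ends at \<open>t\<close> without a jump, hence without an end-point
  condition.\<close>

definition stay :: "real \<Rightarrow> real \<Rightarrow> real \<Rightarrow> real \<Rightarrow> (nat \<Rightarrow> real) \<Rightarrow> (nat \<Rightarrow> real) \<Rightarrow> nat \<Rightarrow> real \<Rightarrow> (real \<Rightarrow> real) \<Rightarrow> bool" where
  "stay a b c d s h k t w \<longleftrightarrow> survive a b c d s h k w \<and>
    in_strip a (b_seq a b (waiting_time s) h (incr s k w) (Suc k)) c (d_seq c d (waiting_time s) h (incr s k w) (Suc k))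
      0 (t - knot s k) (shift_path (knot s k) w)"

text \<open>As the last stretch has no end-point variable, its survival probability given the
  earlier increments is the \<open>chi\<close> factor; being bounded and measurable in the
  increments, it is an admissible \<open>g\<close> in
  \<open>iterated_integral_survive\<close>.\<close>

lemma iterated_integral_stay:
  assumes k: "\<forall>i<k. knot s i < knot s (Suc i)" and t: "knot s k < t"
    and pos: "\<And>u. 0 \<le> u \<Longrightarrow> - (c * u + d) < a * u + b"
  defines "v \<equiv> waiting_time s"
  shows "iterated_integral (\<lambda>i. interval_measure (Phi (v i))) (alpha_seq c d v h) (beta_seq a b v h) k
      (\<lambda>x. (\<Prod>i=1..k. theta_term a b c d v h x i) *
        (1 - chi M B (b_seq a b v h x (k + 1)) a (- d_seq c d v h x (k + 1)) (- c) (t - (\<Sum>i=1..k. v i))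
           - chi M B (d_seq c d v h x (k + 1)) c (- b_seq a b v h x (k + 1)) (- a) (t - (\<Sum>i=1..k. v i)))) (\<lambda>_. 0)
    = (LINT w|W. (if stay a b c d s h k t w then 1 else 0))"
proof -
  let ?P = "\<lambda>x w. in_strip a (b_seq a b v h x (Suc k)) c (d_seq c d v h x (Suc k)) 0 (t - knot s k) w"
  define g where "g x = (LINT w|W. (if ?P x w then 1 else 0 :: real))" for x
  have Pm: "Measurable.pred (seq_space \<Otimes>\<^sub>M path_measure) (\<lambda>z. ?P (fst z) (snd z))"
    by (rule pred_in_strip_seq[OF measurable_fst measurable_snd])
  have Pm': "Measurable.pred path_measure (?P x)" for x
    using measurable_compose[OF measurable_Pair1' Pm, of x] by (simp add: space_PiM)
  have g1: "\<bar>g x\<bar> \<le> 1" for x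
    unfolding g_def by (rule bounded_integral_W[OF integrable_W_If[OF Pm', of "\<lambda>_. 1" 1]]) auto
  have gm: "g \<in> borel_measurable seq_space"
  proof -
    interpret W: prob_space W by (rule prob_space_W)
    have "(\<lambda>z. if ?P (fst z) (snd z) then 1 else 0 :: real) \<in> borel_measurable (seq_space \<Otimes>\<^sub>M W)"
      using measurable_If_zero[OF Pm, of "\<lambda>_. 1"] by (simp cong: measurable_cong_sets)
    then show ?thesis
      unfolding g_def by (intro W.borel_measurable_lebesgue_integral) (simp add: case_prod_beta')
  qed
  have chi: "1 - chi M B (b_seq a b v h x (k + 1)) a (- d_seq c d v h x (k + 1)) (- c) (t - (\<Sum>i=1..k. v i))
           - chi M B (d_seq c d v h x (k + 1)) c (- b_seq a b v h x (k + 1)) (- a) (t - (\<Sum>i=1..k. v i)) = g x" for x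
    \<comment> \<open>The waiting times telescope: the time left is
      \<open>t - knot s k\<close>.\<close>
    unfolding g_def v_def sum_waiting_time Suc_eq_plus1[symmetric]
    by (rule chi_strip) (use t strip_seq_pos[OF pos knot_nonneg[OF k]] in auto)
  have "iterated_integral (\<lambda>i. interval_measure (Phi (v i))) (alpha_seq c d v h) (beta_seq a b v h) k
      (\<lambda>x. (\<Prod>i=1..k. theta_term a b c d v h x i) * g x) (\<lambda>_. 0)
    = (LINT w|W. (if survive a b c d s h k w then g (incr s k w) else 0))"
    unfolding v_def by (rule iterated_integral_survive[OF k pos gm g1])
  also have "\<dots> = (LINT w|W. (if stay a b c d s h k t w then 1 else 0))"
    unfolding g_def stay_def v_def[symmetric]
    by (rule markov_step[where G="\<lambda>_ _. 1" and C=1, OF k Pm]) simp_all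
  finally show ?thesis unfolding chi .
qed

end

section \<open>From path pieces to a tube with jumps\<close>

definition heights :: "(nat \<Rightarrow> real) \<Rightarrow> nat \<Rightarrow> real" where
  "heights h j = (\<Sum>i=1..j. h i)"

lemma heights_simps[simp]: "heights h 0 = 0" "heights h (Suc j) = heights h j + h (Suc j)"
  by (simp_all add: heights_def)

text \<open>The \<open>max 0\<close> only matters for vectors \<open>s\<close> with negative entries; it makes the predicate jointly
  measurable without evaluating paths at negative times.\<close>

definition tube ::
  "real \<Rightarrow> real \<Rightarrow> real \<Rightarrow> real \<Rightarrow> nat \<Rightarrow> real \<Rightarrow> (nat \<Rightarrow> real) \<Rightarrow> (nat \<Rightarrow> real) \<Rightarrow> (real \<Rightarrow> real) \<Rightarrow> bool" where
  "tube a b c d k t s h w \<longleftrightarrow> (\<forall>j\<in>{..k}.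
     in_strip a (b - heights h j) c (d + heights h j) (max 0 (knot s j)) (if j < k then s (Suc j) else t) w)"

text \<open>Along an actual path, \<open>b_seq\<close> and \<open>d_seq\<close> are the gaps between
  the process with jumps, \<open>w\<close> plus the accumulated heights, and the upper and lower
  line at the knot. This explains the two recursions of the formula.\<close>

lemma seq_incr:
  assumes "w 0 = 0"
  shows "b_seq a b (waiting_time s) h (incr s k w) (Suc k) = a * knot s k + b - w (knot s k) - heights h k"
    and "d_seq c d (waiting_time s) h (incr s k w) (Suc k) = c * knot s k + d + w (knot s k) + heights h k"
proof -
  show "b_seq a b (waiting_time s) h (incr s k w) (Suc k) = a * knot s k + b - w (knot s k) - heights h k"
  proof (induction k)
    case (Suc k)
    have "b_seq a b (waiting_time s) h (incr s (Suc k) w) (Suc (Suc k)) =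
      a * waiting_time s (Suc k) + b_seq a b (waiting_time s) h (incr s (Suc k) w) (Suc k) - incr s (Suc k) w (Suc k) - h (Suc k)"
      by (rule b_seq.simps)
    also have "b_seq a b (waiting_time s) h (incr s (Suc k) w) (Suc k) = b_seq a b (waiting_time s) h (incr s k w) (Suc k)"
      unfolding incr.simps by (rule b_seq_upd) simp
    also have "incr s (Suc k) w (Suc k) = w (knot s (Suc k)) - w (knot s k)"
      by (simp add: shift_path_def waiting_time_Suc)
    finally show ?case using Suc by (simp add: waiting_time_Suc algebra_simps)
  qed (simp add: assms)
  show "d_seq c d (waiting_time s) h (incr s k w) (Suc k) = c * knot s k + d + w (knot s k) + heights h k"
  proof (induction k)
    case (Suc k)
    have "d_seq c d (waiting_time s) h (incr s (Suc k) w) (Suc (Suc k)) =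
      c * waiting_time s (Suc k) + d_seq c d (waiting_time s) h (incr s (Suc k) w) (Suc k) + incr s (Suc k) w (Suc k) + h (Suc k)"
      by (rule d_seq.simps)
    also have "d_seq c d (waiting_time s) h (incr s (Suc k) w) (Suc k) = d_seq c d (waiting_time s) h (incr s k w) (Suc k)"
      unfolding incr.simps by (rule d_seq_upd) simp
    also have "incr s (Suc k) w (Suc k) = w (knot s (Suc k)) - w (knot s k)"
      by (simp add: shift_path_def waiting_time_Suc)
    finally show ?case using Suc by (simp add: waiting_time_Suc algebra_simps)
  qed (simp add: assms)
qed

lemma in_strip_shift:
  "in_strip a (a * r + b - w r - H) c (c * r + d + w r + H) 0 T (shift_path r w)
    \<longleftrightarrow> in_strip a (b - H) c (d + H) r (r + T) w"
proof
  assume L: "in_strip a (a * r + b - w r - H) c (c * r + d + w r + H) 0 T (shift_path r w)"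
  show "in_strip a (b - H) c (d + H) r (r + T) w"
    unfolding in_strip_def
  proof
    fix u assume "u \<in> {r..<r + T}"
    then have "u - r \<in> {0..<T}" by auto
    from bspec[OF L[unfolded in_strip_def] this]
    show "- (c * u + (d + H)) < w u \<and> w u < a * u + (b - H)"
      by (simp add: shift_path_def algebra_simps)
  qed
next
  assume R: "in_strip a (b - H) c (d + H) r (r + T) w"
  show "in_strip a (a * r + b - w r - H) c (c * r + d + w r + H) 0 T (shift_path r w)"
    unfolding in_strip_def
  proof
    fix u assume "u \<in> {0..<T}"
    then have "r + u \<in> {r..<r + T}" by auto
    from bspec[OF R[unfolded in_strip_def] this]
    show "- (c * u + (c * r + d + w r + H)) < shift_path r w u \<and> shift_path r w u < a * u + (a * r + b - w r - H)"
      by (simp add: shift_path_def algebra_simps)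
  qed
qed

text \<open>Continuity from the left yields weak inequalities only, since the strip condition stops
  short of the right end.\<close>

lemma in_strip_right_end:
  assumes w: "continuous_on {0..} w" and pq: "0 \<le> p" "p < q" and S: "in_strip a b c d p q w"
  shows "- (c * q + d) \<le> w q" "w q \<le> a * q + b"
proof -
  have lim: "(w \<longlongrightarrow> w q) (at_left q)"
  proof -
    have "continuous_on {0<..} w" using w by (rule continuous_on_subset) auto
    then have "isCont w q" using pq by (simp add: continuous_on_eq_continuous_at)
    then have "(w \<longlongrightarrow> w q) (at q)" by (simp add: isCont_def)
    then show ?thesis by (rule tendsto_within_subset) simp
  qed
  have ev: "\<forall>\<^sub>F u in at_left q. u \<in> {p<..<q}" using pq(2) by (intro eventually_at_left_real)
  have "((\<lambda>u. a * u + b) \<longlongrightarrow> a * q + b) (at_left q)" "((\<lambda>u. - (c * u + d)) \<longlongrightarrow> - (c * q + d)) (at_left q)"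
    by (intro tendsto_intros)+
  moreover have "\<forall>\<^sub>F u in at_left q. w u \<le> a * u + b" "\<forall>\<^sub>F u in at_left q. - (c * u + d) \<le> w u"
    using ev by (eventually_elim, use S in \<open>auto simp: in_strip_def intro!: less_imp_le\<close>)+
  ultimately show "- (c * q + d) \<le> w q" "w q \<le> a * q + b"
    using tendsto_le[OF trivial_limit_at_left_real _ lim] tendsto_le[OF trivial_limit_at_left_real lim] by blast+
qed

text \<open>The bounds on the value after the jump are explicit on both sides. Those on the value
  before it follow weakly from the strip up to the knot, and \<open>ne\<close> excludes equality
  with either line.\<close>

lemma piece_ok_iff:
  assumes w: "w \<in> paths" and k: "0 \<le> knot s k" "knot s k < knot s (Suc k)"
    and ne: "w (knot s (Suc k)) \<noteq> a * knot s (Suc k) + b - heights h k" "w (knot s (Suc k)) \<noteq> - (c * knot s (Suc k) + d) - heights h k"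
  shows "piece_ok a b c d (waiting_time s) h (Suc k) (incr s k w) (shift_path (knot s k) w)
    \<longleftrightarrow> in_strip a (b - heights h k) c (d + heights h k) (knot s k) (knot s (Suc k)) w \<and>
      - (c * knot s (Suc k) + d) < w (knot s (Suc k)) + heights h (Suc k) \<and>
      w (knot s (Suc k)) + heights h (Suc k) < a * knot s (Suc k) + b"
proof -
  have v: "knot s k + waiting_time s (Suc k) = knot s (Suc k)" by (simp add: waiting_time_Suc)
  have sh: "shift_path (knot s k) w (waiting_time s (Suc k)) = w (knot s (Suc k)) - w (knot s k)"
    by (simp add: shift_path_def v)
  have av: "a * waiting_time s (Suc k) = a * knot s (Suc k) - a * knot s k"
    "c * waiting_time s (Suc k) = c * knot s (Suc k) - c * knot s k" by (simp_all add: waiting_time_Suc algebra_simps)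
  have "- (c * knot s (Suc k) + (d + heights h k)) < w (knot s (Suc k)) \<and> w (knot s (Suc k)) < a * knot s (Suc k) + (b - heights h k)"
    if "in_strip a (b - heights h k) c (d + heights h k) (knot s k) (knot s (Suc k)) w"
    using in_strip_right_end[OF pathsD(1)[OF w] k that] ne by (auto simp: less_le)
  then show ?thesis
    unfolding piece_ok_def alpha_seq_def beta_seq_def seq_incr[where w=w, OF pathsD(2)[OF w]] in_strip_shift v sh av
    by auto
qed

text \<open>The after-jump condition at a knot is implied by the tube: the knot is the left end of
  the next piece and belongs to its half-open interval, the last of which is nonempty because
  \<open>knot s k < t\<close>.\<close>

lemma stay_iff_tube:
  assumes w: "w \<in> paths" and k: "\<forall>i<k. knot s i < knot s (Suc i)" and t: "knot s k < t"
    and ne: "\<forall>i<k. w (knot s (Suc i)) \<noteq> a * knot s (Suc i) + b - heights h i \<and>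
      w (knot s (Suc i)) \<noteq> - (c * knot s (Suc i) + d) - heights h i"
  shows "(survive a b c d s h k w \<and>
    in_strip a (b_seq a b (waiting_time s) h (incr s k w) (Suc k)) c (d_seq c d (waiting_time s) h (incr s k w) (Suc k))
      0 (t - knot s k) (shift_path (knot s k) w)) \<longleftrightarrow> tube a b c d k t s h w"
proof -
  let ?S = "\<lambda>j q. in_strip a (b - heights h j) c (d + heights h j) (knot s j) q w"
  have nn: "0 \<le> knot s j" if "j \<le> k" for j using that k by (intro knot_nonneg) auto
  have surv: "survive a b c d s h j w \<longleftrightarrow> (\<forall>i<j. ?S i (knot s (Suc i)) \<and>
      - (c * knot s (Suc i) + d) < w (knot s (Suc i)) + heights h (Suc i) \<and>
      w (knot s (Suc i)) + heights h (Suc i) < a * knot s (Suc i) + b)" if "j \<le> k" for j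
    using that
  proof (induction j)
    case (Suc j)
    have "piece_ok a b c d (waiting_time s) h (Suc j) (incr s j w) (shift_path (knot s j) w)
      \<longleftrightarrow> ?S j (knot s (Suc j)) \<and> - (c * knot s (Suc j) + d) < w (knot s (Suc j)) + heights h (Suc j) \<and>
      w (knot s (Suc j)) + heights h (Suc j) < a * knot s (Suc j) + b"
      using Suc.prems k ne nn[of j] by (intro piece_ok_iff[OF w]) auto
    then show ?case using Suc by (simp only: survive.simps less_Suc_eq) auto
  qed simp
  have start: "- (c * knot s j + d) < w (knot s j) + heights h j \<and> w (knot s j) + heights h j < a * knot s j + b"
    if "?S j q" "knot s j < q" for j q
    using bspec[OF that(1)[unfolded in_strip_def], of "knot s j"] that(2) by auto
  have last: "in_strip a (b_seq a b (waiting_time s) h (incr s k w) (Suc k)) c (d_seq c d (waiting_time s) h (incr s k w) (Suc k))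
      0 (t - knot s k) (shift_path (knot s k) w) \<longleftrightarrow> ?S k t"
    unfolding seq_incr[where w=w, OF pathsD(2)[OF w]] in_strip_shift by simp
  \<comment> \<open>The knots are nonnegative here, so \<open>max 0\<close> disappears.\<close>
  have "tube a b c d k t s h w \<longleftrightarrow> (\<forall>j<k. ?S j (knot s (Suc j))) \<and> ?S k t"
    unfolding tube_def atMost_iff[symmetric] using nn
    by (auto simp: le_less knot_def max_def)
  moreover have "- (c * knot s (Suc i) + d) < w (knot s (Suc i)) + heights h (Suc i) \<and>
      w (knot s (Suc i)) + heights h (Suc i) < a * knot s (Suc i) + b"
    if T: "\<forall>j<k. ?S j (knot s (Suc j))" "?S k t" and i: "i < k" for i
  proof (cases "Suc i = k")
    case True
    with start[OF T(2) t] show ?thesis by (simp only:)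
  next
    case False
    then have "Suc i < k" using i by simp
    with T k have "?S (Suc i) (knot s (Suc (Suc i)))" "knot s (Suc i) < knot s (Suc (Suc i))" by blast+
    then show ?thesis by (rule start)
  qed
  ultimately show ?thesis unfolding last surv[OF order_refl] by blast
qed

lemma pred_tube:
  assumes s: "\<And>i. i \<in> {1..k} \<Longrightarrow> (\<lambda>z. s z i) \<in> borel_measurable K"
    and h: "\<And>i. i \<in> {1..k} \<Longrightarrow> (\<lambda>z. h z i) \<in> borel_measurable K"
    and g: "g \<in> measurable K path_measure"
  shows "Measurable.pred K (\<lambda>z. tube a b c d k t (s z) (h z) (g z))"
  unfolding tube_def
proof (rule pred_intros_finite(3))
  fix j assume j: "j \<in> {..k}"
  have H: "(\<lambda>z. heights (h z) j) \<in> borel_measurable K"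
    unfolding heights_def using j by (intro borel_measurable_sum h) auto
  have p: "(\<lambda>z. max 0 (knot (s z) j)) \<in> borel_measurable K"
    using s[of j] j by (cases "j = 0") (auto simp: knot_def)
  have q: "(\<lambda>z. if j < k then s z (Suc j) else t) \<in> borel_measurable K"
    using s[of "Suc j"] by (cases "j < k") auto
  show "Measurable.pred K (\<lambda>z. in_strip a (b - heights (h z) j) c (d + heights (h z) j) (max 0 (knot (s z) j))
      (if j < k then s z (Suc j) else t) (g z))"
    by (rule pred_in_strip[OF _ _ p q g]) (use H in auto)
qed simp

section \<open>Exact hits of a boundary line at a knot\<close>

context brownian_space begin

lemma AE_W_neq:
  assumes "0 < T"
  shows "AE w in W. w T \<noteq> y"
proof -
  have BT: "B T \<in> borel_measurable M" using assms by (intro brownian_motionD(1)[OF B]) simp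
  have "AE x in lborel. x \<noteq> y" by (rule AE_lborel_singleton)
  then have "AE x in distr M borel (B T). x \<noteq> y"
    unfolding B_law[OF assms] interval_measure_Phi[OF assms] by (subst AE_density) auto
  then have "AE \<omega> in M. path \<omega> T \<noteq> y"
    using BT by (subst (asm) AE_distr_iff) (auto simp: path_def)
  moreover have "{w \<in> space path_measure. w T \<noteq> y} \<in> sets path_measure"
    using path_eval_measurable[of T] assms by (intro predE) simp
  ultimately show ?thesis unfolding W_def by (subst AE_distr_iff) auto
qed

text \<open>\<open>stay\<close> and \<open>tube\<close> can differ only if the path meets one of
  finitely many levels at the positive knots. The law at a positive time has a density, so this is a
  null event.\<close>

lemma iterated_integral_tube:
  assumes k: "\<forall>i<k. knot s i < knot s (Suc i)" and t: "knot s k < t"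
    and pos: "\<And>u. 0 \<le> u \<Longrightarrow> - (c * u + d) < a * u + b"
  defines "v \<equiv> waiting_time s"
  shows "iterated_integral (\<lambda>i. interval_measure (Phi (v i))) (alpha_seq c d v h) (beta_seq a b v h) k
      (\<lambda>x. (\<Prod>i=1..k. theta_term a b c d v h x i) *
        (1 - chi M B (b_seq a b v h x (k + 1)) a (- d_seq c d v h x (k + 1)) (- c) (t - (\<Sum>i=1..k. v i))
           - chi M B (d_seq c d v h x (k + 1)) c (- b_seq a b v h x (k + 1)) (- a) (t - (\<Sum>i=1..k. v i)))) (\<lambda>_. 0)
    = measure W {w \<in> space W. tube a b c d k t s h w}"
proof -
  interpret W: prob_space W by (rule prob_space_W)
  have tm: "{w \<in> space W. tube a b c d k t s h w} \<in> sets W"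
    using predE[OF pred_tube[of k "\<lambda>_. s" path_measure "\<lambda>_. h" "\<lambda>w. w" a b c d t]] by simp
  have k0: "0 < knot s (Suc i)" if "i < k" for i
  proof -
    have "0 \<le> knot s i" using that k by (intro knot_nonneg) auto
    then show ?thesis using k that by (meson le_less_trans)
  qed
  have "AE w in W. \<forall>i\<in>{..<k}. w (knot s (Suc i)) \<noteq> a * knot s (Suc i) + b - heights h i \<and>
      w (knot s (Suc i)) \<noteq> - (c * knot s (Suc i) + d) - heights h i"
    using AE_W_neq[OF k0] by (intro AE_finite_allI AE_conjI) auto
  then have ae: "AE w in W. (if stay a b c d s h k t w then 1 else 0) = (indicator {w \<in> space W. tube a b c d k t s h w} w :: real)"
  proof (rule AE_mp, intro AE_I2 impI)
    fix w assume w: "w \<in> space W" and ne: "\<forall>i\<in>{..<k}. w (knot s (Suc i)) \<noteq> a * knot s (Suc i) + b - heights h i \<and>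
      w (knot s (Suc i)) \<noteq> - (c * knot s (Suc i) + d) - heights h i"
    have "stay a b c d s h k t w \<longleftrightarrow> tube a b c d k t s h w"
      unfolding stay_def using w ne by (intro stay_iff_tube k t) auto
    then show "(if stay a b c d s h k t w then 1 else 0) = (indicator {w \<in> space W. tube a b c d k t s h w} w :: real)"
      using w by (simp add: indicator_def)
  qed
  have m: "Measurable.pred path_measure (stay a b c d s h k t)"
    unfolding stay_def[abs_def]
    by (intro pred_intros_logic(3) incr_survive_measurable[OF k] shift_path_measurable knot_nonneg[OF k]
        pred_in_strip_seq[OF incr_survive_measurable(1)[OF k] shift_path_measurable[OF knot_nonneg[OF k]]])
  have "(LINT w|W. (if stay a b c d s h k t w then 1 else 0)) = (LINT w|W. indicator {w \<in> space W. tube a b c d k t s h w} w :: real)"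
  proof (rule integral_cong_AE[OF _ _ ae])
    show "(\<lambda>w. if stay a b c d s h k t w then 1 else (0::real)) \<in> borel_measurable W"
      using measurable_If_zero[OF m, of "\<lambda>_. 1"] by (simp cong: measurable_cong_sets)
    show "(indicator {w \<in> space W. tube a b c d k t s h w} :: _ \<Rightarrow> real) \<in> borel_measurable W"
      using tm by (rule borel_measurable_indicator)
  qed
  also have "\<dots> = measure W {w \<in> space W. tube a b c d k t s h w}"
    using tm sets.sets_into_space[OF tm] by (simp add: Int_absorb2)
  finally have fin: "(LINT w|W. (if stay a b c d s h k t w then 1 else 0)) = measure W {w \<in> space W. tube a b c d k t s h w}" .
  show ?thesis
    unfolding v_def by (rule trans[OF iterated_integral_stay[OF k t pos] fin])
qed

end

section \<open>Jump times of a counting process\<close>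

text \<open>The path-wise content of \<open>counting_process\<close>, free of measurability.\<close>

definition counting_path :: "(real \<Rightarrow> nat) \<Rightarrow> bool" where
  "counting_path f \<longleftrightarrow> f 0 = 0 \<and> (\<forall>s\<ge>0. (f \<longlongrightarrow> f s) (at_right s)) \<and>
    (\<forall>s>0. \<exists>n. (f \<longlongrightarrow> n) (at_left s) \<and> (f s = n \<or> f s = Suc n))"

text \<open>Convergence of integer values means eventual constancy; this and the next lemma turn the
  one-sided limits into intervals of constancy.\<close>

lemma counting_path_right:
  assumes f: "counting_path f" and s: "0 \<le> s"
  obtains e where "s < e" "\<And>r. s \<le> r \<Longrightarrow> r < e \<Longrightarrow> f r = f s"
proof -
  have "(f \<longlongrightarrow> f s) (at_right s)" using f s by (simp add: counting_path_def)
  then have "\<forall>\<^sub>F r in at_right s. f r = f s" by (simp add: tendsto_discrete)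
  then obtain e where "s < e" "\<And>r. s < r \<Longrightarrow> r < e \<Longrightarrow> f r = f s" unfolding eventually_at_right_field by blast
  with that show ?thesis by (metis order_le_less)
qed

lemma counting_path_left:
  assumes f: "counting_path f" and s: "0 < s"
  obtains e n where "0 \<le> e" "e < s" "\<And>r. e < r \<Longrightarrow> r < s \<Longrightarrow> f r = n" "f s = n \<or> f s = Suc n" "left_limit f s = n"
proof -
  obtain n where n: "(f \<longlongrightarrow> n) (at_left s)" "f s = n \<or> f s = Suc n"
    using f s unfolding counting_path_def by blast
  have "left_limit f s = n" unfolding left_limit_def using n(1) by (intro tendsto_Lim) simp_all
  have "\<forall>\<^sub>F r in at_left s. f r = n" using n(1) by (simp add: tendsto_discrete)
  then obtain e where e: "e < s" "\<And>r. e < r \<Longrightarrow> r < s \<Longrightarrow> f r = n" unfolding eventually_at_left_field by blast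
  show ?thesis
    by (rule that[of "max 0 e" n]) (use s e n \<open>left_limit f s = n\<close> in auto)
qed

text \<open>Monotonicity is a local matter: by bisection (\<open>Bolzano\<close>) it is enough to
  compare points close to a given \<open>x\<close> on either side of it, where the two one-sided
  limits decide.\<close>

lemma counting_path_mono:
  assumes f: "counting_path f" and uv: "0 \<le> u" "u \<le> v"
  shows "f u \<le> f v"
proof -
  have "0 \<le> u \<longrightarrow> f u \<le> f v"
    using uv(2)
  proof (induction rule: Bolzano)
    case (trans a b c)
    then show ?case by auto
  next
    case (local x)
    show ?case
    proof (cases "0 \<le> x")
      case False
      then show ?thesis by (intro exI[of _ 1]) auto
    next
      case x: True
      obtain e where e: "x < e" "\<And>r. x \<le> r \<Longrightarrow> r < e \<Longrightarrow> f r = f x" using counting_path_right[OF f x] by blast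
      show ?thesis
      proof (cases "x = 0")
        case True
        \<comment> \<open>No left limit is available at 0; there \<open>p = 0\<close> is forced, and
          0 is the least natural number.\<close>
        have "f 0 = 0" using f by (simp add: counting_path_def)
        then have "0 \<le> p \<longrightarrow> f p \<le> f q" if "p \<le> x \<and> x \<le> q \<and> q - p < 1" for p q
          using that True by (cases "p = 0") auto
        then show ?thesis by (intro exI[of _ 1]) auto
      next
        case False
        then have "0 < x" using x by simp
        then obtain e' n where e': "e' < x" "\<And>r. e' < r \<Longrightarrow> r < x \<Longrightarrow> f r = n" "f x = n \<or> f x = Suc n"
          by (rule counting_path_left[OF f]) blast
        have "f p \<le> f q" if "p \<le> x \<and> x \<le> q \<and> q - p < min (e - x) (x - e')" for p q
        proof -
          have "f q = f x" using that by (intro e(2)) auto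
          moreover have "f p \<le> f x" using that e'(2)[of p] e'(3) by (cases "p = x") auto
          ultimately show ?thesis by simp
        qed
        then show ?thesis using e(1) e'(1) by (intro exI[of _ "min (e - x) (x - e')"]) auto
      qed
    qed
  qed
  with uv show ?thesis by blast
qed

text \<open>Let \<open>r\<close> be the infimum of the times with count at least
  \<open>Suc k\<close>. Right-continuity makes it attained, the left limit is at most
  \<open>k\<close>, and jumps of size at most one pin it to \<open>k\<close>. The earlier point
  \<open>q\<close> with count \<open>k\<close> shows later that the \<open>k\<close>-th jump time
  lies strictly before \<open>r\<close>.\<close>

lemma counting_path_first:
  assumes f: "counting_path f" and s: "0 \<le> s" "Suc k \<le> f s"
  obtains r q where "0 \<le> q" "q < r" "r \<le> s" "f q = k" "f r \<noteq> left_limit f r"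
proof -
  define A where "A = {u. 0 \<le> u \<and> Suc k \<le> f u}"
  define r where "r = Inf A"
  have sA: "s \<in> A" using s by (simp add: A_def)
  have bdd: "bdd_below A" by (auto simp: A_def)
  have r0: "0 \<le> r" unfolding r_def using sA by (intro cInf_greatest) (auto simp: A_def)
  have rs: "r \<le> s" unfolding r_def by (rule cInf_lower[OF sA bdd])
  obtain e where e: "r < e" "\<And>u. r \<le> u \<Longrightarrow> u < e \<Longrightarrow> f u = f r" using counting_path_right[OF f r0] by blast
  have "\<exists>u\<in>A. u < e" using cInf_lessD[of A e] sA e(1) by (auto simp: r_def)
  then obtain u where u: "u \<in> A" "u < e" by blast
  have "r \<le> u" unfolding r_def by (rule cInf_lower[OF u(1) bdd])
  then have fr: "Suc k \<le> f r" using e(2)[OF _ u(2)] u(1) by (simp add: A_def)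
  have "r \<noteq> 0" using fr f by (auto simp: counting_path_def)
  then have "0 < r" using r0 by simp
  then obtain e' n where e': "0 \<le> e'" "e' < r" "\<And>u. e' < u \<Longrightarrow> u < r \<Longrightarrow> f u = n" "f r = n \<or> f r = Suc n" "left_limit f r = n"
    by (rule counting_path_left[OF f]) blast
  define q where "q = (e' + r) / 2"
  have q: "e' < q" "q < r" using e'(2) by (auto simp: q_def)
  have "f q = n" using e'(3) q by blast
  have "q \<notin> A"
  proof
    assume "q \<in> A"
    then have "r \<le> q" unfolding r_def by (rule cInf_lower[OF _ bdd])
    with q show False by simp
  qed
  then have "n \<le> k" using q e'(1) \<open>f q = n\<close> by (auto simp: A_def)
  then have "n = k" "f r = Suc k" using fr e'(4) by auto
  show ?thesis
    by (rule that[of q r]) (use q e' rs \<open>f q = n\<close> \<open>n = k\<close> \<open>f r = Suc k\<close> in auto)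
qed

text \<open>Translates the recursive infimum into the count; finiteness, measurability and position
  of the jump times are read off from it. The delicate half is that the infimum is strictly above
  every time whose count is at most \<open>k\<close>.\<close>

lemma jump_time_le_iff:
  assumes f: "counting_path (\<lambda>r. N r \<omega>)"
  shows "0 \<le> jump_time N k \<omega>" and "0 \<le> s \<Longrightarrow> jump_time N k \<omega> \<le> ereal s \<longleftrightarrow> k \<le> N s \<omega>"
proof -
  have "0 \<le> jump_time N k \<omega> \<and> (\<forall>s\<ge>0. jump_time N k \<omega> \<le> ereal s \<longleftrightarrow> k \<le> N s \<omega>)"
  proof (induction k)
    case 0
    then show ?case by simp
  next
    case (Suc k)
    let ?f = "\<lambda>r. N r \<omega>"
    let ?S = "{ereal s |s. jump_time N k \<omega> < ereal s \<and> N s \<omega> \<noteq> left_limit ?f s}"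
    have IH: "0 \<le> jump_time N k \<omega>" "\<And>s. 0 \<le> s \<Longrightarrow> jump_time N k \<omega> \<le> ereal s \<longleftrightarrow> k \<le> N s \<omega>" using Suc by auto
    have "0 \<le> Inf ?S" using IH(1) by (intro Inf_greatest) (auto intro: order_trans less_imp_le)
    moreover have "Inf ?S \<le> ereal s" if s: "0 \<le> s" "Suc k \<le> N s \<omega>" for s
    proof -
      obtain r q where r: "0 \<le> q" "q < r" "r \<le> s" "N q \<omega> = k" "N r \<omega> \<noteq> left_limit ?f r"
        by (rule counting_path_first[OF f s])
      have "jump_time N k \<omega> \<le> ereal q" using IH(2) r by simp
      also have "ereal q < ereal r" using r by simp
      finally have "ereal r \<in> ?S" using r(5) by blast
      then have "Inf ?S \<le> ereal r" by (rule Inf_lower)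
      also have "\<dots> \<le> ereal s" using r by simp
      finally show ?thesis .
    qed
    moreover have "ereal s < Inf ?S" if s: "0 \<le> s" "\<not> Suc k \<le> N s \<omega>" for s
    proof -
      \<comment> \<open>The count stays constant slightly beyond \<open>s\<close>, so the next jump
        keeps a positive distance from \<open>s\<close> and the infimum is strictly larger.\<close>
      obtain e where e: "s < e" "\<And>r. s \<le> r \<Longrightarrow> r < e \<Longrightarrow> N r \<omega> = N s \<omega>" using counting_path_right[OF f s(1)] by blast
      have "ereal e \<le> Inf ?S"
      proof (rule Inf_greatest)
        fix x assume "x \<in> ?S"
        then obtain r where r: "x = ereal r" "jump_time N k \<omega> < ereal r" "N r \<omega> \<noteq> left_limit ?f r" by blast
        have "0 < ereal r" using IH(1) r(2) by (rule le_less_trans)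
        then have "0 < r" by simp
        then obtain e' n where e': "0 \<le> e'" "e' < r" "\<And>u. e' < u \<Longrightarrow> u < r \<Longrightarrow> N u \<omega> = n" "N r \<omega> = n \<or> N r \<omega> = Suc n" "left_limit ?f r = n"
          by (rule counting_path_left[OF f]) blast
        obtain p where p: "jump_time N k \<omega> = ereal p"
          using IH(1) r(2) by (cases "jump_time N k \<omega>") auto
        \<comment> \<open>A point after the \<open>k\<close>-th jump time and so close to
          \<open>r\<close> that the count there is the left limit. So this left limit is at least
          \<open>k\<close>, and the jump at \<open>r\<close> raises it to at least
          \<open>Suc k\<close>.\<close>
        define q where "q = (max p e' + r) / 2"
        have q: "p < q" "e' < q" "q < r" using r(2) e'(2) by (auto simp: q_def p)
        have "k \<le> N q \<omega>" using IH(2)[of q] q e'(1) by (simp add: p)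
        then have "Suc k \<le> N r \<omega>" using e'(3)[OF q(2,3)] e'(4,5) r(3) by auto
        have "\<not> r < e"
        proof
          assume "r < e"
          have "N r \<omega> \<le> N s \<omega>"
          proof (cases "r \<le> s")
            case True
            then show ?thesis using counting_path_mono[OF f, of r s] \<open>0 < r\<close> by simp
          next
            case False
            then show ?thesis using e(2)[of r] \<open>r < e\<close> by simp
          qed
          with \<open>Suc k \<le> N r \<omega>\<close> s(2) show False by simp
        qed
        then show "ereal e \<le> x" using r(1) by simp
      qed
      moreover have "ereal s < ereal e" using e(1) by simp
      ultimately show ?thesis by (rule less_le_trans[rotated])
    qed
    ultimately show ?case by (simp only: jump_time.simps) (meson not_le)
  qed
  then show "0 \<le> jump_time N k \<omega>" "0 \<le> s \<Longrightarrow> jump_time N k \<omega> \<le> ereal s \<longleftrightarrow> k \<le> N s \<omega>" by auto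
qed

lemma counting_process_path:
  assumes "counting_process M N" "\<omega> \<in> space M"
  shows "counting_path (\<lambda>r. N r \<omega>)"
  using assms unfolding counting_process_def counting_path_def by blast

lemma jump_time_measurable:
  assumes N: "counting_process M N"
  shows "jump_time N k \<in> borel_measurable M"
  unfolding borel_measurable_iff_Iic_ereal
proof
  fix a :: ereal
  have J: "0 \<le> jump_time N k \<omega>" "0 \<le> s \<Longrightarrow> jump_time N k \<omega> \<le> ereal s \<longleftrightarrow> k \<le> N s \<omega>" if "\<omega> \<in> space M" for \<omega> s
    using jump_time_le_iff[where N=N and \<omega>=\<omega>, OF counting_process_path[OF N that]] by blast+
  show "jump_time N k -` {..a} \<inter> space M \<in> sets M"
  proof (cases a)
    case (real r)
    show ?thesis
    proof (cases "0 \<le> r")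
      case True
      have "N r \<in> measurable M (count_space UNIV)" using N True by (simp add: counting_process_def)
      from measurable_sets[OF this, of "{k..}"]
      have "N r -` {k..} \<inter> space M \<in> sets M" by simp
      also have "N r -` {k..} \<inter> space M = jump_time N k -` {..a} \<inter> space M"
        using J(2)[OF _ True] by (auto simp: real)
      finally show ?thesis .
    next
      case False
      have "\<not> jump_time N k \<omega> \<le> ereal r" if "\<omega> \<in> space M" for \<omega>
      proof
        assume "jump_time N k \<omega> \<le> ereal r"
        with J(1)[OF that] have "0 \<le> ereal r" by (rule order_trans)
        with False show False by simp
      qed
      then have "jump_time N k -` {..a} \<inter> space M = {}" by (auto simp: real)
      then show ?thesis by simp
    qed
  next
    case PInf
    then have "jump_time N k -` {..a} \<inter> space M = space M" by auto
    then show ?thesis by simp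
  next
    case MInf
    then have "jump_time N k -` {..a} \<inter> space M = {}" using J(1) by force
    then show ?thesis by simp
  qed
qed

text \<open>By \<open>jump_time_le_iff\<close>, the \<open>j\<close>-th interval of the tube
  consists of the times before \<open>t\<close> with count \<open>j\<close>. A jump at
  \<open>t\<close> itself is allowed: then the last interval is empty, and no time before
  \<open>t\<close> has count \<open>k\<close>.\<close>

lemma strip_iff_tube:
  fixes w :: "real \<Rightarrow> real"
  assumes f: "counting_path (\<lambda>r. N r \<omega>)" and t: "0 < t" and Nt: "N t \<omega> = k"
  shows "(\<forall>u\<in>{0..<t}. - (c * u + d) < w u + (\<Sum>i=1..N u \<omega>. h i) \<and> w u + (\<Sum>i=1..N u \<omega>. h i) < a * u + b)
    \<longleftrightarrow> tube a b c d k t (\<lambda>i\<in>{1..k}. real_of_ereal (jump_time N i \<omega>)) (\<lambda>i\<in>{1..k}. h i) w"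
proof -
  define s where "s = (\<lambda>i\<in>{1..k}. real_of_ereal (jump_time N i \<omega>))"
  define g where "g = (\<lambda>i\<in>{1..k}. h i)"
  note J = jump_time_le_iff[where N=N and \<omega>=\<omega>, OF f]
  have fin: "jump_time N i \<omega> = ereal (s i)" "s i \<le> t" if i: "i \<in> {1..k}" for i
  proof -
    have le: "jump_time N i \<omega> \<le> ereal t" using J(2)[of t i] t Nt i by simp
    with J(1)[of i] show "jump_time N i \<omega> = ereal (s i)"
      using i by (cases "jump_time N i \<omega>") (auto simp: s_def)
    with le show "s i \<le> t" by simp
  qed
  have s_le: "s i \<le> u \<longleftrightarrow> i \<le> N u \<omega>" if "i \<in> {1..k}" "0 \<le> u" for i u
    using J(2)[OF that(2), of i] fin(1)[OF that(1)] by simp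
  have N_le: "N u \<omega> \<le> k" if "0 \<le> u" "u < t" for u
    using counting_path_mono[OF f that(1), of t] that(2) Nt by simp
  have H: "heights g j = (\<Sum>i=1..j. h i)" if "j \<le> k" for j
    unfolding heights_def g_def using that by (intro sum.cong) auto
  have iff: "u \<in> {max 0 (knot s j)..<(if j < k then s (Suc j) else t)} \<longleftrightarrow> 0 \<le> u \<and> u < t \<and> N u \<omega> = j"
    if j: "j \<le> k" for u j
  proof
    assume u: "u \<in> {max 0 (knot s j)..<(if j < k then s (Suc j) else t)}"
    then have u0: "0 \<le> u" by simp
    have ut: "u < t" using u fin(2)[of "Suc j"] by (auto split: if_splits)
    have "j \<le> N u \<omega>" using u s_le[of j u] u0 j by (cases "j = 0") (auto simp: knot_def)
    moreover have "N u \<omega> \<le> j"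
      using u s_le[of "Suc j" u] u0 j N_le[OF u0 ut] by (cases "j < k") auto
    ultimately show "0 \<le> u \<and> u < t \<and> N u \<omega> = j" using u0 ut by simp
  next
    assume u: "0 \<le> u \<and> u < t \<and> N u \<omega> = j"
    have "knot s j \<le> u" using u s_le[of j u] j by (cases "j = 0") (auto simp: knot_def)
    moreover have "u < s (Suc j)" if "j < k" using u s_le[of "Suc j" u] that by auto
    ultimately show "u \<in> {max 0 (knot s j)..<(if j < k then s (Suc j) else t)}" using u by auto
  qed
  show ?thesis
    unfolding s_def[symmetric] g_def[symmetric]
  proof
    assume L: "\<forall>u\<in>{0..<t}. - (c * u + d) < w u + (\<Sum>i=1..N u \<omega>. h i) \<and> w u + (\<Sum>i=1..N u \<omega>. h i) < a * u + b"
    show "tube a b c d k t s g w"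
      unfolding tube_def in_strip_def
    proof (intro ballI)
      fix j u assume "j \<in> {..k}" and u: "u \<in> {max 0 (knot s j)..<(if j < k then s (Suc j) else t)}"
      then have j: "j \<le> k" by simp
      from u have "0 \<le> u \<and> u < t \<and> N u \<omega> = j" using iff[OF j] by blast
      with bspec[OF L, of u] H[OF j]
      show "- (c * u + (d + heights g j)) < w u \<and> w u < a * u + (b - heights g j)" by auto
    qed
  next
    assume R: "tube a b c d k t s g w"
    show "\<forall>u\<in>{0..<t}. - (c * u + d) < w u + (\<Sum>i=1..N u \<omega>. h i) \<and> w u + (\<Sum>i=1..N u \<omega>. h i) < a * u + b"
    proof
      fix u assume u: "u \<in> {0..<t}"
      then have j: "N u \<omega> \<le> k" using N_le by auto
      have "0 \<le> u \<and> u < t \<and> N u \<omega> = N u \<omega>" using u by simp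
      then have "u \<in> {max 0 (knot s (N u \<omega>))..<(if N u \<omega> < k then s (Suc (N u \<omega>)) else t)}"
        unfolding iff[OF j] .
      with R j have "- (c * u + (d + heights g (N u \<omega>))) < w u \<and> w u < a * u + (b - heights g (N u \<omega>))"
        unfolding tube_def in_strip_def by blast
      then show "- (c * u + d) < w u + (\<Sum>i=1..N u \<omega>. h i) \<and> w u + (\<Sum>i=1..N u \<omega>. h i) < a * u + b"
        using H[OF j] by auto
    qed
  qed
qed

section \<open>Independence of path, jump times and heights\<close>

text \<open>With the sigma-algebra of a process packaged as a measure space,
  \<open>measurable\<close> can express that a quantity depends on this process alone.\<close>

definition generated_space :: "'a measure \<Rightarrow> 'i set \<Rightarrow> 'b measure \<Rightarrow> ('i \<Rightarrow> 'a \<Rightarrow> 'b) \<Rightarrow> 'a measure" where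
  "generated_space M I K X = sigma (space M) (generated_events M I K X)"

lemma generated_events_Pow: "generated_events M I K X \<subseteq> Pow (space M)"
proof
  fix A assume "A \<in> generated_events M I K X"
  then have "A \<subseteq> space M"
    unfolding generated_events_def by (rule sigma_sets_into_sp[rotated]) auto
  then show "A \<in> Pow (space M)" by simp
qed

lemma space_generated_space[simp]: "space (generated_space M I K X) = space M"
  unfolding generated_space_def by (rule space_measure_of[OF generated_events_Pow])

lemma sets_generated_space: "sets (generated_space M I K X) = generated_events M I K X"
  unfolding generated_space_def sets_measure_of[OF generated_events_Pow]
  unfolding generated_events_def by (rule sigma_sets_sigma_sets_eq) auto

lemma generated_space_measurable:
  assumes "i \<in> I" "X i \<in> measurable M K"
  shows "X i \<in> measurable (generated_space M I K X) K"
proof (rule measurableI)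
  show "X i \<omega> \<in> space K" if "\<omega> \<in> space (generated_space M I K X)" for \<omega>
    using measurable_space[OF assms(2)] that by simp
  show "X i -` A \<inter> space (generated_space M I K X) \<in> sets (generated_space M I K X)" if "A \<in> sets K" for A
    unfolding sets_generated_space generated_events_def using assms(1) that
    by (intro sigma_sets.Basic) auto
qed

lemma jump_simplex_sets: "jump_simplex k t \<in> sets (Pi\<^sub>M {1..k} (\<lambda>_. borel))"
proof -
  have c: "(\<lambda>s. s i) \<in> borel_measurable (Pi\<^sub>M {1..k} (\<lambda>_. borel :: real measure))" if "i \<in> {1..k}" for i
    by (rule measurable_component_singleton[OF that])
  have "Measurable.pred (Pi\<^sub>M {1..k} (\<lambda>_. borel :: real measure))
    (\<lambda>s. (\<forall>i\<in>{1..k}. 0 < s i \<and> s i < t) \<and> (\<forall>i\<in>{1..k}. \<forall>j\<in>{1..k}. i < j \<longrightarrow> s i < s j))"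
    by (intro pred_intros_logic(3) pred_intros_finite(3) pred_intros_logic(4) borel_measurable_pred_less c
      borel_measurable_const measurable_const) auto
  from predE[OF this] show ?thesis
    by (simp add: jump_simplex_def space_PiM strict_mono_on_def Ball_def)
qed

lemma jump_simplex_knots:
  assumes "s \<in> jump_simplex k t" "0 < t"
  shows "\<forall>i<k. knot s i < knot s (Suc i)" "knot s k < t"
  using assms by (auto simp: jump_simplex_def knot_def strict_mono_on_def)

context brownian_space begin

definition jump_vec :: "(real \<Rightarrow> 'a \<Rightarrow> nat) \<Rightarrow> nat \<Rightarrow> 'a \<Rightarrow> nat \<Rightarrow> real" where
  "jump_vec N k \<omega> = (\<lambda>i\<in>{1..k}. real_of_ereal (jump_time N i \<omega>))"

definition height_vec :: "(nat \<Rightarrow> 'a \<Rightarrow> real) \<Rightarrow> nat \<Rightarrow> 'a \<Rightarrow> nat \<Rightarrow> real" where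
  "height_vec \<eta> k \<omega> = (\<lambda>i\<in>{1..k}. \<eta> i \<omega>)"

lemma jump_vec_measurable:
  assumes "counting_process K N"
  shows "jump_vec N k \<in> measurable K (Pi\<^sub>M {1..k} (\<lambda>_. borel))"
  unfolding jump_vec_def
  by (intro measurable_restrict borel_measurable_real_of_ereal jump_time_measurable[OF assms])

lemma height_vec_measurable:
  assumes "\<And>i. i \<ge> 1 \<Longrightarrow> \<eta> i \<in> borel_measurable K"
  shows "height_vec \<eta> k \<in> measurable K (Pi\<^sub>M {1..k} (\<lambda>_. borel))"
  unfolding height_vec_def using assms by (intro measurable_restrict) auto

text \<open>Applied over the sigma-algebra of \<open>N\<close> itself,
  \<open>jump_time_measurable\<close> then shows that the jump times are functions of
  \<open>N\<close> alone.\<close>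

lemma counting_process_generated:
  assumes "counting_process M N"
  shows "counting_process (generated_space M {0..} (count_space UNIV) N) N"
  using assms unfolding counting_process_def
  by (auto intro!: generated_space_measurable)

end

text \<open>One summand at a time: with \<open>N t = k\<close> of positive probability, conditioning
  on it gives a probability measure.\<close>

locale jump_setting = brownian_space M B for M :: "'a measure" and B +
  fixes N :: "real \<Rightarrow> 'a \<Rightarrow> nat" and \<eta> :: "nat \<Rightarrow> 'a \<Rightarrow> real" and k :: nat and t :: real
  assumes N: "counting_process M N"
    and \<eta>: "\<And>i. i \<ge> 1 \<Longrightarrow> \<eta> i \<in> borel_measurable M"
    and ind: "mutually_independent M B N \<eta>"
    and t: "0 < t"
    and pos_k: "0 < measure M {\<omega> \<in> space M. N t \<omega> = k}"
begin

abbreviation \<open>VK \<equiv> Pi\<^sub>M {1..k} (\<lambda>_. borel :: real measure)\<close>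
abbreviation \<open>SB \<equiv> generated_space M {0..} borel B\<close>
abbreviation \<open>SN \<equiv> generated_space M {0..} (count_space UNIV) N\<close>
abbreviation \<open>SH \<equiv> generated_space M {1..} borel \<eta>\<close>
abbreviation \<open>At \<equiv> {\<omega> \<in> space M. N t \<omega> = k}\<close>

lemma N_measurable: "0 \<le> s \<Longrightarrow> N s \<in> measurable M (count_space UNIV)"
  using N by (simp add: counting_process_def)

lemma indep3:
  assumes "A1 \<in> sets SB" "A2 \<in> sets SN" "A3 \<in> sets SH"
  shows "prob (A1 \<inter> A2 \<inter> A3) = prob A1 * prob A2 * prob A3"
proof -
  have "indep_sets (\<lambda>j. [sets SB, sets SN, sets SH] ! j) {..<3}"
    using ind by (simp add: mutually_independent_def sets_generated_space)
  note I3 = this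
  have mem: "\<forall>j\<in>{0, 1, 2::nat}. [A1, A2, A3] ! j \<in> [sets SB, sets SN, sets SH] ! j" using assms by simp
  have "prob (\<Inter>j\<in>{0, 1, 2::nat}. [A1, A2, A3] ! j) = (\<Prod>j\<in>{0, 1, 2::nat}. prob ([A1, A2, A3] ! j))"
    by (rule indep_setsD[OF I3 _ _ _ mem]) auto
  then show ?thesis by (simp add: Int_assoc)
qed

lemma subalg: "sets SB \<subseteq> events" "sets SN \<subseteq> events" "sets SH \<subseteq> events"
proof -
  show "sets SB \<subseteq> events"
    unfolding sets_generated_space generated_events_def
    by (rule sets.sigma_sets_subset) (auto intro: measurable_sets[OF brownian_motionD(1)[OF B]])
  show "sets SN \<subseteq> events"
    unfolding sets_generated_space generated_events_def
    by (rule sets.sigma_sets_subset) (auto intro: measurable_sets[OF N_measurable])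
  show "sets SH \<subseteq> events"
    unfolding sets_generated_space generated_events_def
    by (rule sets.sigma_sets_subset) (auto intro: measurable_sets[OF \<eta>])
qed

lemma path_SB: "path \<in> measurable SB path_measure"
proof (rule measurable_path_measure)
  show "(\<lambda>\<omega>. path \<omega> u) \<in> borel_measurable SB" if "0 \<le> u" for u
    unfolding path_def using that by (intro generated_space_measurable brownian_motionD(1)[OF B]) auto
qed (simp add: path_paths)

lemma jump_vec_SN: "jump_vec N k \<in> measurable SN VK"
  by (rule jump_vec_measurable[OF counting_process_generated[OF N]])

lemma height_vec_SH: "height_vec \<eta> k \<in> measurable SH VK"
  by (rule height_vec_measurable) (auto intro!: generated_space_measurable \<eta>)

lemma At_SN: "At \<in> sets SN"
proof -
  have "N t \<in> measurable SN (count_space UNIV)"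
    using t by (intro generated_space_measurable N_measurable) auto
  from measurable_sets[OF this, of "{k}"] show ?thesis by (simp add: vimage_def Int_def conj_commute)
qed

lemma from_subalg:
  assumes "f \<in> measurable S K" "sets S \<subseteq> events" "space S = space M"
  shows "f \<in> measurable M K"
  using assms by (auto simp: measurable_def)

lemma jump_vec_M: "jump_vec N k \<in> measurable M VK"
  by (rule from_subalg[OF jump_vec_SN subalg(2)]) simp

lemma height_vec_M: "height_vec \<eta> k \<in> measurable M VK"
  by (rule from_subalg[OF height_vec_SH subalg(3)]) simp

lemma At_events: "At \<in> events" using At_SN subalg(2) by blast

text \<open>The event \<open>N t = k\<close> and the jump times both belong to the sigma-algebra of
  \<open>N\<close>, so their intersection is still independent of path and heights.\<close>

lemma prob_At_path:
  assumes C: "C \<in> sets VK" and H: "H \<in> sets VK" and G: "G \<in> sets path_measure"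
  shows "prob (At \<inter> (path -` G \<inter> space M) \<inter> ((jump_vec N k -` C \<inter> space M) \<inter> (height_vec \<eta> k -` H \<inter> space M)))
    = measure W G * prob (At \<inter> (jump_vec N k -` C \<inter> space M)) * prob (height_vec \<eta> k -` H \<inter> space M)"
proof -
  have 1: "path -` G \<inter> space M \<in> sets SB" using measurable_sets[OF path_SB G] by simp
  have 2: "At \<inter> (jump_vec N k -` C \<inter> space M) \<in> sets SN"
    using sets.Int[OF At_SN measurable_sets[OF jump_vec_SN C]] by (simp only: space_generated_space)
  have 3: "height_vec \<eta> k -` H \<inter> space M \<in> sets SH" using measurable_sets[OF height_vec_SH H] by simp
  have "measure W G = prob (path -` G \<inter> space M)" unfolding W_def by (rule measure_distr[OF path_measurable G])
  moreover have "At \<inter> (path -` G \<inter> space M) \<inter> ((jump_vec N k -` C \<inter> space M) \<inter> (height_vec \<eta> k -` H \<inter> space M))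
    = (path -` G \<inter> space M) \<inter> (At \<inter> (jump_vec N k -` C \<inter> space M)) \<inter> (height_vec \<eta> k -` H \<inter> space M)" by blast
  ultimately show ?thesis using indep3[OF 1 2 3] by simp
qed

abbreviation \<open>TL \<equiv> jump_time_law M N k t\<close>
abbreviation \<open>HL \<equiv> jump_height_law M \<eta> k\<close>

lemma TL_eq: "TL = distr (uniform_measure M At) VK (jump_vec N k)"
  by (simp add: jump_time_law_def jump_vec_def[abs_def])

lemma HL_eq: "HL = distr M VK (height_vec \<eta> k)"
  by (simp add: jump_height_law_def height_vec_def[abs_def])

lemma prob_space_uniform: "E \<in> events \<Longrightarrow> 0 < prob E \<Longrightarrow> prob_space (uniform_measure M E)"
  by (rule prob_space_uniform_measure) (simp_all add: emeasure_eq_measure)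

lemma uniform_prob:
  "E \<in> events \<Longrightarrow> 0 < prob E \<Longrightarrow> A \<in> events \<Longrightarrow> measure (uniform_measure M E) A = prob (E \<inter> A) / prob E"
  by (rule measure_uniform_measure) (simp_all add: emeasure_eq_measure)

lemma sets_TL[simp]: "sets TL = sets VK" and sets_HL[simp]: "sets HL = sets VK"
  by (simp_all add: TL_eq HL_eq)

lemma prob_space_TL: "prob_space TL"
  unfolding TL_eq using jump_vec_M
  by (intro prob_space.prob_space_distr[OF prob_space_uniform[OF At_events pos_k]]) simp

lemma prob_space_HL: "prob_space HL"
  unfolding HL_eq by (rule prob_space_distr[OF height_vec_M])

lemma measure_TL:
  assumes "C \<in> sets VK"
  shows "measure TL C = prob (At \<inter> (jump_vec N k -` C \<inter> space M)) / prob At"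
proof -
  have "measure TL C = measure (uniform_measure M At) (jump_vec N k -` C \<inter> space M)"
    unfolding TL_eq using jump_vec_M assms by (subst measure_distr) simp_all
  also have "\<dots> = prob (At \<inter> (jump_vec N k -` C \<inter> space M)) / prob At"
    by (rule uniform_prob[OF At_events pos_k measurable_sets[OF jump_vec_M assms]])
  finally show ?thesis .
qed

lemma measure_HL: "H \<in> sets VK \<Longrightarrow> measure HL H = prob (height_vec \<eta> k -` H \<inter> space M)"
  unfolding HL_eq by (rule measure_distr[OF height_vec_M])

lemma prob_At_Int_path:
  assumes G: "G \<in> sets path_measure"
  shows "prob (At \<inter> (path -` G \<inter> space M)) = prob At * measure W G"
proof -
  have sp: "jump_vec N k -` space VK \<inter> space M = space M" "height_vec \<eta> k -` space VK \<inter> space M = space M"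
    using measurable_space[OF jump_vec_M] measurable_space[OF height_vec_M] by blast+
  have "At \<inter> (path -` G \<inter> space M) \<inter> (space M \<inter> space M) = At \<inter> (path -` G \<inter> space M)" "At \<inter> space M = At" by blast+
  with prob_At_path[OF sets.top sets.top G, unfolded sp] show ?thesis by (simp add: prob_space)
qed

text \<open>Conditioning on an event of the Brownian path does not change the joint law of jump times
  and heights; this reduces the independence of three processes to rectangles.\<close>

lemma times_heights_law:
  assumes G: "G \<in> sets path_measure" and pos: "0 < measure W G"
  defines "E \<equiv> At \<inter> (path -` G \<inter> space M)"
  shows "distr (uniform_measure M E) (VK \<Otimes>\<^sub>M VK) (\<lambda>\<omega>. (jump_vec N k \<omega>, height_vec \<eta> k \<omega>)) = TL \<Otimes>\<^sub>M HL"
proof -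
  interpret TL: prob_space TL by (rule prob_space_TL)
  interpret HL: prob_space HL by (rule prob_space_HL)
  have E: "E \<in> events" unfolding E_def using At_events measurable_sets[OF path_measurable G] by (rule sets.Int)
  have pE: "prob E = prob At * measure W G" unfolding E_def by (rule prob_At_Int_path[OF G])
  then have pE0: "0 < prob E" using pos pos_k by simp
  interpret U: prob_space "uniform_measure M E" by (rule prob_space_uniform[OF E pE0])
  have m: "(\<lambda>\<omega>. (jump_vec N k \<omega>, height_vec \<eta> k \<omega>)) \<in> measurable M (VK \<Otimes>\<^sub>M VK)"
    by (intro measurable_Pair jump_vec_M height_vec_M)
  have "TL \<Otimes>\<^sub>M HL = distr (uniform_measure M E) (VK \<Otimes>\<^sub>M VK) (\<lambda>\<omega>. (jump_vec N k \<omega>, height_vec \<eta> k \<omega>))"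
  proof (rule pair_measure_eqI)
    show "sigma_finite_measure TL" "sigma_finite_measure HL" ..
    show "sets (TL \<Otimes>\<^sub>M HL) = sets (distr (uniform_measure M E) (VK \<Otimes>\<^sub>M VK) (\<lambda>\<omega>. (jump_vec N k \<omega>, height_vec \<eta> k \<omega>)))"
      by (simp add: sets_pair_measure_cong[OF sets_TL sets_HL])
    fix C H assume "C \<in> sets TL" "H \<in> sets HL"
    then have CH: "C \<in> sets VK" "H \<in> sets VK" by simp_all
    let ?D = "distr (uniform_measure M E) (VK \<Otimes>\<^sub>M VK) (\<lambda>\<omega>. (jump_vec N k \<omega>, height_vec \<eta> k \<omega>))"
    interpret D: prob_space ?D using m by (intro U.prob_space_distr) simp
    have "measure ?D (C \<times> H) = measure (uniform_measure M E) ((\<lambda>\<omega>. (jump_vec N k \<omega>, height_vec \<eta> k \<omega>)) -` (C \<times> H) \<inter> space M)"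
      using m CH by (subst measure_distr) simp_all
    also have "(\<lambda>\<omega>. (jump_vec N k \<omega>, height_vec \<eta> k \<omega>)) -` (C \<times> H) \<inter> space M
      = (jump_vec N k -` C \<inter> space M) \<inter> (height_vec \<eta> k -` H \<inter> space M)" by auto
    also have "measure (uniform_measure M E) \<dots> = prob (E \<inter> \<dots>) / prob E"
      by (intro uniform_prob[OF E pE0] sets.Int measurable_sets[OF jump_vec_M] measurable_sets[OF height_vec_M] CH)
    also have "\<dots> = measure TL C * measure HL H"
      unfolding E_def prob_At_path[OF CH G] unfolding E_def[symmetric] pE measure_TL[OF CH(1)] measure_HL[OF CH(2)]
      using pos by simp
    finally show "emeasure TL C * emeasure HL H = emeasure ?D (C \<times> H)"
      unfolding TL.emeasure_eq_measure HL.emeasure_eq_measure D.emeasure_eq_measure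
      by (simp only: ennreal_mult'' measure_nonneg)
  qed
  then show ?thesis ..
qed

text \<open>Given that the path lies in \<open>G\<close>, the law of times and heights is known from
  \<open>times_heights_law\<close>; multiplying by the probability of \<open>G\<close> yields
  rectangles \<open>R \<times> G\<close> with arbitrary measurable \<open>R\<close>. If
  \<open>G\<close> is a null set, both sides vanish.\<close>

lemma joint_law:
  "distr (uniform_measure M At) ((VK \<Otimes>\<^sub>M VK) \<Otimes>\<^sub>M path_measure) (\<lambda>\<omega>. ((jump_vec N k \<omega>, height_vec \<eta> k \<omega>), path \<omega>))
    = (TL \<Otimes>\<^sub>M HL) \<Otimes>\<^sub>M W"
proof -
  interpret TL: prob_space TL by (rule prob_space_TL)
  interpret HL: prob_space HL by (rule prob_space_HL)
  interpret W: prob_space W by (rule prob_space_W)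
  interpret TH: pair_prob_space TL HL ..
  interpret U: prob_space "uniform_measure M At" by (rule prob_space_uniform[OF At_events pos_k])
  let ?V = "\<lambda>\<omega>. (jump_vec N k \<omega>, height_vec \<eta> k \<omega>)"
  have m: "?V \<in> measurable M (VK \<Otimes>\<^sub>M VK)"
    by (intro measurable_Pair jump_vec_M height_vec_M)
  have m': "(\<lambda>\<omega>. (?V \<omega>, path \<omega>)) \<in> measurable M ((VK \<Otimes>\<^sub>M VK) \<Otimes>\<^sub>M path_measure)"
    by (intro measurable_Pair m path_measurable)
  let ?D = "distr (uniform_measure M At) ((VK \<Otimes>\<^sub>M VK) \<Otimes>\<^sub>M path_measure) (\<lambda>\<omega>. (?V \<omega>, path \<omega>))"
  interpret D: prob_space ?D using m' by (intro U.prob_space_distr) simp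
  have setsTH: "sets (TL \<Otimes>\<^sub>M HL) = sets (VK \<Otimes>\<^sub>M VK)" by (rule sets_pair_measure_cong) simp_all
  have "(TL \<Otimes>\<^sub>M HL) \<Otimes>\<^sub>M W = ?D"
  proof (rule pair_measure_eqI)
    show "sigma_finite_measure (TL \<Otimes>\<^sub>M HL)" "sigma_finite_measure W" ..
    show "sets ((TL \<Otimes>\<^sub>M HL) \<Otimes>\<^sub>M W) = sets ?D"
      using sets_pair_measure_cong[OF setsTH sets_W] by simp
    fix R G assume "R \<in> sets (TL \<Otimes>\<^sub>M HL)" "G \<in> sets W"
    then have R: "R \<in> sets (VK \<Otimes>\<^sub>M VK)" and G: "G \<in> sets path_measure" by (simp_all add: setsTH)
    let ?E = "At \<inter> (path -` G \<inter> space M)"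
    have mR: "?V -` R \<inter> space M \<in> events" by (rule measurable_sets[OF m R])
    have mG: "path -` G \<inter> space M \<in> events" by (rule measurable_sets[OF path_measurable G])
    have E: "?E \<in> events" using At_events mG by (rule sets.Int)
    have "measure ?D (R \<times> G) = measure (uniform_measure M At) ((\<lambda>\<omega>. (?V \<omega>, path \<omega>)) -` (R \<times> G) \<inter> space M)"
      using m' R G by (subst measure_distr) simp_all
    also have "(\<lambda>\<omega>. (?V \<omega>, path \<omega>)) -` (R \<times> G) \<inter> space M = (path -` G \<inter> space M) \<inter> (?V -` R \<inter> space M)" by auto
    also have "measure (uniform_measure M At) \<dots> = prob (At \<inter> \<dots>) / prob At"
      by (rule uniform_prob[OF At_events pos_k sets.Int[OF mG mR]])
    also have "At \<inter> ((path -` G \<inter> space M) \<inter> (?V -` R \<inter> space M)) = ?E \<inter> (?V -` R \<inter> space M)" by blast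
    also have "prob \<dots> / prob At = measure (TL \<Otimes>\<^sub>M HL) R * measure W G"
    proof (cases "0 < measure W G")
      case True
      have pE: "prob ?E = prob At * measure W G" by (rule prob_At_Int_path[OF G])
      then have pE0: "0 < prob ?E" using True pos_k by simp
      have "measure (TL \<Otimes>\<^sub>M HL) R = measure (uniform_measure M ?E) (?V -` R \<inter> space M)"
        unfolding times_heights_law[OF G True, symmetric] using m R by (subst measure_distr) simp_all
      also have "\<dots> = prob (?E \<inter> (?V -` R \<inter> space M)) / prob ?E" by (rule uniform_prob[OF E pE0 mR])
      finally show ?thesis using True pos_k by (simp add: pE)
    next
      case False
      then have "measure W G = 0" by (simp add: zero_less_measure_iff)
      then have "prob ?E = 0" using prob_At_Int_path[OF G] by simp
      moreover have "prob (?E \<inter> (?V -` R \<inter> space M)) \<le> prob ?E" using E by (intro finite_measure_mono) auto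
      ultimately have "prob (?E \<inter> (?V -` R \<inter> space M)) = 0" 
        using measure_nonneg[of M "?E \<inter> (?V -` R \<inter> space M)"] by linarith
      then show ?thesis using \<open>measure W G = 0\<close> by simp
    qed
    finally show "emeasure (TL \<Otimes>\<^sub>M HL) R * emeasure W G = emeasure ?D (R \<times> G)"
      unfolding TH.emeasure_eq_measure W.emeasure_eq_measure D.emeasure_eq_measure
      by (simp only: ennreal_mult'' measure_nonneg)
  qed
  then show ?thesis ..
qed

lemma tube_measurable:
  "Measurable.pred ((VK \<Otimes>\<^sub>M VK) \<Otimes>\<^sub>M path_measure) (\<lambda>z. tube a b c d k t (fst (fst z)) (snd (fst z)) (snd z))"
proof (rule pred_tube)
  fix i assume i: "i \<in> {1..k}"
  show "(\<lambda>z. fst (fst z) i) \<in> borel_measurable ((VK \<Otimes>\<^sub>M VK) \<Otimes>\<^sub>M path_measure)"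
    by (rule measurable_compose[OF measurable_compose[OF measurable_fst measurable_fst] measurable_component_singleton[OF i]])
  show "(\<lambda>z. snd (fst z) i) \<in> borel_measurable ((VK \<Otimes>\<^sub>M VK) \<Otimes>\<^sub>M path_measure)"
    by (rule measurable_compose[OF measurable_compose[OF measurable_fst measurable_snd] measurable_component_singleton[OF i]])
qed (rule measurable_snd)

text \<open>Fubini under the joint law. The second claim is recorded because integrands over the
  jump times will be compared almost everywhere, which asks for measurability; it comes from the
  tube event instead of \<open>theta\<close>.\<close>

lemma tube_prob:
  fixes a b c d :: real
  defines "Q \<equiv> \<lambda>s h. measure W {w \<in> space W. tube a b c d k t s h w}"
  shows "prob {\<omega> \<in> space M. N t \<omega> = k \<and> tube a b c d k t (jump_vec N k \<omega>) (height_vec \<eta> k \<omega>) (path \<omega>)}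
      = prob At * (LINT s|TL. LINT h|HL. Q s h)"
    and "(\<lambda>s. LINT h|HL. Q s h) \<in> borel_measurable VK"
proof -
  interpret TL: prob_space TL by (rule prob_space_TL)
  interpret HL: prob_space HL by (rule prob_space_HL)
  interpret W: prob_space W by (rule prob_space_W)
  interpret TH: pair_prob_space TL HL ..
  interpret P: pair_prob_space "TL \<Otimes>\<^sub>M HL" W ..
  let ?V = "\<lambda>\<omega>. (jump_vec N k \<omega>, height_vec \<eta> k \<omega>)"
  let ?S = "(VK \<Otimes>\<^sub>M VK) \<Otimes>\<^sub>M path_measure"
  let ?P = "\<lambda>z. tube a b c d k t (fst (fst z)) (snd (fst z)) (snd z)"
  let ?T = "{z \<in> space ?S. ?P z}"
  have setsTH: "sets (TL \<Otimes>\<^sub>M HL) = sets (VK \<Otimes>\<^sub>M VK)" by (rule sets_pair_measure_cong) simp_all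
  have setsS: "sets ((TL \<Otimes>\<^sub>M HL) \<Otimes>\<^sub>M W) = sets ?S" by (rule sets_pair_measure_cong[OF setsTH]) simp
  have T: "?T \<in> sets ?S" by (rule predE[OF tube_measurable])
  have m': "(\<lambda>\<omega>. (?V \<omega>, path \<omega>)) \<in> measurable M ?S"
    by (intro measurable_Pair jump_vec_M height_vec_M path_measurable)
  then have m'': "(\<lambda>\<omega>. (?V \<omega>, path \<omega>)) \<in> measurable (uniform_measure M At) ?S" by simp
  have Tm: "(indicator ?T :: _ \<Rightarrow> real) \<in> borel_measurable ((TL \<Otimes>\<^sub>M HL) \<Otimes>\<^sub>M W)"
    using T setsS by (intro borel_measurable_indicator) simp
  have int: "integrable ((TL \<Otimes>\<^sub>M HL) \<Otimes>\<^sub>M W) (indicator ?T :: _ \<Rightarrow> real)"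
    by (rule P.integrable_const_bound[where B=1]) (use Tm in \<open>auto simp: indicator_def\<close>)
  have spTH: "space (TL \<Otimes>\<^sub>M HL) = space (VK \<Otimes>\<^sub>M VK)" by (rule sets_eq_imp_space_eq[OF setsTH])
  have inner: "(LINT w|W. indicator ?T (p, w)) = Q (fst p) (snd p)" if "p \<in> space (TL \<Otimes>\<^sub>M HL)" for p
  proof -
    have "(p, w) \<in> space ?S \<longleftrightarrow> w \<in> space W" for w
      using that unfolding spTH space_pair_measure[of "VK \<Otimes>\<^sub>M VK" path_measure] by simp
    then have "{w \<in> space W. ?P (p, w)} = Pair p -` ?T" by auto
    moreover have "Pair p -` ?T \<in> sets W" using sets_Pair1[OF T, of p] by simp
    moreover have "(LINT w|W. indicator ?T (p, w)) = (LINT w|W. indicator (Pair p -` ?T) w :: real)"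
      by (intro Bochner_Integration.integral_cong) (auto simp: indicator_def)
    ultimately show ?thesis
      using sets.sets_into_space[of "Pair p -` ?T" W] by (simp add: Q_def Int_absorb2)
  qed
  have Qm: "(\<lambda>p. Q (fst p) (snd p)) \<in> borel_measurable (TL \<Otimes>\<^sub>M HL)"
  proof -
    have "(\<lambda>p. LINT w|W. indicator ?T (p, w) :: real) \<in> borel_measurable (TL \<Otimes>\<^sub>M HL)"
      using Tm by (intro W.borel_measurable_lebesgue_integral) (simp add: case_prod_beta')
    moreover have "(\<lambda>p. LINT w|W. indicator ?T (p, w) :: real) \<in> borel_measurable (TL \<Otimes>\<^sub>M HL)
      \<longleftrightarrow> (\<lambda>p. Q (fst p) (snd p)) \<in> borel_measurable (TL \<Otimes>\<^sub>M HL)"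
      by (rule measurable_cong) (rule inner)
    ultimately show ?thesis by blast
  qed
  have Qint: "integrable (TL \<Otimes>\<^sub>M HL) (\<lambda>p. Q (fst p) (snd p))"
    by (rule TH.integrable_const_bound[where B=1]) (use Qm in \<open>auto simp: Q_def\<close>)
  show "(\<lambda>s. LINT h|HL. Q s h) \<in> borel_measurable VK"
  proof -
    have "(\<lambda>s. LINT h|HL. Q s h) \<in> borel_measurable TL"
      using Qm by (intro HL.borel_measurable_lebesgue_integral) (simp add: case_prod_beta')
    then show ?thesis by (simp cong: measurable_cong_sets)
  qed
  define F where "F \<omega> = (?V \<omega>, path \<omega>)" for \<omega>
  define R where "R = ?T"
  have F: "F \<in> measurable (uniform_measure M At) ?S" "F \<in> measurable M ?S"
    unfolding F_def using m' m'' by blast+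
  have R: "R \<in> sets ?S" unfolding R_def by (rule T)
  have "F \<omega> \<in> R \<longleftrightarrow> tube a b c d k t (jump_vec N k \<omega>) (height_vec \<eta> k \<omega>) (path \<omega>)" if "\<omega> \<in> space M" for \<omega>
    using measurable_space[OF F(2) that] by (simp add: R_def F_def)
  then have ev: "{\<omega> \<in> space M. N t \<omega> = k \<and> tube a b c d k t (jump_vec N k \<omega>) (height_vec \<eta> k \<omega>) (path \<omega>)}
    = At \<inter> (F -` R \<inter> space M)" by blast
  have "prob (At \<inter> (F -` R \<inter> space M)) = prob At * measure (uniform_measure M At) (F -` R \<inter> space M)"
    using uniform_prob[OF At_events pos_k measurable_sets[OF F(2) R]] pos_k by simp
  also have "measure (uniform_measure M At) (F -` R \<inter> space M) = measure (distr (uniform_measure M At) ?S F) R"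
    using measure_distr[OF F(1) R] by simp
  also have "distr (uniform_measure M At) ?S F = (TL \<Otimes>\<^sub>M HL) \<Otimes>\<^sub>M W"
    unfolding F_def by (rule joint_law)
  also have "measure ((TL \<Otimes>\<^sub>M HL) \<Otimes>\<^sub>M W) R = (LINT z|((TL \<Otimes>\<^sub>M HL) \<Otimes>\<^sub>M W). indicator R z)"
    using sets.sets_into_space[OF R] sets_eq_imp_space_eq[OF setsS] by (simp add: Int_absorb2)
  also have "\<dots> = (LINT z|((TL \<Otimes>\<^sub>M HL) \<Otimes>\<^sub>M W). indicator ?T z)" unfolding R_def ..
  also have "\<dots> = (LINT p|(TL \<Otimes>\<^sub>M HL). LINT w|W. indicator ?T (p, w))"
    by (rule P.integral_fst'[OF int, symmetric])
  also have "\<dots> = (LINT p|(TL \<Otimes>\<^sub>M HL). Q (fst p) (snd p))"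
    by (intro Bochner_Integration.integral_cong refl inner)
  also have "\<dots> = (LINT s|TL. LINT h|HL. Q s h)"
    using TH.integral_fst'[OF Qint] by simp
  finally show "prob {\<omega> \<in> space M. N t \<omega> = k \<and> tube a b c d k t (jump_vec N k \<omega>) (height_vec \<eta> k \<omega>) (path \<omega>)}
      = prob At * (LINT s|TL. LINT h|HL. Q s h)" unfolding ev .
qed

end

section \<open>Summation over the number of jumps\<close>

context jump_setting begin

text \<open>On the simplex the iterated integral equals a tube probability for every
  \<open>s\<close> and \<open>h\<close>, so it is exchanged pointwise under the indicator, without
  measurability in \<open>s\<close> or \<open>h\<close>. \<open>support\<close> then removes the
  indicator.\<close>

lemma summand_eq:
  fixes a b c d :: real
  assumes pos: "\<And>u. 0 \<le> u \<Longrightarrow> - (c * u + d) < a * u + b"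
    and support: "AE s in TL. s \<in> jump_simplex k t"
  shows "(LINT s:jump_simplex k t|TL. LINT h|HL.
         (let w = waiting_time s;
              b' = b_seq a b w h;
              d' = d_seq c d w h
          in iterated_integral (\<lambda>i. interval_measure (Phi (w i)))
               (alpha_seq c d w h) (beta_seq a b w h) k
               (\<lambda>x. (\<Prod>i=1..k.
                        1 - theta M B (b' x i) a (- d' x i) (- c) (w i) (x i)
                          - theta M B (d' x i) c (- b' x i) (- a) (w i) (- x i)) *
                    (1 - chi M B (b' x (k + 1)) a (- d' x (k + 1)) (- c) (t - (\<Sum>i=1..k. w i))
                       - chi M B (d' x (k + 1)) c (- b' x (k + 1)) (- a) (t - (\<Sum>i=1..k. w i))))
               (\<lambda>_. 0)))
    = (LINT s|TL. LINT h|HL. measure W {w \<in> space W. tube a b c d k t s h w})"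
    (is "(LINT s:_|_. LINT h|_. ?I s h) = (LINT s|_. ?Q s)")
proof -
  have I: "?I s h = measure W {w \<in> space W. tube a b c d k t s h w}" if "s \<in> jump_simplex k t" for s h
    unfolding Let_def by (rule iterated_integral_tube[OF jump_simplex_knots[OF that t] pos])
  have "(LINT s:jump_simplex k t|TL. LINT h|HL. ?I s h) = (LINT s|TL. indicator (jump_simplex k t) s *\<^sub>R ?Q s)"
    unfolding set_lebesgue_integral_def
  proof (rule Bochner_Integration.integral_cong[OF refl])
    fix s
    have "(LINT h|HL. ?I s h) = ?Q s" if "s \<in> jump_simplex k t"
      by (rule Bochner_Integration.integral_cong[OF refl I[OF that]])
    then show "indicator (jump_simplex k t) s *\<^sub>R (LINT h|HL. ?I s h) = indicator (jump_simplex k t) s *\<^sub>R ?Q s"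
      by (cases "s \<in> jump_simplex k t") (simp_all only: indicator_simps scaleR_zero_left not_False_eq_True)
  qed
  also have "\<dots> = (LINT s|TL. ?Q s)"
  proof (rule integral_cong_AE)
    have Q: "?Q \<in> borel_measurable TL"
      using tube_prob(2)[of a b c d] by (simp cong: measurable_cong_sets)
    then show "?Q \<in> borel_measurable TL" .
    have "(indicator (jump_simplex k t) :: _ \<Rightarrow> real) \<in> borel_measurable TL"
      using jump_simplex_sets[of k t] by (intro borel_measurable_indicator) simp
    then show "(\<lambda>s. indicator (jump_simplex k t) s *\<^sub>R ?Q s) \<in> borel_measurable TL"
      using Q by (rule borel_measurable_scaleR)
    show "AE s in TL. indicator (jump_simplex k t) s *\<^sub>R ?Q s = ?Q s"
      using support by eventually_elim simp
  qed
  finally show ?thesis .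
qed

end

theorem theorem2p3:
  fixes M :: "'a measure"
    and B :: "real \<Rightarrow> 'a \<Rightarrow> real"
    and N :: "real \<Rightarrow> 'a \<Rightarrow> nat"
    and \<eta> :: "nat \<Rightarrow> 'a \<Rightarrow> real"
    and X :: "real \<Rightarrow> 'a \<Rightarrow> real"
    and a b c d t :: real
  assumes "prob_space M"
    and "standard_brownian_motion M B"
    and "counting_process M N"
    and "\<And>i. i \<ge> 1 \<Longrightarrow> \<eta> i \<in> borel_measurable M"
    and "mutually_independent M B N \<eta>"
    and support: "\<And>k u. u > 0 \<Longrightarrow> AE s in jump_time_law M N k u. s \<in> jump_simplex k u"
    and X: "\<And>s \<omega>. X s \<omega> = B s \<omega> + (\<Sum>i=1..N s \<omega>. \<eta> i \<omega>)"
    and "b > 0" and "d > 0"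
    and "\<And>s. s > 0 \<Longrightarrow> a * s + b > - (c * s + d)"
    and "t > 0"
  shows "(\<lambda>k.
      measure M {\<omega> \<in> space M. N t \<omega> = k} *
      (LINT s:jump_simplex k t|jump_time_law M N k t.
        LINT h|jump_height_law M \<eta> k.
         (let w = waiting_time s;
              b' = b_seq a b w h;
              d' = d_seq c d w h
          in iterated_integral (\<lambda>i. interval_measure (Phi (w i)))
               (alpha_seq c d w h) (beta_seq a b w h) k
               (\<lambda>x. (\<Prod>i=1..k.
                        1 - theta M B (b' x i) a (- d' x i) (- c) (w i) (x i)
                          - theta M B (d' x i) c (- b' x i) (- a) (w i) (- x i)) *
                    (1 - chi M B (b' x (k + 1)) a (- d' x (k + 1)) (- c) (t - (\<Sum>i=1..k. w i))
                       - chi M B (d' x (k + 1)) c (- b' x (k + 1)) (- a) (t - (\<Sum>i=1..k. w i))))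
               (\<lambda>_. 0))))
    sums measure M {\<omega> \<in> space M. \<forall>s\<in>{0..<t}. - (c * s + d) < X s \<omega> \<and> X s \<omega> < a * s + b}"
proof -
  interpret prob_space M by fact
  interpret brownian_space M B by unfold_locales fact
  note N = \<open>counting_process M N\<close>
  \<comment> \<open>The separation of the lines is assumed for positive times; at 0 it is the
    positivity of \<open>b\<close> and \<open>d\<close>.\<close>
  have pos: "- (c * u + d) < a * u + b" if "0 \<le> u" for u
    using assms(10)[of u] that \<open>b > 0\<close> \<open>d > 0\<close> by (cases "u = 0") auto
  let ?E = "{\<omega> \<in> space M. \<forall>s\<in>{0..<t}. - (c * s + d) < X s \<omega> \<and> X s \<omega> < a * s + b}"
  let ?E' = "\<lambda>k. {\<omega> \<in> space M. N t \<omega> = k \<and> tube a b c d k t (jump_vec N k \<omega>) (height_vec \<eta> k \<omega>) (path \<omega>)}"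
  have Nt: "{\<omega> \<in> space M. N t \<omega> = k} \<in> events" for k
  proof -
    have "N t \<in> measurable M (count_space UNIV)" using N \<open>t > 0\<close> by (simp add: counting_process_def)
    from measurable_sets[OF this, of "{k}"] show ?thesis by (simp add: vimage_def Int_def conj_commute)
  qed
  have E'_sets: "?E' k \<in> events" for k
  proof -
    have jm: "jump_vec N k \<in> measurable M (Pi\<^sub>M {1..k} (\<lambda>_. borel))" by (rule jump_vec_measurable[OF N])
    have hm: "height_vec \<eta> k \<in> measurable M (Pi\<^sub>M {1..k} (\<lambda>_. borel))"
      by (rule height_vec_measurable) (rule assms(4))
    have "Measurable.pred M (\<lambda>\<omega>. tube a b c d k t (jump_vec N k \<omega>) (height_vec \<eta> k \<omega>) (path \<omega>))"
      by (intro pred_tube path_measurable measurable_compose[OF jm measurable_component_singleton]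
          measurable_compose[OF hm measurable_component_singleton])
    from sets.Int[OF Nt[of k] predE[OF this]] show ?thesis
      by (simp add: Int_def conj_ac cong: conj_cong)
  qed
  have E_iff: "\<omega> \<in> ?E \<longleftrightarrow> \<omega> \<in> ?E' (N t \<omega>)" if \<omega>: "\<omega> \<in> space M" for \<omega>
    using strip_iff_tube[where N=N and \<omega>=\<omega> and w="path \<omega>" and h="\<lambda>i. \<eta> i \<omega>" and a=a and b=b and c=c and d=d,
        OF counting_process_path[OF N \<omega>] \<open>t > 0\<close> refl] \<omega>
    by (simp add: X path_def jump_vec_def height_vec_def)
  \<comment> \<open>The strip event is split by the value of \<open>N t\<close>; each outcome can
    lie only in the piece indexed by its own count.\<close>
  have UN: "(\<Union>k. ?E' k) = ?E"
  proof (rule set_eqI)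
    fix \<omega>
    show "\<omega> \<in> (\<Union>k. ?E' k) \<longleftrightarrow> \<omega> \<in> ?E"
    proof (cases "\<omega> \<in> space M")
      case True
      have "\<omega> \<in> (\<Union>k. ?E' k) \<longleftrightarrow> \<omega> \<in> ?E' (N t \<omega>)" by auto
      then show ?thesis using E_iff[OF True] by (simp only:)
    qed auto
  qed
  have summand: "measure M {\<omega> \<in> space M. N t \<omega> = k} *
      (LINT s:jump_simplex k t|jump_time_law M N k t.
        LINT h|jump_height_law M \<eta> k.
         (let w = waiting_time s;
              b' = b_seq a b w h;
              d' = d_seq c d w h
          in iterated_integral (\<lambda>i. interval_measure (Phi (w i)))
               (alpha_seq c d w h) (beta_seq a b w h) k
               (\<lambda>x. (\<Prod>i=1..k.
                        1 - theta M B (b' x i) a (- d' x i) (- c) (w i) (x i)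
                          - theta M B (d' x i) c (- b' x i) (- a) (w i) (- x i)) *
                    (1 - chi M B (b' x (k + 1)) a (- d' x (k + 1)) (- c) (t - (\<Sum>i=1..k. w i))
                       - chi M B (d' x (k + 1)) c (- b' x (k + 1)) (- a) (t - (\<Sum>i=1..k. w i))))
               (\<lambda>_. 0))) = measure M (?E' k)" (is "_ * ?J = _") for k
  proof (cases "0 < measure M {\<omega> \<in> space M. N t \<omega> = k}")
    case True
    interpret J: jump_setting M B N \<eta> k t
      by unfold_locales (use N assms(4,5) \<open>t > 0\<close> True in auto)
    have "?J = (LINT s|jump_time_law M N k t. LINT h|jump_height_law M \<eta> k. measure W {w \<in> space W. tube a b c d k t s h w})"
      by (rule J.summand_eq[OF pos support[OF \<open>t > 0\<close>]])
    then show ?thesis using J.tube_prob(1)[of a b c d] by (simp only:)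
  next
    \<comment> \<open>If \<open>N t = k\<close> has probability zero, the factor in front makes the
      summand 0, and the event on the right is contained in a null event.\<close>
    case False
    then have 0: "measure M {\<omega> \<in> space M. N t \<omega> = k} = 0" by (simp add: zero_less_measure_iff)
    have "measure M (?E' k) \<le> measure M {\<omega> \<in> space M. N t \<omega> = k}"
      using Nt by (intro finite_measure_mono) auto
    with 0 measure_nonneg[of M "?E' k"] have "measure M (?E' k) = 0" by linarith
    with 0 show ?thesis by (simp only: mult_zero_left)
  qed
  have "(\<lambda>k. measure M (?E' k)) sums measure M (\<Union>k. ?E' k)"
    using E'_sets by (intro finite_measure_UNION) (auto simp: disjoint_family_on_def)
  then show ?thesis unfolding summand UN .
qed

end
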